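(* Let $V:\mathbb{Z}^d\to\mathbb{R}^+\cup\{+\infty\}$ be a strictly convex potential with $V(\vec 0)=0$, and assume $\alpha^*(V)<\infty$. Then for each $\alpha>\alpha^*(V)$ there exists a family of random permutations $(\zeta_\Lambda,\ \Lambda\subseteq\mathbb{Z}^d)$, defined on a common probability space, with $\zeta_\Lambda\in S_\Lambda$ for each $\Lambda$, such that: (i) for every finite $\Lambda$, $\zeta_\Lambda$ is distributed according to $G_\Lambda$ (the specification with identity boundary conditions at temperature $\alpha$); (ii) for each $x\in\mathbb{Z}^d$, $\lim_{\Lambda\nearrow\mathbb{Z}^d}\zeta_\Lambda(x)=\zeta_{\mathbb{Z}^d}(x)$ almost surely; consequently, calling $\mu$ the law of $\zeta_{\mathbb{Z}^d}$, $G_\Lambda\to\mu$ weakly as $\Lambda\nearrow\mathbb{Z}^d$; (iii) $\mu$ is a Gibbs measure at temperature $\alpha$, ergodic (with respect to spatial translations of $\mathbb{Z}^d$), with mean jump $\vec 0$ (the mean displacement $\sigma(x)-x$ under $\mu$ is $\vec0$); (iv) $\mu$ is the unique Gibbs measure for the specifications $G_\Lambda$ that is supported on the set of finite-cycle permutations of $\mathbb{Z}^d$.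
   Context: $S$ is the set of bijections $\sigma:\mathbb{Z}^d\to\mathbb{Z}^d$ with the product topology (generated by the sets $\{\sigma:\sigma(x)=y\}$) and Borel $\sigma$-algebra. For $\xi\in S$ and finite $\Lambda\subset\mathbb{Z}^d$, $S_{\Lambda|\xi}=\{\sigma\in S:\sigma(x)=\xi(x)\ \forall x\notin\Lambda\}$, and $S_\Lambda=S_{\Lambda|\mathrm{I}}$ with $\mathrm{I}$ the identity (for $\Lambda=\mathbb{Z}^d$, $S_{\mathbb{Z}^d}=S$). The Hamiltonian is $H_\Lambda(\sigma)=\sum_{x\in\Lambda}V(\sigma(x)-x)$, and for $\alpha>0$ the specification is $G_{\Lambda|\xi}(\sigma)=Z_{\Lambda|\xi}^{-1}\exp(-\alpha H_\Lambda(\sigma))$ for $\sigma\in S_{\Lambda|\xi}$, with $Z_{\Lambda|\xi}$ the normalizing constant; $G_\Lambda:=G_{\Lambda|\mathrm{I}}$. A probability measure $\mu$ on $S$ is a Gibbs measure at temperature $\alpha$ if for every finite $\Lambda$ and $\mu$-a.e. $\xi$, $\mu(\cdot\mid\sigma(x)=\xi(x),x\in\Lambda^c)=G_{\Lambda|\xi}$. A finite cycle of length $n\ge2$ on distinct sites $x_1,\dots,x_n$ is the permutation $\gamma$ with $\gamma(x_i)=x_{i+1}$ (indices mod $n$) and $\gamma(x)=x$ otherwise; its support is $\{\gamma\}=\{x_1,\dots,x_n\}$ and $|\gamma|=n$; infinite cycles are defined analogously with a doubly infinite sequence of distinct sites. Every permutation is a composition of disjoint cycles; it is finite-cycle if all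 these cycles are finite. $\Gamma$ is the set of finite cycles. The weight of $\gamma\in\Gamma$ is $w(\gamma)=\exp\{-\alpha\sum_{x\in\{\gamma\}}V(\gamma(x)-x)\}$, $\beta(V,\alpha)=\sum_{\gamma\in\Gamma,\ \vec0\in\{\gamma\}}|\gamma|\,w(\gamma)$, and $\alpha^*(V)=\inf\{\alpha:\beta(V,\alpha)<1\}$ (with $\alpha^*=\infty$ if $\beta(V,\alpha)=\infty$ for all $\alpha$). *)

theory Defs
  imports "HOL-Probability.Probability"
begin

text \<open>Sites of the lattice Z^d are functions 'd => int, 'd a finite index type with d = CARD('d).\<close>

type_synonym 'd site = "'d \<Rightarrow> int"
type_synonym 'd perm = "'d site \<Rightarrow> 'd site"

definition jump :: "'d site \<Rightarrow> 'd site \<Rightarrow> 'd site" where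
  "jump y x = (\<lambda>i. y i - x i)"

definition Sperm :: "'d perm set" where
  "Sperm = {\<sigma>. bij \<sigma>}"

definition Stop :: "'d perm topology" where
  "Stop = subtopology (product_topology (\<lambda>_. discrete_topology UNIV) UNIV) Sperm"

definition SM :: "'d perm measure" where
  "SM = sigma Sperm {U. openin Stop U}"

definition SL :: "'d site set \<Rightarrow> 'd perm \<Rightarrow> 'd perm set" where
  "SL \<Lambda> \<xi> = {\<sigma> \<in> Sperm. \<forall>x. x \<notin> \<Lambda> \<longrightarrow> \<sigma> x = \<xi> x}"

definition boltz :: "real \<Rightarrow> ennreal \<Rightarrow> real" where
  "boltz \<alpha> h = (if h = \<top> then 0 else exp (- \<alpha> * enn2real h))"

definition Ham :: "('d site \<Rightarrow> ennreal) \<Rightarrow> 'd site set \<Rightarrow> 'd perm \<Rightarrow> ennreal" where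
  "Ham V \<Lambda> \<sigma> = (\<Sum>x\<in>\<Lambda>. V (jump (\<sigma> x) x))"

definition Zpart :: "real \<Rightarrow> ('d site \<Rightarrow> ennreal) \<Rightarrow> 'd site set \<Rightarrow> 'd perm \<Rightarrow> real" where
  "Zpart \<alpha> V \<Lambda> \<xi> = (\<Sum>\<sigma>\<in>SL \<Lambda> \<xi>. boltz \<alpha> (Ham V \<Lambda> \<sigma>))"

definition Gspec :: "real \<Rightarrow> ('d site \<Rightarrow> ennreal) \<Rightarrow> 'd site set \<Rightarrow> 'd perm \<Rightarrow> 'd perm measure" where
  "Gspec \<alpha> V \<Lambda> \<xi> = measure_of Sperm (sets SM)
     (\<lambda>A. \<Sum>\<sigma>\<in>SL \<Lambda> \<xi> \<inter> A. ennreal (boltz \<alpha> (Ham V \<Lambda> \<sigma>) / Zpart \<alpha> V \<Lambda> \<xi>))"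

definition Fout :: "'d site set \<Rightarrow> 'd perm measure" where
  "Fout \<Lambda> = sigma Sperm {{\<sigma> \<in> Sperm. \<sigma> x = y} | x y. x \<notin> \<Lambda>}"

definition gibbs :: "real \<Rightarrow> ('d site \<Rightarrow> ennreal) \<Rightarrow> 'd perm measure \<Rightarrow> bool" where
  "gibbs \<alpha> V \<mu> \<longleftrightarrow> prob_space \<mu> \<and> sets \<mu> = sets SM \<and>
     (\<forall>\<Lambda>. finite \<Lambda> \<longrightarrow> (\<forall>A \<in> sets SM.
        AE \<xi> in \<mu>. real_cond_exp \<mu> (Fout \<Lambda>) (indicator A) \<xi> = measure (Gspec \<alpha> V \<Lambda> \<xi>) A))"

definition shift :: "'d site \<Rightarrow> 'd perm \<Rightarrow> 'd perm" where
  "shift z \<sigma> = (\<lambda>x. (\<lambda>i. \<sigma> (\<lambda>j. x j - z j) i + z i))"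

definition ergodic :: "'d perm measure \<Rightarrow> bool" where
  "ergodic \<mu> \<longleftrightarrow> (\<forall>z. distr \<mu> SM (shift z) = \<mu>) \<and>
     (\<forall>A \<in> sets SM. (\<forall>z. {\<sigma> \<in> Sperm. shift z \<sigma> \<in> A} = A) \<longrightarrow>
        emeasure \<mu> A = 0 \<or> emeasure \<mu> A = 1)"

definition mean_jump_zero :: "'d perm measure \<Rightarrow> bool" where
  "mean_jump_zero \<mu> \<longleftrightarrow> (\<forall>x i. integrable \<mu> (\<lambda>\<sigma>. real_of_int (\<sigma> x i - x i)) \<and>
      (\<integral>\<sigma>. real_of_int (\<sigma> x i - x i) \<partial>\<mu>) = 0)"

definition weak_conv_net :: "('d site set \<Rightarrow> 'd perm measure) \<Rightarrow> 'd perm measure \<Rightarrow> bool" where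
  "weak_conv_net G \<mu> \<longleftrightarrow> (\<forall>f. continuous_map Stop euclideanreal f \<and> (\<exists>B. \<forall>\<sigma>\<in>Sperm. \<bar>f \<sigma>\<bar> \<le> B) \<longrightarrow>
      ((\<lambda>\<Lambda>. \<integral>\<sigma>. f \<sigma> \<partial>G \<Lambda>) \<longlongrightarrow> (\<integral>\<sigma>. f \<sigma> \<partial>\<mu>)) (finite_subsets_at_top UNIV))"

definition cycle_through :: "'d perm \<Rightarrow> 'd site \<Rightarrow> 'd site set" where
  "cycle_through \<sigma> x = {(\<sigma> ^^ n) x | n. True} \<union> {(inv \<sigma> ^^ n) x | n. True}"

definition finite_cycle_perm :: "'d perm \<Rightarrow> bool" where
  "finite_cycle_perm \<sigma> \<longleftrightarrow> (\<forall>x. finite (cycle_through \<sigma> x))"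

definition is_finite_cycle :: "'d perm \<Rightarrow> bool" where
  "is_finite_cycle \<gamma> \<longleftrightarrow> (\<exists>xs. distinct xs \<and> 2 \<le> length xs \<and>
      (\<forall>i < length xs. \<gamma> (xs ! i) = xs ! (Suc i mod length xs)) \<and>
      (\<forall>x. x \<notin> set xs \<longrightarrow> \<gamma> x = x))"

definition csupp :: "'d perm \<Rightarrow> 'd site set" where
  "csupp \<gamma> = {x. \<gamma> x \<noteq> x}"

definition cweight :: "real \<Rightarrow> ('d site \<Rightarrow> ennreal) \<Rightarrow> 'd perm \<Rightarrow> real" where
  "cweight \<alpha> V \<gamma> = boltz \<alpha> (\<Sum>x\<in>csupp \<gamma>. V (jump (\<gamma> x) x))"

definition beta :: "('d site \<Rightarrow> ennreal) \<Rightarrow> real \<Rightarrow> ennreal" where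
  "beta V \<alpha> = (\<Sum>\<^sub>\<infinity>\<gamma>\<in>{\<gamma>. is_finite_cycle \<gamma> \<and> (\<lambda>_. 0) \<in> csupp \<gamma>}.
       of_nat (card (csupp \<gamma>)) * ennreal (cweight \<alpha> V \<gamma>))"

text \<open>alpha* = inf of temperatures alpha > 0 with beta < 1; Inf of the empty set is +infinity.\<close>
definition alpha_star :: "('d site \<Rightarrow> ennreal) \<Rightarrow> ereal" where
  "alpha_star V = Inf {ereal a | a. 0 < a \<and> beta V a < 1}"

definition strictly_convex_pot :: "('d site \<Rightarrow> ennreal) \<Rightarrow> bool" where
  "strictly_convex_pot V \<longleftrightarrow> (\<exists>f :: ('d \<Rightarrow> real) \<Rightarrow> ennreal.
     (\<forall>x y t. x \<noteq> y \<and> 0 < t \<and> t < 1 \<and> f x < \<top> \<and> f y < \<top> \<longrightarrow>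
        f (\<lambda>i. t * x i + (1 - t) * y i) < ennreal t * f x + ennreal (1 - t) * f y) \<and>
     (\<forall>z. V z = f (\<lambda>i. real_of_int (z i))))"

end

theory Submission
  imports Defs
begin

text \<open>
  A permutation drawn from the specification with identity boundary condition is a gas of disjoint cycles,
  so its law is determined by the void probabilities \<open>r(A)\<close> that all sites of a finite set \<open>A\<close> are fixed
  points. Decomposing according to the cycle through a site \<open>x\<close> gives a recursion for
  \<open>ln r(A) - ln r(A \<union> {x})\<close> which, since \<open>\<beta> < 1\<close>, is a contraction. Hence the void probabilities converge
  along the net of finite volumes, the limiting recursion on the whole lattice has only one solution, and
  void probabilities of distant sets decouple. This yields the limiting law, uniqueness among the
  finite-cycle Gibbs measures, translation invariance and mixing.

  The almost sure convergence needs no dynamics: all finite volumes are driven by one uniform variable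
  through nested intervals indexed by the successively explored cycles, and convergence of the interval
  lengths makes the sampled cycles eventually constant off a countable set. The Gibbs property passes to
  the limit in an exchange identity for rearrangements inside a finite set. The mean jump vanishes by mass
  transport along cycles; its integrability is where convexity enters, through a linear lower bound for
  the potential on those jumps that occur in cycles of positive weight.
\<close>


section \<open>Limits along the net of finite sets\<close>

text \<open>The factor \<open>card (csupp \<gamma>)\<close> in \<open>beta\<close> is what makes the
  recursion contract: passing from the void set \<open>insert x A\<close> to
  \<open>insert x A \<union> csupp \<gamma>\<close> adds the other
  \<open>card (csupp \<gamma>) - 1\<close> sites one at a time, each at the cost of one more
  instance of the same recursion, and the remaining unit pays for a cycle that leaves the window in
  which two systems agree. A single comparison, \<open>void_compare\<close>, between systems with
  different volumes and different void sets therefore serves the thermodynamic limit, uniqueness and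
  mixing. Measures are tied to void probabilities by one observation: if all sites of
  \<open>D\<close> are fixed points, composing with a permutation of \<open>D\<close> multiplies the
  probability by its weight, whatever the boundary condition. Jumps of infinite energy have weight
  0, so the exchange identity behind the Gibbs property is stated with products instead of
  quotients. The room between \<alpha> and some smaller \<alpha>' with
  \<open>beta V \<alpha>' < 1\<close> pays for the unbounded jump length in the mean.\<close>

lemma tendsto_infsum_dominated:
  fixes a :: "'k \<Rightarrow> 'n \<Rightarrow> real"
  assumes summ: "M summable_on I"
    and bnd: "\<forall>\<^sub>F n in F. \<forall>k\<in>I. \<bar>a k n\<bar> \<le> M k"
    and lim: "\<And>k. k \<in> I \<Longrightarrow> (a k \<longlongrightarrow> b k) F"
  shows "((\<lambda>n. \<Sum>\<^sub>\<infinity>k\<in>I. a k n) \<longlongrightarrow> (\<Sum>\<^sub>\<infinity>k\<in>I. b k)) F"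
proof (cases "F = bot")
  case False
  define Y where "Y = {n. \<forall>k\<in>I. \<bar>a k n\<bar> \<le> M k}"
  have bM: "\<bar>b k\<bar> \<le> M k" if "k \<in> I" for k
  proof (rule tendsto_upperbound[OF tendsto_rabs[OF lim[OF that]] _ False])
    show "\<forall>\<^sub>F n in F. \<bar>a k n\<bar> \<le> M k" using bnd by eventually_elim (use that in auto)
  qed
  have b_sum: "b summable_on I"
    by (rule abs_summable_summable, rule summable_on_comparison_test[OF summ]) (use bM in auto)
  \<comment> \<open>The bound holds only eventually, hence the restriction to the set
    \<open>Y\<close> of good indices. On \<open>Y\<close> the partial sums converge uniformly, so
    the two limits may be exchanged.\<close>
  have u: "uniform_limit Y (\<lambda>X n. \<Sum>k\<in>X. a k n) (\<lambda>n. \<Sum>\<^sub>\<infinity>k\<in>I. a k n) (finite_subsets_at_top I)"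
    by (rule Weierstrass_m_test_general[OF _ summ]) (auto simp: Y_def)
  show ?thesis
  proof (rule swap_uniform_limit'[OF _ _ u])
    show "\<forall>\<^sub>F X in finite_subsets_at_top I. ((\<lambda>n. \<Sum>k\<in>X. a k n) \<longlongrightarrow> (\<Sum>k\<in>X. b k)) F"
      by (rule eventually_finite_subsets_at_top_weakI) (auto intro!: tendsto_sum lim)
    show "((\<lambda>X. \<Sum>k\<in>X. b k) \<longlongrightarrow> (\<Sum>\<^sub>\<infinity>k\<in>I. b k)) (finite_subsets_at_top I)"
      using b_sum by (rule infsum_tendsto)
    show "\<forall>\<^sub>F n in F. n \<in> Y" using bnd unfolding Y_def by simp
  qed auto
qed auto

text \<open>If convergence failed, one could pick bad finite sets containing the first
  \<open>n\<close> elements of the countable type; these form a sequence cofinal in the net. The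
  reduction makes dominated convergence for integrals, a statement on sequences, applicable to the
  net of volumes.\<close>

lemma tendsto_finite_subsets_at_top_sequentially:
  fixes g :: "'a::countable set \<Rightarrow> real"
  assumes seq: "\<And>L. (\<And>n::nat. finite (L n)) \<Longrightarrow> filterlim L (finite_subsets_at_top UNIV) sequentially
      \<Longrightarrow> (\<lambda>n. g (L n)) \<longlonglongrightarrow> l"
  shows "(g \<longlongrightarrow> l) (finite_subsets_at_top UNIV)"
proof (rule ccontr)
  assume "\<not> ?thesis"
  then obtain e where e: "e > 0" and ne: "\<not> (\<forall>\<^sub>F L in finite_subsets_at_top UNIV. dist (g L) l < e)"
    unfolding tendsto_iff by auto
  define B where "B = (\<lambda>n. from_nat ` {..<n} :: 'a set)"
  have "\<exists>L. finite L \<and> B n \<subseteq> L \<and> \<not> dist (g L) l < e" for n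
    using ne unfolding eventually_finite_subsets_at_top B_def by (metis finite_imageI finite_lessThan subset_UNIV)
  then obtain L where L: "\<And>n. finite (L n)" "\<And>n. B n \<subseteq> L n" "\<And>n. \<not> dist (g (L n)) l < e"
    by metis
  have "filterlim L (finite_subsets_at_top UNIV) sequentially"
    unfolding filterlim_finite_subsets_at_top
  proof (intro allI impI)
    fix X :: "'a set" assume X: "finite X \<and> X \<subseteq> UNIV"
    define N where "N = Suc (Max (insert 0 (to_nat ` X)))"
    have "X \<subseteq> B n" if "n \<ge> N" for n
    proof
      fix x assume "x \<in> X"
      then have "to_nat x < N" unfolding N_def using X by (simp add: le_imp_less_Suc)
      then show "x \<in> B n" unfolding B_def using that by (intro image_eqI[of _ _ "to_nat x"]) auto
    qed
    then show "\<forall>\<^sub>F n in sequentially. finite (L n) \<and> X \<subseteq> L n \<and> L n \<subseteq> UNIV"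
      unfolding eventually_sequentially using L by (metis order_trans subset_UNIV)
  qed
  from seq[OF L(1) this] have "\<forall>\<^sub>F n in sequentially. dist (g (L n)) l < e"
    using e unfolding tendsto_iff by auto
  then show False using L(3) by (simp add: eventually_sequentially)
qed

lemma (in finite_measure) integral_dominated_convergence_finite_subsets:
  fixes f :: "'b::countable set \<Rightarrow> 'a \<Rightarrow> real"
  assumes meas: "\<And>L. finite L \<Longrightarrow> f L \<in> borel_measurable M" and g: "g \<in> borel_measurable M"
    and bnd: "\<And>L x. finite L \<Longrightarrow> x \<in> space M \<Longrightarrow> \<bar>f L x\<bar> \<le> B"
    and lim: "AE x in M. ((\<lambda>L. f L x) \<longlongrightarrow> g x) (finite_subsets_at_top UNIV)"
  shows "((\<lambda>L. \<integral>x. f L x \<partial>M) \<longlongrightarrow> (\<integral>x. g x \<partial>M)) (finite_subsets_at_top UNIV)"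
proof (rule tendsto_finite_subsets_at_top_sequentially)
  fix L :: "nat \<Rightarrow> 'b set"
  assume fin: "\<And>n. finite (L n)" and L: "filterlim L (finite_subsets_at_top UNIV) sequentially"
  show "(\<lambda>n. \<integral>x. f (L n) x \<partial>M) \<longlonglongrightarrow> (\<integral>x. g x \<partial>M)"
  proof (rule integral_dominated_convergence[where w="\<lambda>_. B"])
    show "AE x in M. (\<lambda>n. f (L n) x) \<longlonglongrightarrow> g x"
      using lim by eventually_elim (rule filterlim_compose[OF _ L])
  qed (use meas g fin bnd in auto)
qed

lemma (in finite_measure) has_sum_measure_UN:
  assumes "countable I" "disjoint_family_on A I" "\<And>i. i \<in> I \<Longrightarrow> A i \<in> sets M"
  shows "((\<lambda>i. measure M (A i)) has_sum measure M (\<Union>i\<in>I. A i)) I"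
proof (cases "finite I")
  case True
  then show ?thesis
    using finite_measure_finite_Union[OF True, of A] assms by (auto intro!: has_sum_finiteI)
next
  case False
  let ?e = "from_nat_into I"
  have bij: "bij_betw ?e UNIV I" by (rule bij_betw_from_nat_into[OF assms(1) False])
  have 1: "(\<lambda>n. measure M (A (?e n))) sums measure M (\<Union>n. A (?e n))"
  proof (rule finite_measure_UNION)
    show "range (\<lambda>n. A (?e n)) \<subseteq> sets M" using assms(3) bij by (auto simp: bij_betw_def)
    show "disjoint_family (\<lambda>n. A (?e n))"
      using assms(2) bij unfolding disjoint_family_on_def bij_betw_def inj_on_def by (metis UNIV_I rangeI)
  qed
  have 2: "(\<Union>n. A (?e n)) = (\<Union>i\<in>I. A i)"
    using bij_betw_imp_surj_on[OF bij] by (metis image_image)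
  have "((\<lambda>n. measure M (A (?e n))) has_sum measure M (\<Union>i\<in>I. A i)) UNIV"
    using 1 unfolding 2 by (intro sums_nonneg_imp_has_sum) auto
  then show ?thesis
    by (simp add: has_sum_reindex_bij_betw[OF bij, of "\<lambda>i. measure M (A i)"])
qed

section \<open>Coupling along a tree of nested intervals\<close>

text \<open>Lists grow at the head: \<^term>\<open>k # s\<close> is the \<^term>\<open>k\<close>-th child of the node \<^term>\<open>s\<close>.
  The node \<^term>\<open>s\<close> owns the interval \<^term>\<open>{lft p s ..< lft p s + p s}\<close>, which its children partition
  from left to right.\<close>

fun lft :: "(nat list \<Rightarrow> real) \<Rightarrow> nat list \<Rightarrow> real" where
  "lft p [] = 0"
| "lft p (k # s) = lft p s + (\<Sum>j<k. p (j # s))"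

text \<open>The path descends to the child whose half-open interval contains \<open>u\<close>. The
  \<open>LEAST\<close> picks a genuine minimum only where such a child exists, which
  \<open>tree_path_in\<close> secures for \<open>u\<close> in the unit interval.\<close>

fun tree_path :: "(nat list \<Rightarrow> real) \<Rightarrow> real \<Rightarrow> nat \<Rightarrow> nat list" where
  "tree_path p u 0 = []"
| "tree_path p u (Suc n) =
     (LEAST k. u < lft p (tree_path p u n) + (\<Sum>j\<le>k. p (j # tree_path p u n))) # tree_path p u n"

lemma length_tree_path [simp]: "length (tree_path p u n) = n"
  by (induction n) auto

definition tree_mass :: "(nat list \<Rightarrow> real) \<Rightarrow> bool" where
  "tree_mass p \<longleftrightarrow> p [] = 1 \<and> (\<forall>s. 0 \<le> p s) \<and> (\<forall>s. (\<lambda>k. p (k # s)) sums p s)"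

lemma tree_path_in:
  assumes p: "tree_mass p" and u: "u \<in> {0..<1}"
  shows "u \<in> {lft p (tree_path p u n) ..< lft p (tree_path p u n) + p (tree_path p u n)}"
proof (induction n)
  case 0
  then show ?case using p u by (auto simp: tree_mass_def)
next
  case (Suc n)
  let ?s = "tree_path p u n"
  define Q where "Q = (\<lambda>k. u < lft p ?s + (\<Sum>j\<le>k. p (j # ?s)))"
  \<comment> \<open>The children exhaust the mass of the node and \<open>u\<close> lies strictly
    below its right end, so some finite partial sum already passes \<open>u\<close>. Minimality of
    the chosen index then gives the lower bound \<open>nQ\<close>.\<close>
  have "(\<lambda>k. \<Sum>j<k. p (j # ?s)) \<longlonglongrightarrow> p ?s"
    using p unfolding tree_mass_def sums_def by auto
  then have "(\<lambda>k. lft p ?s + (\<Sum>j<k. p (j # ?s))) \<longlonglongrightarrow> lft p ?s + p ?s"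
    by (intro tendsto_intros)
  from order_tendstoD(1)[OF this, of u] Suc
  obtain k where "u < lft p ?s + (\<Sum>j<k. p (j # ?s))" by (auto simp: eventually_sequentially)
  moreover have "(\<Sum>j<k. p (j # ?s)) \<le> (\<Sum>j\<le>k. p (j # ?s))"
    using p by (intro sum_mono2) (auto simp: tree_mass_def)
  ultimately have "Q k" unfolding Q_def by linarith
  then have Q: "Q (Least Q)" by (rule LeastI)
  have nQ: "lft p ?s + (\<Sum>j<Least Q. p (j # ?s)) \<le> u"
  proof (cases "Least Q")
    case (Suc m)
    have "\<not> Q m" by (rule not_less_Least) (simp add: Suc)
    then have "lft p ?s + (\<Sum>j\<le>m. p (j # ?s)) \<le> u" by (simp add: Q_def)
    then show ?thesis unfolding Suc lessThan_Suc_atMost .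
  qed (use Suc in auto)
  have path: "tree_path p u (Suc n) = Least Q # ?s" by (simp add: Q_def)
  have "u < lft p ?s + (\<Sum>j<Suc (Least Q). p (j # ?s))"
    using Q unfolding lessThan_Suc_atMost by (subst (asm) (1) Q_def)
  with nQ show ?case unfolding path by simp
qed

text \<open>The interval of a child lies inside that of its parent, so membership in the last
  interval forces all earlier turns of the path.\<close>

lemma tree_path_eqI:
  assumes p: "tree_mass p" 
  shows "u \<in> {lft p s ..< lft p s + p s} \<Longrightarrow> tree_path p u (length s) = s"
proof (induction s)
  case (Cons k s)
  have nn: "\<And>s. 0 \<le> p s" using p by (auto simp: tree_mass_def)
  have sm: "(\<lambda>k. p (k # s)) sums p s" using p by (auto simp: tree_mass_def)
  have "(\<Sum>j<Suc k. p (j # s)) \<le> p s"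
    using sum_le_suminf[of "\<lambda>k. p (k # s)" "{..<Suc k}"] sm nn by (auto simp: sums_iff)
  moreover have "0 \<le> (\<Sum>j<k. p (j # s))" using nn by (simp add: sum_nonneg)
  ultimately have s: "tree_path p u (length s) = s" using Cons by (intro Cons.IH) auto
  have "(LEAST k. u < lft p s + (\<Sum>j\<le>k. p (j # s))) = k"
  proof (rule Least_equality)
    show "u < lft p s + (\<Sum>j\<le>k. p (j # s))" using Cons.prems by (simp flip: lessThan_Suc_atMost)
    fix m assume m: "u < lft p s + (\<Sum>j\<le>m. p (j # s))"
    show "k \<le> m"
    proof (rule ccontr)
      assume "\<not> k \<le> m"
      then have "(\<Sum>j\<le>m. p (j # s)) \<le> (\<Sum>j<k. p (j # s))" using nn by (intro sum_mono2) auto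
      then show False using m Cons.prems by simp
    qed
  qed
  then show ?case using s by simp
qed simp

lemma tree_path_vimage:
  assumes p: "tree_mass p" and "length s = n"
  shows "{u \<in> {0..<1}. tree_path p u n = s} = {lft p s ..< lft p s + p s}"
proof -
  have "lft p s \<ge> 0 \<and> lft p s + p s \<le> 1"
  proof (induction s)
    case (Cons k s)
    have nn: "\<And>s. 0 \<le> p s" using p by (auto simp: tree_mass_def)
    have sm: "(\<lambda>k. p (k # s)) sums p s" using p by (auto simp: tree_mass_def)
    have "(\<Sum>j<Suc k. p (j # s)) \<le> p s"
      using sum_le_suminf[of "\<lambda>k. p (k # s)" "{..<Suc k}"] sm nn by (auto simp: sums_iff)
    moreover have "0 \<le> (\<Sum>j<k. p (j # s))" using nn by (simp add: sum_nonneg)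
    ultimately show ?case using Cons by auto
  qed (use p in \<open>auto simp: tree_mass_def\<close>)
  then show ?thesis
    using tree_path_in[OF p, of _ n] tree_path_eqI[OF p, of _ s] assms(2) by fastforce
qed

text \<open>Off the end points, \<open>u\<close> lies strictly inside the intervals of its path, which is stable under small
  changes of the masses.\<close>

lemma tree_path_eventually_eq:
  assumes p: "tree_mass p" and P: "\<forall>\<^sub>F L in F. tree_mass (P L)"
    and lim: "\<And>s. ((\<lambda>L. P L s) \<longlongrightarrow> p s) F"
    and u: "u \<in> {0..<1}" "\<And>s. u \<noteq> lft p s"
  shows "\<forall>\<^sub>F L in F. tree_path (P L) u n = tree_path p u n"
proof -
  let ?s = "tree_path p u n"
  have lft: "((\<lambda>L. lft (P L) s) \<longlongrightarrow> lft p s) F" for s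
    by (induction s) (auto intro!: tendsto_intros lim)
  \<comment> \<open>Excluding end points matters only on the left: on the right the half-open
    interval is already strict. Strict inequalities survive small changes.\<close>
  have "\<forall>\<^sub>F L in F. lft (P L) ?s < u"
    using tree_path_in[OF p u(1), of n] u(2)[of ?s] by (intro order_tendstoD(2)[OF lft]) auto
  moreover have "\<forall>\<^sub>F L in F. u < lft (P L) ?s + P L ?s"
    using tree_path_in[OF p u(1), of n]
    by (intro order_tendstoD(1)[OF tendsto_add[OF lft lim]]) auto
  ultimately show ?thesis using P
    by eventually_elim (use tree_path_eqI[of _ u ?s] in auto)
qed

section \<open>Lebesgue measure on the unit interval as source of randomness\<close>

definition unit_measure :: "real measure" where
  "unit_measure = restrict_space lborel {0..<1}"

lemma space_unit_measure [simp]: "space unit_measure = {0..<1}"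
  by (simp add: unit_measure_def space_restrict_space)

lemma sets_unit_measure: "A \<in> sets borel \<Longrightarrow> A \<subseteq> {0..<1} \<Longrightarrow> A \<in> sets unit_measure"
  by (auto simp: unit_measure_def sets_restrict_space image_iff intro!: bexI[of _ A])

lemma prob_space_unit_measure: "prob_space unit_measure"
  by (rule prob_spaceI) (simp add: unit_measure_def emeasure_restrict_space space_restrict_space)


lemma measurable_tree_path:
  assumes "tree_mass p"
  shows "{u \<in> {0..<1}. Q (tree_path p u n)} \<in> sets unit_measure"
proof -
  have "{u \<in> {0..<1}. Q (tree_path p u n)} =
      (\<Union>s\<in>{s. length s = n \<and> Q s}. {u \<in> {0..<1}. tree_path p u n = s})" by auto
  also have "\<dots> \<in> sets unit_measure"
  proof (rule sets.countable_UN'')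
    fix s assume "s \<in> {s. length s = n \<and> Q s}"
    then have eq: "{u \<in> {0..<1}. tree_path p u n = s} = {lft p s ..< lft p s + p s}"
      using tree_path_vimage[OF assms] by auto
    then have "{lft p s ..< lft p s + p s} \<subseteq> {0..<1}" by blast
    then show "{u \<in> {0..<1}. tree_path p u n = s} \<in> sets unit_measure"
      unfolding eq by (intro sets_unit_measure) auto
  qed auto
  finally show ?thesis .
qed

lemma measure_tree_path:
  assumes "tree_mass p"
  shows "measure unit_measure {u \<in> {0..<1}. tree_path p u (length s) = s} = p s"
proof -
  have eq: "{u \<in> {0..<1}. tree_path p u (length s) = s} = {lft p s ..< lft p s + p s}"
    using tree_path_vimage[OF assms] by auto
  have "measure unit_measure {u \<in> {0..<1}. tree_path p u (length s) = s} =
    measure lborel {u \<in> {0..<1}. tree_path p u (length s) = s}"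
    unfolding unit_measure_def by (rule measure_restrict_space) auto
  also have "\<dots> = p s" unfolding eq using assms by (simp add: tree_mass_def)
  finally show ?thesis .
qed

section \<open>The space of permutations\<close>

text \<open>The prescription \<open>\<tau>\<close> is an arbitrary function of which only the values
  on \<open>D\<close> count; it need not extend to a permutation, and then the cylinder is
  empty.\<close>

definition cyl :: "'d site set \<Rightarrow> 'd perm \<Rightarrow> 'd perm set" where
  "cyl D \<tau> = {\<sigma> \<in> Sperm. \<forall>x\<in>D. \<sigma> x = \<tau> x}"

definition cylinders :: "'d perm set set" where
  "cylinders = {cyl D \<tau> | D \<tau>. finite D}"

lemma topspace_Stop: "topspace Stop = Sperm"
  by (simp add: Stop_def topspace_subtopology)

lemma openin_cyl:
  assumes "finite D" shows "openin Stop (cyl D \<tau>)"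
proof -
  let ?U = "PiE UNIV (\<lambda>x. if x \<in> D then {\<tau> x} else UNIV)"
  have "openin (product_topology (\<lambda>_. discrete_topology UNIV) UNIV) ?U"
    by (rule product_topology_basis) (use assms in \<open>auto intro: rev_finite_subset\<close>)
  moreover have "cyl D \<tau> = ?U \<inter> Sperm"
    by (auto simp: cyl_def PiE_iff split: if_splits)
  ultimately show ?thesis unfolding Stop_def openin_subtopology by blast
qed

lemma openin_Stop_nbhd:
  assumes "openin Stop U" "\<sigma> \<in> U"
  shows "\<exists>D. finite D \<and> cyl D \<sigma> \<subseteq> U"
proof -
  obtain T where T: "openin (product_topology (\<lambda>_. discrete_topology UNIV) UNIV) T" "U = T \<inter> Sperm"
    using assms(1) unfolding Stop_def openin_subtopology by blast
  obtain W where W: "finite {i. W i \<noteq> UNIV}" "\<sigma> \<in> PiE UNIV W" "PiE UNIV W \<subseteq> T"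
    using T(1) assms(2) unfolding T(2) openin_product_topology_alt by fastforce
  have "cyl {i. W i \<noteq> UNIV} \<sigma> \<subseteq> U"
  proof
    fix \<tau> assume \<tau>: "\<tau> \<in> cyl {i. W i \<noteq> UNIV} \<sigma>"
    have "\<tau> i \<in> W i" for i
      using \<tau> W(2) by (cases "W i = UNIV") (auto simp: cyl_def PiE_iff)
    then show "\<tau> \<in> U" using W(3) \<tau> unfolding T(2) cyl_def by (auto simp: PiE_iff)
  qed
  then show ?thesis using W(1) by blast
qed

lemma openin_Stop_subset: "openin Stop U \<Longrightarrow> U \<subseteq> Sperm"
  using openin_subset topspace_Stop by metis

lemma space_SM [simp]: "space SM = Sperm"
  unfolding SM_def by (rule space_measure_of) (rule subsetI, simp add: openin_Stop_subset)

lemma cyl_eq_list: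
  assumes "finite D"
  shows "\<exists>l. cyl D \<tau> = {\<sigma> \<in> Sperm. \<forall>z \<in> set l. \<sigma> (fst z) = snd z}"
proof -
  obtain xs where xs: "set xs = D" using assms finite_list by metis
  have "cyl D \<tau> = {\<sigma> \<in> Sperm. \<forall>z \<in> set (map (\<lambda>x. (x, \<tau> x)) xs). \<sigma> (fst z) = snd z}"
    by (simp add: cyl_def xs)
  then show ?thesis by (rule exI)
qed

lemma countable_cylinders: "countable (cylinders :: ('d::finite) perm set set)"
proof -
  let ?f = "\<lambda>l. {\<sigma> \<in> Sperm. \<forall>z \<in> set l. \<sigma> (fst z) = (snd z :: 'd site)}"
  have "cylinders \<subseteq> range ?f"
  proof
    fix C :: "'d perm set" assume "C \<in> cylinders"
    then obtain D \<tau> where C: "C = cyl D \<tau>" "finite D" unfolding cylinders_def by auto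
    show "C \<in> range ?f" using cyl_eq_list[OF C(2), of \<tau>] unfolding C(1) by auto
  qed
  then show ?thesis by (rule countable_subset) simp
qed

text \<open>There are only countably many cylinders and they form a base of the topology, so each
  open set is a countable union of them.\<close>

lemma sets_SM: "sets (SM :: ('d::finite) perm measure) = sigma_sets Sperm cylinders"
proof -
  have sub: "{U. openin Stop U} \<subseteq> Pow (Sperm :: 'd perm set)"
    by (rule subsetI) (simp add: openin_Stop_subset)
  have "sigma_sets Sperm {U. openin Stop U} = sigma_sets Sperm (cylinders :: 'd perm set set)"
  proof (rule sigma_sets_eqI)
    fix U :: "'d perm set" assume "U \<in> {U. openin Stop U}"
    then have U: "openin Stop U" by simp
    have "U = \<Union>{C \<in> cylinders. C \<subseteq> U}"
    proof
      show "U \<subseteq> \<Union>{C \<in> cylinders. C \<subseteq> U}"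
      proof
        fix \<sigma> assume s: "\<sigma> \<in> U"
        then obtain D where "finite D" "cyl D \<sigma> \<subseteq> U" using openin_Stop_nbhd[OF U] by blast
        moreover have "\<sigma> \<in> cyl D \<sigma>"
          using s openin_Stop_subset[OF U] by (auto simp: cyl_def)
        ultimately show "\<sigma> \<in> \<Union>{C \<in> cylinders. C \<subseteq> U}" by (auto simp: cylinders_def)
      qed
    qed auto
    moreover have "\<Union>{C \<in> cylinders. C \<subseteq> U} \<in> sigma_sets Sperm cylinders"
      by (rule sigma_sets_UNION) (auto intro: countable_subset[OF _ countable_cylinders])
    ultimately show "U \<in> sigma_sets Sperm cylinders" by simp
  next
    fix U :: "'d perm set" assume "U \<in> cylinders"
    then show "U \<in> sigma_sets Sperm {U. openin Stop U}" using openin_cyl by (auto simp: cylinders_def)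
  qed
  then show ?thesis unfolding SM_def using sub by simp
qed

lemma cyl_in_SM: "finite D \<Longrightarrow> cyl D \<tau> \<in> sets (SM :: ('d::finite) perm measure)"
  unfolding sets_SM by (auto simp: cylinders_def)

text \<open>Any permutation in a nonempty intersection can itself serve as the joint
  prescription.\<close>

lemma cyl_Int: "cyl D \<tau> \<inter> cyl D' \<tau>' = {} \<or>
   (\<exists>\<rho>. cyl D \<tau> \<inter> cyl D' \<tau>' = cyl (D \<union> D') \<rho>)"
proof (cases "cyl D \<tau> \<inter> cyl D' \<tau>' = {}")
  case False
  then obtain \<rho> where "\<rho> \<in> cyl D \<tau> \<inter> cyl D' \<tau>'" by blast
  then have "cyl D \<tau> \<inter> cyl D' \<tau>' = cyl (D \<union> D') \<rho>" by (auto simp: cyl_def)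
  then show ?thesis by blast
qed simp

lemma Int_stable_cylinders: "Int_stable (insert {} (cylinders :: 'a perm set set))"
proof (rule Int_stableI)
  fix a b :: "'a perm set" assume ab: "a \<in> insert {} cylinders" "b \<in> insert {} (cylinders :: 'a perm set set)"
  show "a \<inter> b \<in> insert {} cylinders"
  proof (cases "a = {} \<or> b = {}")
    case False
    then obtain D \<tau> D' \<tau>' where "a = cyl D \<tau>" "b = cyl D' \<tau>'" "finite D" "finite D'"
      using ab by (auto simp: cylinders_def)
    then show ?thesis using cyl_Int[of D \<tau> D' \<tau>'] unfolding cylinders_def by blast
  qed auto
qed

lemma sets_SM_insert: "sets (SM :: ('d::finite) perm measure) = sigma_sets Sperm (insert {} cylinders)"
  unfolding sets_SM by (rule sigma_sets_eqI) (auto intro: sigma_sets.Empty)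

lemma measure_eqI_cylinders:
  fixes m1 m2 :: "('d::finite) perm measure"
  assumes "sets m1 = sets SM" "sets m2 = sets SM"
    and "\<And>D \<tau>. finite D \<Longrightarrow> emeasure m1 (cyl D \<tau>) = emeasure m2 (cyl D \<tau>)"
    and "emeasure m1 Sperm \<noteq> \<infinity>"
  shows "m1 = m2"
proof (rule measure_eqI_generator_eq[OF Int_stable_cylinders, where \<Omega>=Sperm and A="\<lambda>_. Sperm"])
  show "insert {} cylinders \<subseteq> Pow (Sperm :: 'd perm set)" by (auto simp: cylinders_def cyl_def)
  have "cyl {} id = (Sperm :: 'd perm set)" by (auto simp: cyl_def)
  then show "range (\<lambda>_. Sperm) \<subseteq> insert {} (cylinders :: 'd perm set set)" by (force simp: cylinders_def)
  show "emeasure m1 X = emeasure m2 X" if "X \<in> insert {} cylinders" for X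
    using that assms(3) by (auto simp: cylinders_def)
qed (use assms sets_SM_insert in auto)

lemma measurable_SM_I:
  fixes f :: "'a \<Rightarrow> ('d::finite) perm"
  assumes "f \<in> space M \<rightarrow> Sperm" and "\<And>x y. {m \<in> space M. f m x = y} \<in> sets M"
  shows "f \<in> measurable M SM"
proof -
  have "f \<in> measurable M (sigma Sperm cylinders)"
  proof (rule measurable_measure_of)
    fix C :: "'d perm set" assume "C \<in> cylinders"
    then obtain D \<tau> where C: "finite D" "C = cyl D \<tau>" by (auto simp: cylinders_def)
    have "f -` C \<inter> space M = {m \<in> space M. \<forall>x\<in>D. f m x = \<tau> x}"
      using assms(1) by (auto simp: C cyl_def)
    also have "\<dots> \<in> sets M" by (rule sets.sets_Collect_finite_All[OF assms(2) C(1)])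
    finally show "f -` C \<inter> space M \<in> sets M" .
  qed (use assms in \<open>auto simp: cylinders_def cyl_def\<close>)
  moreover have "sets (sigma Sperm cylinders) = sets (SM :: 'd perm measure)"
    unfolding sets_SM by (rule sets_measure_of) (auto simp: cylinders_def cyl_def)
  ultimately show ?thesis by (simp cong: measurable_cong_sets)
qed

lemma sets_SM_value: "{\<sigma> \<in> Sperm. \<sigma> x = y} \<in> sets (SM :: ('d::finite) perm measure)"
proof -
  have "{\<sigma> \<in> Sperm. \<sigma> x = y} = cyl {x} (\<lambda>_. y)" by (auto simp: cyl_def)
  then show ?thesis by (simp add: cyl_in_SM)
qed

lemma continuous_map_Stop_local:
  assumes "finite D" "\<And>\<sigma> \<tau>. \<sigma> \<in> Sperm \<Longrightarrow> \<tau> \<in> Sperm \<Longrightarrow> (\<And>x. x \<in> D \<Longrightarrow> \<sigma> x = \<tau> x) \<Longrightarrow> f \<sigma> = f \<tau>"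
  shows "continuous_map Stop euclideanreal f"
  unfolding continuous_map_def
proof (intro conjI allI impI)
  fix U assume "openin euclideanreal U"
  show "openin Stop {\<sigma> \<in> topspace Stop. f \<sigma> \<in> U}"
  proof (subst openin_subopen, intro ballI)
    fix \<sigma> assume s: "\<sigma> \<in> {\<sigma> \<in> topspace Stop. f \<sigma> \<in> U}"
    have "cyl D \<sigma> \<subseteq> {\<sigma> \<in> topspace Stop. f \<sigma> \<in> U}"
    proof
      fix \<tau> assume t: "\<tau> \<in> cyl D \<sigma>"
      then have "f \<tau> = f \<sigma>" using s by (intro assms(2)) (auto simp: cyl_def topspace_Stop)
      then show "\<tau> \<in> {\<sigma> \<in> topspace Stop. f \<sigma> \<in> U}" using s t by (auto simp: cyl_def topspace_Stop)
    qed
    moreover have "\<sigma> \<in> cyl D \<sigma>" using s by (auto simp: cyl_def topspace_Stop)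
    ultimately show "\<exists>T. openin Stop T \<and> \<sigma> \<in> T \<and> T \<subseteq> {\<sigma> \<in> topspace Stop. f \<sigma> \<in> U}"
      using openin_cyl[OF assms(1)] by blast
  qed
qed auto

lemma continuous_map_Stop_measurable:
  assumes "continuous_map Stop euclideanreal f"
  shows "f \<in> borel_measurable (SM :: ('d::finite) perm measure)"
proof (rule borel_measurableI)
  fix S :: "real set" assume "open S"
  then have "openin Stop {\<sigma> \<in> topspace Stop. f \<sigma> \<in> S}"
    using assms unfolding continuous_map_def by auto
  moreover have "{\<sigma> \<in> topspace Stop. f \<sigma> \<in> S} = f -` S \<inter> space SM" by (auto simp: topspace_Stop)
  ultimately show "f -` S \<inter> space SM \<in> sets SM"
    unfolding SM_def by (subst sets_measure_of) (rule subsetI, simp add: openin_Stop_subset, auto)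
qed

section \<open>Cycles\<close>

text \<open>Forward iterates suffice: a finite forward orbit of a bijection is periodic and hence is
  the whole cycle, while an infinite cycle has an infinite forward half.\<close>

definition orb :: "'d perm \<Rightarrow> 'd site \<Rightarrow> 'd site set" where
  "orb \<sigma> x = range (\<lambda>n. (\<sigma> ^^ n) x)"

definition cyc :: "'d perm \<Rightarrow> 'd site \<Rightarrow> 'd perm" where
  "cyc \<sigma> x = (\<lambda>y. if y \<in> orb \<sigma> x then \<sigma> y else y)"

lemma orb_self: "x \<in> orb \<sigma> x"
  unfolding orb_def by (rule range_eqI[of _ _ 0]) simp

lemma orb_step: "y \<in> orb \<sigma> x \<Longrightarrow> \<sigma> y \<in> orb \<sigma> x"
  unfolding orb_def by (auto intro: range_eqI[of _ _ "Suc n" for n])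

lemma orb_fixed: "\<sigma> x = x \<Longrightarrow> orb \<sigma> x = {x}"
proof -
  assume "\<sigma> x = x"
  then have "(\<sigma> ^^ n) x = x" for n by (induction n) auto
  then show ?thesis by (auto simp: orb_def)
qed

lemma cyc_fixed: "\<sigma> x = x \<Longrightarrow> cyc \<sigma> x = id"
  by (auto simp: cyc_def orb_fixed)

lemma funpow_bij: "bij \<sigma> \<Longrightarrow> bij (\<sigma> ^^ n)" for \<sigma> :: "'a \<Rightarrow> 'a"
  by (induction n) (auto intro: bij_comp)

text \<open>By pigeonhole two iterates coincide, and injectivity cancels the smaller power.\<close>

lemma orb_period:
  assumes "bij \<sigma>" "finite (orb \<sigma> x)"
  shows "\<exists>n>0. (\<sigma> ^^ n) x = x"
proof -
  have "\<not> inj (\<lambda>n. (\<sigma> ^^ n) x)"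
    using assms(2) finite_imageD[of "\<lambda>n. (\<sigma> ^^ n) x" UNIV] unfolding orb_def by auto
  then obtain m n where mn: "(\<sigma> ^^ m) x = (\<sigma> ^^ n) x" "m < n"
    unfolding inj_def by (metis linorder_neqE_nat)
  then have "(\<sigma> ^^ m) ((\<sigma> ^^ (n - m)) x) = (\<sigma> ^^ m) x"
    by (metis add_diff_inverse_nat comp_apply funpow_add less_imp_le not_le)
  then have "(\<sigma> ^^ (n - m)) x = x" using funpow_bij[OF assms(1)] by (metis bij_def inj_eq)
  then show ?thesis using mn(2) by (intro exI[of _ "n - m"]) auto
qed

lemma is_finite_cycle_cyc:
  assumes "bij \<sigma>" "finite (orb \<sigma> x)" "\<sigma> x \<noteq> x"
  shows "is_finite_cycle (cyc \<sigma> x)" "csupp (cyc \<sigma> x) = orb \<sigma> x"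
proof -
  \<comment> \<open>The cycle is listed as the iterates below the minimal period. Minimality makes
    them distinct, and the period is at least 2 because \<open>x\<close> is moved.\<close>
  define n where "n = (LEAST n. n > 0 \<and> (\<sigma> ^^ n) x = x)"
  have n: "n > 0" "(\<sigma> ^^ n) x = x"
    using LeastI_ex[OF orb_period[OF assms(1,2)]] unfolding n_def by auto
  have nmin: "n \<le> m" if "m > 0" "(\<sigma> ^^ m) x = x" for m
    unfolding n_def using that by (intro Least_le) auto
  have n2: "n \<ge> 2"
  proof (rule ccontr)
    assume "\<not> n \<ge> 2" then have "n = 1" using n by auto
    then show False using n assms(3) by simp
  qed
  have modn: "(\<sigma> ^^ m) x = (\<sigma> ^^ (m mod n)) x" for m
  proof -
    have "(\<sigma> ^^ (k * n)) x = x" for k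
      by (induction k) (auto simp: funpow_add n(2))
    then have "(\<sigma> ^^ (m mod n + m div n * n)) x = (\<sigma> ^^ (m mod n)) x" unfolding funpow_add by simp
    then show ?thesis by simp
  qed
  define xs where "xs = map (\<lambda>i. (\<sigma> ^^ i) x) [0..<n]"
  have nth: "xs ! i = (\<sigma> ^^ i) x" if "i < n" for i using that by (simp add: xs_def)
  have len: "length xs = n" by (simp add: xs_def)
  have "inj_on (\<lambda>i. (\<sigma> ^^ i) x) {0..<n}"
  proof (rule linorder_inj_onI')
    fix i j assume ij: "i \<in> {0..<n}" "j \<in> {0..<n}" "i < j"
    show "(\<sigma> ^^ i) x \<noteq> (\<sigma> ^^ j) x"
    proof
      assume "(\<sigma> ^^ i) x = (\<sigma> ^^ j) x"
      then have "(\<sigma> ^^ i) ((\<sigma> ^^ (j - i)) x) = (\<sigma> ^^ i) x"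
        using ij by (metis add_diff_inverse_nat comp_apply funpow_add less_imp_le not_le)
      then have "(\<sigma> ^^ (j - i)) x = x" using funpow_bij[OF assms(1)] by (metis bij_def inj_eq)
      then have "n \<le> j - i" using ij by (intro nmin) auto
      then show False using ij by auto
    qed
  qed
  then have dist: "distinct xs" by (auto simp: xs_def distinct_map)
  have set: "set xs = orb \<sigma> x"
  proof -
    have "y \<in> set xs" if y: "y \<in> orb \<sigma> x" for y
    proof -
      obtain m where "y = (\<sigma> ^^ m) x" using y unfolding orb_def by blast
      then have "y = (\<sigma> ^^ (m mod n)) x" using modn by simp
      then show ?thesis using n(1) by (auto simp: xs_def)
    qed
    then show ?thesis by (auto simp: xs_def orb_def)
  qed
  have step: "\<sigma> (xs ! i) = xs ! (Suc i mod n)" if "i < n" for i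
    using that nth[of i] nth[of "Suc i mod n"] modn[of "Suc i"] n(1) by simp
  have out: "cyc \<sigma> x y = y" if "y \<notin> set xs" for y using that set by (auto simp: cyc_def)
  have ins: "cyc \<sigma> x (xs ! i) = xs ! (Suc i mod n)" if "i < n" for i
    using step[OF that] set nth_mem[of i xs] that len by (auto simp: cyc_def)
  show "is_finite_cycle (cyc \<sigma> x)"
    unfolding is_finite_cycle_def using dist n2 len ins out by (intro exI[of _ xs]) auto
  have "cyc \<sigma> x y \<noteq> y" if y: "y \<in> set xs" for y
  proof -
    obtain i where i: "i < n" "y = xs ! i" using y len by (auto simp: in_set_conv_nth)
    have "Suc i mod n \<noteq> i" using i n2 by (cases "Suc i = n") auto
    moreover have "Suc i mod n < n" using n(1) by simp
    ultimately show ?thesis using ins[OF i(1)] dist i len by (simp add: nth_eq_iff_index_eq)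
  qed
  then show "csupp (cyc \<sigma> x) = orb \<sigma> x" using out set unfolding csupp_def by blast
qed

lemma is_finite_cycleE:
  assumes "is_finite_cycle \<gamma>"
  obtains xs where "distinct xs" "2 \<le> length xs" "csupp \<gamma> = set xs"
    "\<And>i. i < length xs \<Longrightarrow> \<gamma> (xs ! i) = xs ! (Suc i mod length xs)"
proof -
  obtain xs where xs: "distinct xs" "2 \<le> length xs"
      "\<And>i. i < length xs \<Longrightarrow> \<gamma> (xs ! i) = xs ! (Suc i mod length xs)"
      "\<And>x. x \<notin> set xs \<Longrightarrow> \<gamma> x = x"
    using assms unfolding is_finite_cycle_def by auto
  have "\<gamma> y \<noteq> y" if y: "y \<in> set xs" for y
  proof -
    let ?n = "length xs"
    obtain i where i: "i < ?n" "y = xs ! i" using y by (auto simp: in_set_conv_nth)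
    have "Suc i mod ?n \<noteq> i" using i xs(2) by (cases "Suc i = ?n") auto
    moreover have "Suc i mod ?n < ?n" using xs(2) by (intro mod_less_divisor) linarith
    ultimately show ?thesis using xs(3)[OF i(1)] xs(1) i by (simp add: nth_eq_iff_index_eq)
  qed
  then have "csupp \<gamma> = set xs" using xs(4) unfolding csupp_def by blast
  then show ?thesis using that xs by blast
qed

lemma finite_csupp: "is_finite_cycle \<gamma> \<Longrightarrow> finite (csupp \<gamma>)"
  by (elim is_finite_cycleE) simp

lemma orb_finite_cycle:
  assumes "is_finite_cycle \<gamma>" "x \<in> csupp \<gamma>"
  shows "orb \<gamma> x = csupp \<gamma>"
proof -
  obtain xs where xs: "distinct xs" "2 \<le> length xs" "csupp \<gamma> = set xs"
      "\<And>i. i < length xs \<Longrightarrow> \<gamma> (xs ! i) = xs ! (Suc i mod length xs)"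
    using is_finite_cycleE[OF assms(1)] by metis
  let ?n = "length xs"
  have n0: "?n > 0" using xs by linarith
  obtain i where i: "i < ?n" "x = xs ! i" using assms(2) xs(3) by (auto simp: in_set_conv_nth)
  have pow: "(\<gamma> ^^ k) x = xs ! ((i + k) mod ?n)" for k
  proof (induction k)
    case (Suc k)
    then show ?case using xs(4)[of "(i + k) mod ?n"] n0 by (simp add: mod_Suc_eq)
  qed (use i in simp)
  show ?thesis
  proof
    show "orb \<gamma> x \<subseteq> csupp \<gamma>" using pow n0 by (auto simp: orb_def xs(3))
    show "csupp \<gamma> \<subseteq> orb \<gamma> x"
    proof
      fix y assume "y \<in> csupp \<gamma>"
      then obtain j where j: "j < ?n" "y = xs ! j" using xs(3) by (auto simp: in_set_conv_nth)
      \<comment> \<open>A full turn is added before subtracting, so that the natural-number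
        difference is not truncated when \<open>j < i\<close>.\<close>
      have "(i + (j + ?n - i)) mod ?n = j" using i j by simp
      then have "(\<gamma> ^^ (j + ?n - i)) x = y" using pow[of "j + ?n - i"] j by simp
      then show "y \<in> orb \<gamma> x" unfolding orb_def by blast
    qed
  qed
qed

lemma finite_cycle_image:
  assumes "is_finite_cycle \<gamma>" "y \<in> csupp \<gamma>"
  shows "\<gamma> y \<in> csupp \<gamma>"
  using orb_finite_cycle[OF assms] orb_step[OF orb_self] by blast

lemma finite_cycle_permutes:
  assumes "is_finite_cycle \<gamma>" shows "\<gamma> permutes (csupp \<gamma>)"
proof (rule bij_imp_permutes)
  have sub: "\<gamma> ` csupp \<gamma> \<subseteq> csupp \<gamma>" using finite_cycle_image[OF assms] by auto
  have "csupp \<gamma> \<subseteq> \<gamma> ` csupp \<gamma>"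
  proof
    fix y assume y: "y \<in> csupp \<gamma>"
    have "\<gamma> y \<in> csupp \<gamma>" using finite_cycle_image[OF assms y] .
    then have "y \<in> orb \<gamma> (\<gamma> y)" using orb_finite_cycle[OF assms] y by blast
    then obtain n where "y = (\<gamma> ^^ n) (\<gamma> y)" by (auto simp: orb_def)
    then have y2: "y = \<gamma> ((\<gamma> ^^ n) y)" by (simp add: funpow_swap1)
    have "(\<gamma> ^^ n) y \<in> csupp \<gamma>" using orb_finite_cycle[OF assms y] by (auto simp: orb_def)
    then show "y \<in> \<gamma> ` csupp \<gamma>" using y2 by blast
  qed
  then have "\<gamma> ` csupp \<gamma> = csupp \<gamma>" using sub by blast
  then show "bij_betw \<gamma> (csupp \<gamma>) (csupp \<gamma>)"
    using finite_csupp[OF assms] by (simp add: bij_betw_def eq_card_imp_inj_on)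
qed (auto simp: csupp_def)

text \<open>The support is closed under \<open>\<gamma>\<close>, so an agreement on it propagates
  along the orbit. Thus a permutation determines which cycle was chosen at \<open>x\<close>, and
  events belonging to different choices are disjoint.\<close>

lemma cyc_unique:
  assumes "is_finite_cycle \<gamma>" "x \<in> csupp \<gamma>" "\<And>y. y \<in> csupp \<gamma> \<Longrightarrow> \<sigma> y = \<gamma> y"
  shows "cyc \<sigma> x = \<gamma>" "orb \<sigma> x = csupp \<gamma>"
proof -
  have "(\<sigma> ^^ n) x = (\<gamma> ^^ n) x \<and> (\<gamma> ^^ n) x \<in> csupp \<gamma>" for n
    by (induction n) (use assms finite_cycle_image[OF assms(1)] in auto)
  then show o: "orb \<sigma> x = csupp \<gamma>" using orb_finite_cycle[OF assms(1,2)] by (auto simp: orb_def)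
  show "cyc \<sigma> x = \<gamma>" using assms(3) by (auto simp: cyc_def o csupp_def)
qed

lemma countable_finite_cycles: "countable {\<gamma> :: ('d::finite) perm. is_finite_cycle \<gamma>}"
proof -
  define P where "P = (\<lambda>(\<gamma> :: 'd perm) xs. (\<forall>i < length xs. \<gamma> (xs ! i) = xs ! (Suc i mod length xs)) \<and>
      (\<forall>x. x \<notin> set xs \<longrightarrow> \<gamma> x = x))"
  have uniq: "\<gamma> = \<gamma>'" if "P \<gamma> xs" "P \<gamma>' xs" for \<gamma> \<gamma>' xs
  proof
    fix x show "\<gamma> x = \<gamma>' x"
      using that by (cases "x \<in> set xs") (auto simp: P_def in_set_conv_nth)
  qed
  have "{\<gamma> :: 'd perm. is_finite_cycle \<gamma>} \<subseteq> range (\<lambda>xs. THE \<gamma>. P \<gamma> xs)"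
  proof
    fix \<gamma> :: "'d perm" assume "\<gamma> \<in> {\<gamma>. is_finite_cycle \<gamma>}"
    then obtain xs where "P \<gamma> xs" by (auto simp: is_finite_cycle_def P_def)
    then have "(THE \<gamma>. P \<gamma> xs) = \<gamma>" using uniq by blast
    then show "\<gamma> \<in> range (\<lambda>xs. THE \<gamma>. P \<gamma> xs)" by (metis rangeI)
  qed
  then show ?thesis by (rule countable_subset) simp
qed

lemma finite_orb_of_finite_cycle_perm: "finite_cycle_perm \<sigma> \<Longrightarrow> finite (orb \<sigma> x)"
  unfolding finite_cycle_perm_def cycle_through_def orb_def
  by (erule allE[of _ x], erule rev_finite_subset) auto

text \<open>\<open>cycle_through\<close> also contains backward iterates; on a finite set, forward
  invariance under a bijection is equality by counting, hence backward invariance as well.\<close>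

lemma finite_cycle_through:
  assumes "bij \<sigma>" "finite B" "x \<in> B" "\<sigma> ` B \<subseteq> B"
  shows "finite (cycle_through \<sigma> x)"
proof -
  have "\<sigma> ` B = B"
    using assms by (metis bij_def card_image card_subset_eq inj_on_subset subset_UNIV)
  then have inv: "inv \<sigma> y \<in> B" if "y \<in> B" for y
    using that assms(1) by (metis bij_def image_iff inv_f_f)
  have "(\<sigma> ^^ n) x \<in> B" for n by (induction n) (use assms in auto)
  moreover have "(inv \<sigma> ^^ n) x \<in> B" for n by (induction n) (use assms inv in auto)
  ultimately have "cycle_through \<sigma> x \<subseteq> B" unfolding cycle_through_def by auto
  then show ?thesis using assms(2) finite_subset by blast
qed

lemma SL_id: "SL \<Lambda> id = {\<pi>. \<pi> permutes \<Lambda>}"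
  unfolding SL_def Sperm_def by (auto simp: permutes_def bij_iff) 

lemma finite_SL_id: "finite \<Lambda> \<Longrightarrow> finite (SL \<Lambda> id)"
  unfolding SL_id by (rule finite_permutations)

text \<open>Composing on the right rearranges which site of \<open>\<Lambda>\<close> receives which
  target, so every admissible filling is \<open>\<xi>\<close> after a permutation of
  \<open>\<Lambda>\<close>. This gives all boundary conditions the same finite index set.\<close>

lemma SL_eq_image:
  assumes "\<xi> \<in> Sperm"
  shows "SL \<Lambda> \<xi> = (\<lambda>\<pi>. \<xi> \<circ> \<pi>) ` SL \<Lambda> id"
proof
  show "(\<lambda>\<pi>. \<xi> \<circ> \<pi>) ` SL \<Lambda> id \<subseteq> SL \<Lambda> \<xi>"
    using assms by (auto simp: SL_def Sperm_def intro: bij_comp)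
  show "SL \<Lambda> \<xi> \<subseteq> (\<lambda>\<pi>. \<xi> \<circ> \<pi>) ` SL \<Lambda> id"
  proof
    fix \<sigma> assume s: "\<sigma> \<in> SL \<Lambda> \<xi>"
    have b: "bij \<xi>" using assms by (simp add: Sperm_def)
    have "inv \<xi> \<circ> \<sigma> \<in> SL \<Lambda> id"
      using s b by (auto simp: SL_def Sperm_def bij_is_inj intro: bij_comp bij_imp_bij_inv)
    moreover have "\<sigma> = \<xi> \<circ> (inv \<xi> \<circ> \<sigma>)"
      using b by (auto simp: fun_eq_iff bij_is_surj surj_f_inv_f)
    ultimately show "\<sigma> \<in> (\<lambda>\<pi>. \<xi> \<circ> \<pi>) ` SL \<Lambda> id" by blast
  qed
qed

lemma finite_SL: "finite \<Lambda> \<Longrightarrow> \<xi> \<in> Sperm \<Longrightarrow> finite (SL \<Lambda> \<xi>)"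
  by (simp add: SL_eq_image finite_SL_id)

lemma inj_on_comp_SL: "\<xi> \<in> Sperm \<Longrightarrow> inj_on (\<lambda>\<pi>. \<xi> \<circ> \<pi>) X"
  by (auto simp: inj_on_def Sperm_def bij_def fun_eq_iff inj_eq)

lemma finite_cycle_perm_permutes:
  assumes "\<pi> permutes \<Lambda>" "finite \<Lambda>" shows "finite_cycle_perm \<pi>"
  unfolding finite_cycle_perm_def
proof
  fix x
  have im: "\<pi> ` insert x \<Lambda> \<subseteq> insert x \<Lambda>"
    using permutes_in_image[OF assms(1)] permutes_not_in[OF assms(1)] by (cases "x \<in> \<Lambda>") auto
  show "finite (cycle_through \<pi> x)"
    using finite_cycle_through[OF permutes_bij[OF assms(1)] _ _ im] assms(2) by simp
qed

section \<open>Weights and translations\<close>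

definition tr :: "'d site \<Rightarrow> 'd site \<Rightarrow> 'd site" where
  "tr z x = (\<lambda>i. x i + z i)"

definition neg :: "'d site \<Rightarrow> 'd site" where
  "neg z = (\<lambda>i. - z i)"

lemma tr_neg [simp]: "tr z (tr (neg z) x) = x" "tr (neg z) (tr z x) = x"
  by (auto simp: tr_def neg_def)

lemma bij_tr: "bij (tr z)"
  by (rule bijI'[of "tr z"]) (metis tr_neg, metis tr_neg)

lemma inj_tr: "inj (tr z)" using bij_tr bij_def by blast

lemma tr_eq_iff [simp]: "tr z x = tr z y \<longleftrightarrow> x = y"
  using inj_tr by (auto dest: injD)

lemma shift_apply: "shift z \<sigma> x = tr z (\<sigma> (tr (neg z) x))"
  by (simp add: shift_def tr_def neg_def)

lemma shift_tr [simp]: "shift z \<sigma> (tr z x) = tr z (\<sigma> x)"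
  by (simp add: shift_apply)

lemma shift_neg [simp]: "shift z (shift (neg z) \<sigma>) = \<sigma>" "shift (neg z) (shift z \<sigma>) = \<sigma>"
  by (auto simp: shift_apply fun_eq_iff)

lemma bij_shift: "bij \<sigma> \<Longrightarrow> bij (shift z \<sigma>)"
proof -
  assume "bij \<sigma>"
  then have "bij (tr z \<circ> (\<sigma> \<circ> tr (neg z)))" by (intro bij_comp bij_tr)
  moreover have "shift z \<sigma> = tr z \<circ> (\<sigma> \<circ> tr (neg z))" by (auto simp: shift_apply)
  ultimately show ?thesis by simp
qed

lemma csupp_shift: "csupp (shift z \<gamma>) = tr z ` csupp \<gamma>"
proof (rule set_eqI)
  fix x
  obtain y where x: "x = tr z y" using tr_neg(1) by metis
  show "x \<in> csupp (shift z \<gamma>) \<longleftrightarrow> x \<in> tr z ` csupp \<gamma>"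
    unfolding x by (auto simp: csupp_def)
qed

lemma is_finite_cycle_shift: "is_finite_cycle \<gamma> \<Longrightarrow> is_finite_cycle (shift z \<gamma>)"
proof -
  assume "is_finite_cycle \<gamma>"
  then obtain xs where xs: "distinct xs" "2 \<le> length xs"
      "\<forall>i < length xs. \<gamma> (xs ! i) = xs ! (Suc i mod length xs)"
      "\<forall>x. x \<notin> set xs \<longrightarrow> \<gamma> x = x"
    unfolding is_finite_cycle_def by auto
  have lt: "Suc i mod length xs < length xs" for i using xs(2) by (intro mod_less_divisor) linarith
  have "shift z \<gamma> x = x" if "x \<notin> tr z ` set xs" for x
    using that xs(4) unfolding shift_apply by (metis image_eqI tr_neg(1))
  then show ?thesis unfolding is_finite_cycle_def
    by (intro exI[of _ "map (tr z) xs"])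
       (use xs lt inj_tr[of z] in \<open>auto simp: distinct_map inj_on_def\<close>)
qed

lemma jump_tr [simp]: "jump (tr z y) (tr z x) = jump y x"
  by (auto simp: jump_def tr_def)

lemma cweight_shift: "cweight \<alpha> V (shift z \<gamma>) = cweight \<alpha> V \<gamma>"
  unfolding cweight_def csupp_shift
  by (subst sum.reindex) (auto intro: inj_on_subset[OF inj_tr])

lemma boltz_nonneg: "0 \<le> boltz \<alpha> h"
  by (simp add: boltz_def)

lemma boltz_0 [simp]: "boltz \<alpha> 0 = 1"
  by (simp add: boltz_def)

lemma boltz_le_1: "0 \<le> \<alpha> \<Longrightarrow> boltz \<alpha> h \<le> 1"
  by (simp add: boltz_def)

text \<open>Weight 0 at infinite energy is consistent with multiplicativity, so forbidden jumps can
  be carried along in products without case distinctions.\<close>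

lemma boltz_add: "boltz \<alpha> (h + k) = boltz \<alpha> h * boltz \<alpha> k"
  by (auto simp: boltz_def enn2real_plus less_top distrib_left exp_add exp_diff field_simps exp_minus)

lemma boltz_sum: "boltz \<alpha> (\<Sum>x\<in>A. f x) = (\<Prod>x\<in>A. boltz \<alpha> (f x))"
  by (induction A rule: infinite_finite_induct) (auto simp: boltz_add)

lemma boltz_Ham: "boltz \<alpha> (Ham V D \<sigma>) = (\<Prod>x\<in>D. boltz \<alpha> (V (jump (\<sigma> x) x)))"
  unfolding Ham_def by (rule boltz_sum)

lemma jump_self [simp]: "jump x x = (\<lambda>_. 0)" by (simp add: jump_def)

lemma csupp_id [simp]: "csupp id = {}" "csupp (\<lambda>a. a) = {}" by (simp_all add: csupp_def)

lemma cweight_id [simp]: "cweight \<alpha> V id = 1" "cweight \<alpha> V (\<lambda>a. a) = 1" by (simp_all add: cweight_def)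

lemma cweight_nonneg: "0 \<le> cweight \<alpha> V \<gamma>"
  by (simp add: cweight_def boltz_nonneg)

lemma cweight_le_1: "0 \<le> \<alpha> \<Longrightarrow> cweight \<alpha> V \<gamma> \<le> 1"
  by (simp add: cweight_def boltz_le_1)

lemma cweight_eq_boltz_Ham:
  assumes "V (\<lambda>_. 0) = 0" "finite D" "csupp \<tau> \<subseteq> D"
  shows "cweight \<alpha> V \<tau> = boltz \<alpha> (Ham V D \<tau>)"
proof -
  have "(\<Sum>x\<in>csupp \<tau>. V (jump (\<tau> x) x)) = (\<Sum>x\<in>D. V (jump (\<tau> x) x))"
    using assms by (intro sum.mono_neutral_left) (auto simp: csupp_def)
  then show ?thesis by (simp add: cweight_def Ham_def)
qed

definition through :: "'d site \<Rightarrow> 'd perm set" where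
  "through x = {\<gamma>. is_finite_cycle \<gamma> \<and> x \<in> csupp \<gamma>}"

text \<open>The value \<open>id\<close> stands for \<open>x\<close> being a fixed point. If
  \<open>x\<close> already lies in \<open>A\<close>, disjointness leaves \<open>id\<close> as the
  only choice, so that exploring a site twice does nothing.\<close>

definition choice :: "'d site \<Rightarrow> 'd site set \<Rightarrow> 'd perm set" where
  "choice x A = {c. (c = id \<or> c \<in> through x) \<and> csupp c \<inter> A = {}}"

lemma id_notin_through [simp]: "id \<notin> through x" by (simp add: through_def)

lemma throughD: "\<gamma> \<in> through x \<Longrightarrow> is_finite_cycle \<gamma>" "\<gamma> \<in> through x \<Longrightarrow> x \<in> csupp \<gamma>"
    "\<gamma> \<in> through x \<Longrightarrow> finite (csupp \<gamma>)"
  by (auto simp: through_def finite_csupp)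

lemma countable_through: "countable (through (x :: ('d::finite) site))"
  by (rule countable_subset[OF _ countable_finite_cycles]) (auto simp: through_def)

lemma countable_choice: "countable (choice (x :: ('d::finite) site) A)"
  by (rule countable_subset[of _ "insert id (through x)"])
     (auto simp: choice_def countable_through)

lemma bij_betw_shift_through: "bij_betw (shift z) (through x) (through (tr z x))"
proof (rule bij_betw_byWitness[where f'="shift (neg z)"])
  show "shift z ` through x \<subseteq> through (tr z x)"
    by (auto simp: through_def is_finite_cycle_shift csupp_shift)
  show "shift (neg z) ` through (tr z x) \<subseteq> through x"
    by (auto simp: through_def is_finite_cycle_shift csupp_shift) (metis image_eqI tr_neg(2))
qed auto

lemma ex_tr: "\<exists>z. x = tr z y"
  by (rule exI[of _ "\<lambda>i. x i - y i"]) (auto simp: tr_def)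

lemma abs_ln_one_add_diff_le:
  fixes s t :: real assumes "0 \<le> s" "0 \<le> t"
  shows "\<bar>ln (1 + s) - ln (1 + t)\<bar> \<le> \<bar>s - t\<bar>"
proof -
  have *: "ln (1 + s) - ln (1 + t) \<le> \<bar>s - t\<bar>" if "0 \<le> s" "0 \<le> t" for s t :: real
  proof -
    have "ln (1 + s) - ln (1 + t) \<le> (1 + s - (1 + t)) / (1 + t)" by (rule ln_diff_le) (use that in auto)
    also have "\<dots> \<le> \<bar>s - t\<bar> / (1 + t)" using that by (intro divide_right_mono) auto
    also have "\<dots> \<le> \<bar>s - t\<bar> / 1" using that by (intro divide_left_mono) auto
    finally show ?thesis by simp
  qed
  show ?thesis using *[OF assms] *[OF assms(2,1)] by (simp add: abs_minus_commute abs_le_iff)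
qed

text \<open>The exponential is 1-Lipschitz on the nonpositive reals; this is the same fact in terms
  of the logarithms.\<close>

lemma abs_diff_le_ln_diff:
  fixes s t :: real assumes "0 < s" "s \<le> 1" "0 < t" "t \<le> 1"
  shows "\<bar>s - t\<bar> \<le> \<bar>ln s - ln t\<bar>"
proof -
  have *: "s - t \<le> \<bar>ln s - ln t\<bar>" if st: "0 < s" "s \<le> 1" "0 < t" for s t :: real
  proof (cases "t \<le> s")
    case True
    have "s - t \<le> (s - t) / s" using st True by (simp add: pos_le_divide_eq mult_left_le)
    also have "\<dots> = - ((t - s) / s)" by (metis minus_diff_eq minus_divide_left)
    also have "\<dots> \<le> - (ln t - ln s)" using ln_diff_le[of t s] st by simp
    finally show ?thesis by simp
  qed simp
  show ?thesis using *[of s t] *[of t s] assms by (simp add: abs_le_iff abs_minus_commute)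
qed

section \<open>The exploration recursion and its contraction property\<close>

text \<open>The parameter \<open>b\<close> is only an upper bound of \<open>beta\<close>, so that
  one \<open>b\<close> can serve two temperatures at once.\<close>

locale cycle_gas =
  fixes V :: "('d::finite) site \<Rightarrow> ennreal" and \<alpha> b :: real
  assumes V0: "V (\<lambda>_. 0) = 0" and alpha_nonneg: "0 \<le> \<alpha>"
    and b_nonneg: "0 \<le> b" and b_less_1: "b < 1" and beta_le: "beta V \<alpha> \<le> ennreal b"
begin

abbreviation w :: "'d perm \<Rightarrow> real" where "w \<equiv> cweight \<alpha> V"

lemmas w_nonneg = cweight_nonneg[of \<alpha> V] and w_le_1 = cweight_le_1[OF alpha_nonneg, of V]

text \<open>\<open>beta\<close> counts cycles through the origin; translations preserve weights and
  lengths, so its bound holds at every site.\<close>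

lemma card_weight_finite_sum_le:
  assumes "finite F" "F \<subseteq> through x"
  shows "(\<Sum>\<gamma>\<in>F. card (csupp \<gamma>) * w \<gamma>) \<le> b"
proof -
  have zero: "(\<Sum>\<gamma>\<in>F. card (csupp \<gamma>) * w \<gamma>) \<le> b" if F: "finite F" "F \<subseteq> through (\<lambda>_. 0)" for F
  proof -
    have "ennreal (\<Sum>\<gamma>\<in>F. card (csupp \<gamma>) * w \<gamma>) = (\<Sum>\<gamma>\<in>F. of_nat (card (csupp \<gamma>)) * ennreal (w \<gamma>))"
      using w_nonneg by (simp add: sum_nonneg ennreal_mult' ennreal_of_nat_eq_real_of_nat flip: sum_ennreal)
    also have "\<dots> \<le> beta V \<alpha>"
      unfolding beta_def using F
      by (subst nonneg_infsum_complete) (auto simp: through_def intro!: SUP_upper)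
    also have "\<dots> \<le> ennreal b" by (rule beta_le)
    finally show ?thesis using b_nonneg by (simp add: ennreal_le_iff)
  qed
  obtain z where z: "x = tr z (\<lambda>_. 0)" using ex_tr by blast
  define F' where "F' = shift (neg z) ` F"
  have FF: "F = shift z ` F'" by (auto simp: F'_def image_image)
  have inj: "inj_on (shift z) F'" by (metis inj_on_inverseI shift_neg(2))
  have "F' \<subseteq> through (\<lambda>_. 0)"
    using bij_betw_shift_through[of "neg z" x] assms(2) unfolding z F'_def bij_betw_def by auto
  moreover have "finite F'" using assms(1) by (simp add: F'_def)
  ultimately have "(\<Sum>\<gamma>\<in>F'. card (csupp \<gamma>) * w \<gamma>) \<le> b" by (intro zero)
  moreover have "(\<Sum>\<gamma>\<in>F. card (csupp \<gamma>) * w \<gamma>) = (\<Sum>\<gamma>\<in>F'. card (csupp \<gamma>) * w \<gamma>)"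
    unfolding FF using inj
    by (subst sum.reindex)
       (auto simp: csupp_shift cweight_shift card_image inj_on_subset[OF inj_tr] intro!: sum.cong)
  ultimately show ?thesis by simp
qed

lemma card_weight_summable: "(\<lambda>\<gamma>. card (csupp \<gamma>) * w \<gamma>) summable_on through x"
  by (rule nonneg_bdd_above_summable_on)
     (use card_weight_finite_sum_le w_nonneg in \<open>auto intro!: bdd_aboveI[of _ b]\<close>)

lemma card_weight_infsum_le: "(\<Sum>\<^sub>\<infinity>\<gamma>\<in>through x. card (csupp \<gamma>) * w \<gamma>) \<le> b"
  by (rule infsum_le_finite_sums[OF card_weight_summable card_weight_finite_sum_le])

lemma card_csupp_ge_1: "\<gamma> \<in> through x \<Longrightarrow> 1 \<le> card (csupp \<gamma>)"
  using throughD by (metis One_nat_def Suc_leI card_gt_0_iff empty_iff)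

text \<open>The length factor in \<open>beta\<close> acts as a budget: any quantity bounded by the
  cycle length may be summed against the weights, with total at most \<open>b\<close>.\<close>

lemma dominated_summable:
  fixes t :: "'d perm \<Rightarrow> real"
  assumes "\<And>\<gamma>. \<gamma> \<in> through x \<Longrightarrow> \<bar>t \<gamma>\<bar> \<le> card (csupp \<gamma>)"
  shows "(\<lambda>\<gamma>. w \<gamma> * t \<gamma>) summable_on through x" "\<bar>\<Sum>\<^sub>\<infinity>\<gamma>\<in>through x. w \<gamma> * t \<gamma>\<bar> \<le> b"
proof -
  have le: "\<bar>w \<gamma> * t \<gamma>\<bar> \<le> card (csupp \<gamma>) * w \<gamma>" if "\<gamma> \<in> through x" for \<gamma>
    using mult_right_mono[OF assms[OF that] w_nonneg[of \<gamma>]] w_nonneg[of \<gamma>]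
    by (simp add: abs_mult mult.commute[of "w \<gamma>"])
  have abs: "(\<lambda>\<gamma>. \<bar>w \<gamma> * t \<gamma>\<bar>) summable_on through x"
    by (rule summable_on_comparison_test[OF card_weight_summable[of x] le]) auto
  show "(\<lambda>\<gamma>. w \<gamma> * t \<gamma>) summable_on through x"
    by (rule abs_summable_summable) (use abs in simp)
  have "\<bar>\<Sum>\<^sub>\<infinity>\<gamma>\<in>through x. w \<gamma> * t \<gamma>\<bar> \<le> (\<Sum>\<^sub>\<infinity>\<gamma>\<in>through x. \<bar>w \<gamma> * t \<gamma>\<bar>)"
    using norm_infsum_bound[of "\<lambda>\<gamma>. w \<gamma> * t \<gamma>" "through x"] abs by simp
  also have "\<dots> \<le> (\<Sum>\<^sub>\<infinity>\<gamma>\<in>through x. card (csupp \<gamma>) * w \<gamma>)"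
    by (rule infsum_mono[OF abs card_weight_summable le])
  also have "\<dots> \<le> b" by (rule card_weight_infsum_le)
  finally show "\<bar>\<Sum>\<^sub>\<infinity>\<gamma>\<in>through x. w \<gamma> * t \<gamma>\<bar> \<le> b" .
qed

text \<open>\<^term>\<open>r A\<close> plays the role of the probability that all sites of \<^term>\<open>A\<close> are fixed points, when only
  cycles inside \<open>\<Lambda>\<close> are allowed; the identity decomposes according to the cycle through \<^term>\<open>x\<close>.\<close>

definition void_system :: "'d site set \<Rightarrow> ('d site set \<Rightarrow> real) \<Rightarrow> bool" where
  "void_system \<Lambda> r \<longleftrightarrow> r {} = 1 \<and> (\<forall>A B. finite B \<longrightarrow> A \<subseteq> B \<longrightarrow> 0 \<le> r B \<and> r B \<le> r A) \<and>
     (\<forall>A x. finite A \<longrightarrow>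
        ((\<lambda>c. w c * r (insert x A \<union> csupp c)) has_sum r A) {c \<in> choice x A. csupp c \<subseteq> \<Lambda>})"

context
  fixes \<Lambda> r assumes r: "void_system \<Lambda> r"
begin

lemma void_nonneg: "finite A \<Longrightarrow> 0 \<le> r A"
  using r unfolding void_system_def by blast

lemma void_mono: "finite B \<Longrightarrow> A \<subseteq> B \<Longrightarrow> r B \<le> r A"
  using r unfolding void_system_def by blast

lemma void_empty: "r {} = 1"
  using r unfolding void_system_def by blast

lemma void_split:
  assumes "finite A" "x \<notin> A"
  shows "r A = r (insert x A) +
    (\<Sum>\<^sub>\<infinity>\<gamma>\<in>through x. w \<gamma> * (if csupp \<gamma> \<subseteq> \<Lambda> - A then r (insert x A \<union> csupp \<gamma>) else 0))"
proof -
  let ?T = "{\<gamma> \<in> through x. csupp \<gamma> \<subseteq> \<Lambda> - A}"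
  let ?f = "\<lambda>c. w c * r (insert x A \<union> csupp c)"
  have ch: "{c \<in> choice x A. csupp c \<subseteq> \<Lambda>} = insert id ?T"
    using assms(2) by (auto simp: choice_def csupp_def)
  have hs: "(?f has_sum r A) (insert id ?T)"
    using r assms(1) unfolding void_system_def ch[symmetric] by blast
  have "?f summable_on ?T" by (rule summable_on_subset[OF has_sum_imp_summable[OF hs]]) auto
  then have "(?f has_sum infsum ?f ?T) ?T" by (rule has_sum_infsum)
  then have "(?f has_sum ?f id + infsum ?f ?T) (insert id ?T)"
    by (intro has_sum_insert) auto
  then have "r A = ?f id + infsum ?f ?T" using hs has_sum_unique by blast
  also have "infsum ?f ?T = (\<Sum>\<^sub>\<infinity>\<gamma>\<in>through x. w \<gamma> * (if csupp \<gamma> \<subseteq> \<Lambda> - A then r (insert x A \<union> csupp \<gamma>) else 0))"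
    by (rule infsum_cong_neutral) auto
  finally show ?thesis by simp
qed

text \<open>If \<open>r (insert x A)\<close> vanished, monotonicity would annihilate every term of
  the recursion for \<open>r A\<close>, and \<open>r A\<close> would vanish too.\<close>

lemma void_pos: "finite A \<Longrightarrow> 0 < r A"
proof (induction A rule: finite_induct)
  case (insert x A)
  show ?case
  proof (rule ccontr)
    assume "\<not> ?thesis"
    then have z: "r (insert x A) = 0" using void_nonneg[of "insert x A"] insert(1) by auto
    have "r (insert x A \<union> csupp \<gamma>) = 0" if "\<gamma> \<in> through x" for \<gamma>
      using void_mono[of "insert x A \<union> csupp \<gamma>" "insert x A"] void_nonneg[of "insert x A \<union> csupp \<gamma>"]
        z insert(1) throughD(3)[OF that] by auto
    then have "(\<Sum>\<^sub>\<infinity>\<gamma>\<in>through x. w \<gamma> * (if csupp \<gamma> \<subseteq> \<Lambda> - A then r (insert x A \<union> csupp \<gamma>) else 0)) = 0"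
      by (intro infsum_0) auto
    then show False using void_split[OF insert(1,2)] z insert(3) by simp
  qed
qed (simp add: void_empty)

text \<open>The conditional probability that all of \<open>csupp \<gamma>\<close> is fixed, given
  that \<open>insert x A\<close> is. Multiplied by the weight it is the odds of
  \<open>\<gamma>\<close> being the cycle at \<open>x\<close> against \<open>x\<close> being fixed,
  with cycles that do not fit into \<open>\<Lambda> - A\<close> ruled out.\<close>

definition void_ratio :: "'d site set \<Rightarrow> 'd site \<Rightarrow> 'd perm \<Rightarrow> real" where
  "void_ratio A x \<gamma> = (if csupp \<gamma> \<subseteq> \<Lambda> - A then r (insert x A \<union> csupp \<gamma>) / r (insert x A) else 0)"

lemma void_ratio_bounds:
  assumes "finite A" "\<gamma> \<in> through x"
  shows "0 \<le> void_ratio A x \<gamma>" "void_ratio A x \<gamma> \<le> 1"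
proof -
  have "r (insert x A \<union> csupp \<gamma>) \<le> r (insert x A)" "0 \<le> r (insert x A \<union> csupp \<gamma>)" "0 < r (insert x A)"
    using assms(1) throughD(3)[OF assms(2)] by (auto intro!: void_mono void_nonneg void_pos)
  then show "0 \<le> void_ratio A x \<gamma>" "void_ratio A x \<gamma> \<le> 1"
    by (auto simp: void_ratio_def divide_le_eq_1)
qed

lemma ln_void_insert:
  assumes "finite A" "x \<notin> A"
  shows "ln (r A) - ln (r (insert x A)) = ln (1 + (\<Sum>\<^sub>\<infinity>\<gamma>\<in>through x. w \<gamma> * void_ratio A x \<gamma>))"
proof -
  have pos: "0 < r A" "0 < r (insert x A)" using assms by (auto intro: void_pos)
  have "(\<Sum>\<^sub>\<infinity>\<gamma>\<in>through x. w \<gamma> * (if csupp \<gamma> \<subseteq> \<Lambda> - A then r (insert x A \<union> csupp \<gamma>) else 0))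
      = (\<Sum>\<^sub>\<infinity>\<gamma>\<in>through x. r (insert x A) * (w \<gamma> * void_ratio A x \<gamma>))"
    using pos by (intro infsum_cong) (auto simp: void_ratio_def)
  also have "\<dots> = r (insert x A) * (\<Sum>\<^sub>\<infinity>\<gamma>\<in>through x. w \<gamma> * void_ratio A x \<gamma>)"
    by (rule infsum_cmult_right')
  finally have "r A / r (insert x A) = 1 + (\<Sum>\<^sub>\<infinity>\<gamma>\<in>through x. w \<gamma> * void_ratio A x \<gamma>)"
    using void_split[OF assms] pos by (simp add: field_simps)
  moreover have "ln (r A) - ln (r (insert x A)) = ln (r A / r (insert x A))" using pos by (simp add: ln_div)
  ultimately show ?thesis by simp
qed

end

text \<open>The influence at \<open>x\<close> of changes outside the window \<open>C\<close>, after
  unfolding the recursion \<open>n\<close> times. A cycle through \<open>x\<close> passes on the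
  influence at its other sites and adds 1 if it leaves \<open>C\<close>. The start value 1 is the
  trivial bound, valid since \<open>b < 1\<close>.\<close>

primrec infl :: "nat \<Rightarrow> 'd site set \<Rightarrow> 'd site \<Rightarrow> real" where
  "infl 0 C x = 1"
| "infl (Suc n) C x = (\<Sum>\<^sub>\<infinity>\<gamma>\<in>through x. w \<gamma> *
      ((\<Sum>y\<in>csupp \<gamma> - {x}. infl n C y) + (if csupp \<gamma> \<subseteq> C then 0 else 1)))"

lemma infl_bounds: "0 \<le> infl n C x \<and> infl n C x \<le> 1"
  and infl_summand_bounds: "\<gamma> \<in> through x \<Longrightarrow>
    0 \<le> (\<Sum>y\<in>csupp \<gamma> - {x}. infl n C y) + (if csupp \<gamma> \<subseteq> C then 0 else 1) \<and>
    (\<Sum>y\<in>csupp \<gamma> - {x}. infl n C y) + (if csupp \<gamma> \<subseteq> C then 0 else 1) \<le> card (csupp \<gamma>)"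
proof -
  have summand: "0 \<le> (\<Sum>y\<in>csupp \<gamma> - {x}. infl n C y) + (if csupp \<gamma> \<subseteq> C then 0 else 1) \<and>
    (\<Sum>y\<in>csupp \<gamma> - {x}. infl n C y) + (if csupp \<gamma> \<subseteq> C then 0 else 1) \<le> card (csupp \<gamma>)"
    if g: "\<gamma> \<in> through x" and IH: "\<And>x. 0 \<le> infl n C x \<and> infl n C x \<le> 1" for n \<gamma> x
  proof -
    have "(\<Sum>y\<in>csupp \<gamma> - {x}. infl n C y) \<le> (\<Sum>y\<in>csupp \<gamma> - {x}. 1)"
      using IH by (intro sum_mono) auto
    \<comment> \<open>Omitting \<open>x\<close> from the sum leaves exactly the unit that covers the
      possible exit from \<open>C\<close>; the summand thus stays within the budget of
      \<open>dominated_summable\<close>.\<close>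
    also have "\<dots> = real (card (csupp \<gamma>)) - 1"
      using throughD[OF g] card_csupp_ge_1[OF g] by (simp add: card_Diff_singleton of_nat_diff)
    moreover have "0 \<le> (\<Sum>y\<in>csupp \<gamma> - {x}. infl n C y)" using IH by (intro sum_nonneg) auto
    ultimately show ?thesis by (auto simp: sum_nonneg)
  qed
  have main: "0 \<le> infl n C x \<and> infl n C x \<le> 1" for n x
  proof (induction n arbitrary: x)
    case (Suc n)
    have "\<bar>infl (Suc n) C x\<bar> \<le> b"
      unfolding infl.simps by (rule dominated_summable(2)) (use summand[OF _ Suc] in auto)
    moreover have "0 \<le> infl (Suc n) C x"
      unfolding infl.simps by (rule infsum_nonneg) (use summand[OF _ Suc] w_nonneg in auto)
    ultimately show ?case using b_less_1 by auto
  qed simp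
  then show "0 \<le> infl n C x \<and> infl n C x \<le> 1" by auto
  show "\<gamma> \<in> through x \<Longrightarrow>
    0 \<le> (\<Sum>y\<in>csupp \<gamma> - {x}. infl n C y) + (if csupp \<gamma> \<subseteq> C then 0 else 1) \<and>
    (\<Sum>y\<in>csupp \<gamma> - {x}. infl n C y) + (if csupp \<gamma> \<subseteq> C then 0 else 1) \<le> card (csupp \<gamma>)"
    using summand main by blast
qed

text \<open>No cycle leaves the full window, so only the contraction by \<open>b\<close> at each
  level remains.\<close>

lemma infl_UNIV_le: "infl n UNIV x \<le> b ^ n"
proof (induction n arbitrary: x)
  case (Suc n)
  have "infl (Suc n) UNIV x \<le> (\<Sum>\<^sub>\<infinity>\<gamma>\<in>through x. b ^ n * (card (csupp \<gamma>) * w \<gamma>))"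
    unfolding infl.simps
  proof (rule infsum_mono)
    show "(\<lambda>\<gamma>. w \<gamma> * ((\<Sum>y\<in>csupp \<gamma> - {x}. infl n UNIV y) + (if csupp \<gamma> \<subseteq> UNIV then 0 else 1))) summable_on through x"
      by (rule dominated_summable(1)) (use infl_summand_bounds[of _ x n UNIV] in force)
    show "(\<lambda>\<gamma>. b ^ n * (card (csupp \<gamma>) * w \<gamma>)) summable_on through x"
      by (intro summable_on_cmult_right card_weight_summable)
    fix \<gamma> assume g: "\<gamma> \<in> through x"
    have "(\<Sum>y\<in>csupp \<gamma> - {x}. infl n UNIV y) \<le> (\<Sum>y\<in>csupp \<gamma> - {x}. b ^ n)"
      by (intro sum_mono Suc)
    also have "\<dots> \<le> (\<Sum>y\<in>csupp \<gamma>. b ^ n)"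
      using throughD[OF g] b_nonneg by (intro sum_mono2) auto
    also have "\<dots> = b ^ n * card (csupp \<gamma>)" by simp
    finally show "w \<gamma> * ((\<Sum>y\<in>csupp \<gamma> - {x}. infl n UNIV y) + (if csupp \<gamma> \<subseteq> UNIV then 0 else 1))
        \<le> b ^ n * (card (csupp \<gamma>) * w \<gamma>)"
      using mult_left_mono[OF _ w_nonneg[of \<gamma>]] by (force simp: mult_ac)
  qed
  also have "\<dots> = b ^ n * (\<Sum>\<^sub>\<infinity>\<gamma>\<in>through x. card (csupp \<gamma>) * w \<gamma>)" by (rule infsum_cmult_right')
  also have "\<dots> \<le> b ^ n * b" using card_weight_infsum_le b_nonneg by (intro mult_left_mono) auto
  finally show ?case by (simp add: mult.commute)
qed simp

text \<open>At fixed depth a given cycle has finite support and is eventually inside the window;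
  dominated convergence handles the sum over cycles.\<close>

lemma infl_tendsto:
  assumes "\<And>y. \<forall>\<^sub>F k in G. y \<in> C k"
  shows "((\<lambda>k. infl n (C k) x) \<longlongrightarrow> infl n UNIV x) G"
proof (induction n arbitrary: x)
  case (Suc n)
  show ?case unfolding infl.simps
  proof (rule tendsto_infsum_dominated[OF card_weight_summable])
    show "\<forall>\<^sub>F k in G. \<forall>\<gamma>\<in>through x. \<bar>w \<gamma> * ((\<Sum>y\<in>csupp \<gamma> - {x}. infl n (C k) y) + (if csupp \<gamma> \<subseteq> C k then 0 else 1))\<bar>
        \<le> card (csupp \<gamma>) * w \<gamma>"
    proof (intro always_eventually allI ballI)
      fix k \<gamma> assume g: "\<gamma> \<in> through x"
      show "\<bar>w \<gamma> * ((\<Sum>y\<in>csupp \<gamma> - {x}. infl n (C k) y) + (if csupp \<gamma> \<subseteq> C k then 0 else 1))\<bar>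
        \<le> card (csupp \<gamma>) * w \<gamma>"
        using infl_summand_bounds[OF g, of n "C k"] w_nonneg[of \<gamma>]
        unfolding abs_mult by (simp add: mult.commute mult_left_mono del: sum.infinite)
    qed
    fix \<gamma> assume g: "\<gamma> \<in> through x"
    have "\<forall>\<^sub>F k in G. \<forall>y\<in>csupp \<gamma>. y \<in> C k"
      using throughD(3)[OF g] assms by (intro eventually_ball_finite) auto
    then have "\<forall>\<^sub>F k in G. (if csupp \<gamma> \<subseteq> C k then 0 else 1) = (if csupp \<gamma> \<subseteq> UNIV then 0 else 1 :: real)"
      by eventually_elim auto
    then have "((\<lambda>k. if csupp \<gamma> \<subseteq> C k then 0 else 1 :: real) \<longlongrightarrow> (if csupp \<gamma> \<subseteq> UNIV then 0 else 1)) G"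
      by (rule tendsto_eventually)
    then show "((\<lambda>k. w \<gamma> * ((\<Sum>y\<in>csupp \<gamma> - {x}. infl n (C k) y) + (if csupp \<gamma> \<subseteq> C k then 0 else 1))) \<longlongrightarrow>
       w \<gamma> * ((\<Sum>y\<in>csupp \<gamma> - {x}. infl n UNIV y) + (if csupp \<gamma> \<subseteq> UNIV then 0 else 1))) G"
      by (intro tendsto_intros Suc)
  qed
qed simp

text \<open>The maps \<open>s \<mapsto> ln (1 + s)\<close> and
  \<open>u \<mapsto> exp (- u)\<close> are 1-Lipschitz on the nonnegative reals, so the recursion in \<open>ln_void_insert\<close> contracts
  by the factor \<open>b\<close>.\<close>

lemma void_compare:
  assumes r: "void_system \<Lambda> r" and r': "void_system \<Lambda>' r'"
    and fin: "finite A" "finite A'" and x: "x \<notin> A" "x \<notin> A'"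
    and agree: "(\<Lambda> - A) \<inter> C = (\<Lambda>' - A') \<inter> C"
  shows "\<bar>(ln (r A) - ln (r (insert x A))) - (ln (r' A') - ln (r' (insert x A')))\<bar> \<le> infl n C x"
  using fin x agree
proof (induction n arbitrary: A A' x)
  case 0
  let ?S = "\<Sum>\<^sub>\<infinity>\<gamma>\<in>through x. w \<gamma> * void_ratio \<Lambda> r A x \<gamma>" and ?S' = "\<Sum>\<^sub>\<infinity>\<gamma>\<in>through x. w \<gamma> * void_ratio \<Lambda>' r' A' x \<gamma>"
  \<comment> \<open>At depth 0 nothing is compared: both sums lie between 0 and \<open>b\<close>,
    hence their difference is below 1.\<close>
  have S: "0 \<le> ?S" "\<bar>?S\<bar> \<le> b"
    using void_ratio_bounds[OF r 0(1)] card_csupp_ge_1 w_nonneg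
    by (auto intro!: infsum_nonneg dominated_summable(2)) fastforce
  have S': "0 \<le> ?S'" "\<bar>?S'\<bar> \<le> b"
    using void_ratio_bounds[OF r' 0(2)] card_csupp_ge_1 w_nonneg
    by (auto intro!: infsum_nonneg dominated_summable(2)) fastforce
  show ?case
    using abs_ln_one_add_diff_le[OF S(1) S'(1)] S S' b_less_1
    unfolding ln_void_insert[OF r 0(1,3)] ln_void_insert[OF r' 0(2,4)] infl.simps by linarith
next
  case (Suc n)
  let ?t = "void_ratio \<Lambda> r A x" and ?t' = "void_ratio \<Lambda>' r' A' x"
  let ?S = "\<Sum>\<^sub>\<infinity>\<gamma>\<in>through x. w \<gamma> * ?t \<gamma>" and ?S' = "\<Sum>\<^sub>\<infinity>\<gamma>\<in>through x. w \<gamma> * ?t' \<gamma>"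
  let ?a = "\<lambda>\<gamma>. (\<Sum>y\<in>csupp \<gamma> - {x}. infl n C y) + (if csupp \<gamma> \<subseteq> C then 0 else 1)"
  note bt = void_ratio_bounds[OF r Suc.prems(1)] and bt' = void_ratio_bounds[OF r' Suc.prems(2)]
  \<comment> \<open>Telescoping: both void sets receive the same site at each step, so the
    environments keep agreeing inside \<open>C\<close> and the induction hypothesis applies to every
    increment.\<close>
  have tele: "\<bar>(ln (r A1) - ln (r (A1 \<union> B))) - (ln (r' A1') - ln (r' (A1' \<union> B)))\<bar> \<le> (\<Sum>y\<in>B. infl n C y)"
    if B: "finite B" "B \<inter> A1 = {}" "B \<inter> A1' = {}" and A1: "finite A1" "finite A1'"
      "(\<Lambda> - A1) \<inter> C = (\<Lambda>' - A1') \<inter> C" for B A1 A1'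
    using B
  proof (induction B rule: finite_induct)
    case (insert y B)
    have "\<bar>(ln (r (A1 \<union> B)) - ln (r (insert y (A1 \<union> B)))) - (ln (r' (A1' \<union> B)) - ln (r' (insert y (A1' \<union> B))))\<bar>
        \<le> infl n C y"
      by (rule Suc.IH) (use insert A1 in auto)
    then show ?case using insert by auto
  qed simp
  have key: "\<bar>?t \<gamma> - ?t' \<gamma>\<bar> \<le> ?a \<gamma>" if g: "\<gamma> \<in> through x" for \<gamma>
  proof -
    have nn: "0 \<le> (\<Sum>y\<in>csupp \<gamma> - {x}. infl n C y)" using infl_bounds by (intro sum_nonneg) auto
    consider "csupp \<gamma> \<subseteq> \<Lambda> - A" "csupp \<gamma> \<subseteq> \<Lambda>' - A'" | "\<not> csupp \<gamma> \<subseteq> \<Lambda> - A" "\<not> csupp \<gamma> \<subseteq> \<Lambda>' - A'"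
      | "csupp \<gamma> \<subseteq> \<Lambda> - A \<longleftrightarrow> \<not> csupp \<gamma> \<subseteq> \<Lambda>' - A'" by blast
    then show ?thesis
    proof cases
      case 1
      let ?B = "csupp \<gamma> - {x}"
      have fB: "finite (csupp \<gamma>)" using throughD(3)[OF g] .
      have eq: "insert x A \<union> csupp \<gamma> = insert x A \<union> ?B" "insert x A' \<union> csupp \<gamma> = insert x A' \<union> ?B" by auto
      have pos: "0 < r (insert x A)" "0 < r (insert x A \<union> ?B)" "0 < r' (insert x A')" "0 < r' (insert x A' \<union> ?B)"
        using Suc.prems fB by (auto intro!: void_pos[OF r] void_pos[OF r'])
      have t: "?t \<gamma> = r (insert x A \<union> ?B) / r (insert x A)" "?t' \<gamma> = r' (insert x A' \<union> ?B) / r' (insert x A')"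
        using 1 unfolding void_ratio_def[OF r] void_ratio_def[OF r'] eq by auto
      have tpos: "0 < ?t \<gamma>" "0 < ?t' \<gamma>" unfolding t using pos by auto
      have "\<bar>?t \<gamma> - ?t' \<gamma>\<bar> \<le> \<bar>ln (?t \<gamma>) - ln (?t' \<gamma>)\<bar>"
        by (rule abs_diff_le_ln_diff) (use tpos bt[OF g] bt'[OF g] in auto)
      also have "\<dots> = \<bar>(ln (r (insert x A)) - ln (r (insert x A \<union> ?B))) - (ln (r' (insert x A')) - ln (r' (insert x A' \<union> ?B)))\<bar>"
        unfolding t using pos by (simp add: ln_div)
      also have "\<dots> \<le> (\<Sum>y\<in>?B. infl n C y)"
        by (rule tele) (use 1 fB Suc.prems in auto)
      finally show ?thesis by auto
    next
      case 2
      then show ?thesis using nn by (simp add: void_ratio_def[OF r] void_ratio_def[OF r'])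
    next
      case 3
      then have "\<not> csupp \<gamma> \<subseteq> C" using Suc.prems(5) by blast
      then show ?thesis using nn bt[OF g] bt'[OF g] by auto
    qed
  qed
  have st: "(\<lambda>\<gamma>. w \<gamma> * ?t \<gamma>) summable_on through x"
    by (rule dominated_summable(1)) (use bt card_csupp_ge_1 in fastforce)
  have st': "(\<lambda>\<gamma>. w \<gamma> * ?t' \<gamma>) summable_on through x"
    by (rule dominated_summable(1)) (use bt' card_csupp_ge_1 in fastforce)
  have S0: "0 \<le> ?S" "0 \<le> ?S'" using bt bt' w_nonneg by (auto intro!: infsum_nonneg)
  have sa: "(\<lambda>\<gamma>. w \<gamma> * ?a \<gamma>) summable_on through x"
    by (rule dominated_summable(1)) (use infl_summand_bounds in auto)
  have d: "?S - ?S' = (\<Sum>\<^sub>\<infinity>\<gamma>\<in>through x. w \<gamma> * ?t \<gamma> - w \<gamma> * ?t' \<gamma>)"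
    using infsum_add[OF st summable_on_uminus[THEN iffD2, OF st']] by (simp add: infsum_uminus)
  have le: "\<bar>w \<gamma> * ?t \<gamma> - w \<gamma> * ?t' \<gamma>\<bar> \<le> w \<gamma> * ?a \<gamma>" if g: "\<gamma> \<in> through x" for \<gamma>
  proof -
    have "w \<gamma> * ?t \<gamma> - w \<gamma> * ?t' \<gamma> = w \<gamma> * (?t \<gamma> - ?t' \<gamma>)" by (simp add: right_diff_distrib)
    then show ?thesis using key[OF g] w_nonneg[of \<gamma>] by (simp add: abs_mult mult_left_mono)
  qed
  have abss: "(\<lambda>\<gamma>. \<bar>w \<gamma> * ?t \<gamma> - w \<gamma> * ?t' \<gamma>\<bar>) summable_on through x"
    by (rule summable_on_comparison_test[OF sa]) (use le in auto)
  have "\<bar>?S - ?S'\<bar> \<le> (\<Sum>\<^sub>\<infinity>\<gamma>\<in>through x. \<bar>w \<gamma> * ?t \<gamma> - w \<gamma> * ?t' \<gamma>\<bar>)"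
    unfolding d using norm_infsum_bound[of "\<lambda>\<gamma>. w \<gamma> * ?t \<gamma> - w \<gamma> * ?t' \<gamma>" "through x"] abss by simp
  also have "\<dots> \<le> infl (Suc n) C x"
    unfolding infl.simps by (rule infsum_mono[OF abss sa le])
  finally have "\<bar>?S - ?S'\<bar> \<le> infl (Suc n) C x" .
  then show ?case
    using abs_ln_one_add_diff_le[OF S0]
    unfolding ln_void_insert[OF r Suc.prems(1,3)] ln_void_insert[OF r' Suc.prems(2,4)] by linarith
qed

lemma void_compare_set:
  assumes r: "void_system \<Lambda> r" and r': "void_system \<Lambda>' r'"
    and fin: "finite A" "finite A'" and B: "finite B" "B \<inter> A = {}" "B \<inter> A' = {}"
    and agree: "(\<Lambda> - A) \<inter> C = (\<Lambda>' - A') \<inter> C"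
  shows "\<bar>(ln (r A) - ln (r (A \<union> B))) - (ln (r' A') - ln (r' (A' \<union> B)))\<bar> \<le> (\<Sum>y\<in>B. infl n C y)"
  using B
proof (induction B rule: finite_induct)
  case (insert y B)
  have "\<bar>(ln (r (A \<union> B)) - ln (r (insert y (A \<union> B)))) - (ln (r' (A' \<union> B)) - ln (r' (insert y (A' \<union> B))))\<bar>
      \<le> infl n C y"
    by (rule void_compare[OF r r']) (use insert fin agree in auto)
  then show ?case using insert by auto
qed simp

text \<open>Taking the full window and the empty initial void set leaves the bound
  \<open>card A * b ^ n\<close> for every depth \<open>n\<close>.\<close>

lemma void_unique:
  assumes r: "void_system UNIV r" and r': "void_system UNIV r'" and A: "finite A"
  shows "r A = r' A"
proof -
  have "\<bar>ln (r A) - ln (r' A)\<bar> \<le> card A * b ^ n" for n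
  proof -
    have "\<bar>(ln (r {}) - ln (r ({} \<union> A))) - (ln (r' {}) - ln (r' ({} \<union> A)))\<bar> \<le> (\<Sum>y\<in>A. infl n UNIV y)"
      by (rule void_compare_set[OF r r']) (use A in auto)
    also have "\<dots> \<le> (\<Sum>y\<in>A. b ^ n)" by (intro sum_mono infl_UNIV_le)
    finally show ?thesis by (simp add: void_empty[OF r] void_empty[OF r'])
  qed
  moreover have "(\<lambda>n. card A * b ^ n) \<longlonglongrightarrow> real (card A) * 0"
    by (intro tendsto_intros LIMSEQ_realpow_zero b_nonneg b_less_1)
  ultimately have "\<bar>ln (r A) - ln (r' A)\<bar> \<le> real (card A) * 0"
    by (intro tendsto_lowerbound[of _ _ sequentially]) auto
  then show ?thesis using void_pos[OF r A] void_pos[OF r' A] by simp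
qed

text \<open>The order of choices matters: first a depth \<open>n\<close> at which the influence in
  the full window is small, then windows large enough for this \<open>n\<close>. The filter is left
  general because windows arise both as growing volumes and as complements of receding sets.\<close>

lemma infl_sum_small:
  assumes "finite B" "\<And>y. \<forall>\<^sub>F k in G. y \<in> C k" "0 < e"
  shows "\<exists>n. \<forall>\<^sub>F k in G. (\<Sum>y\<in>B. infl n (C k) y) < e"
proof -
  have "(\<lambda>n. card B * b ^ n) \<longlonglongrightarrow> real (card B) * 0"
    by (intro tendsto_intros LIMSEQ_realpow_zero b_nonneg b_less_1)
  then have "\<forall>\<^sub>F n in sequentially. card B * b ^ n < e" using assms(3) by (intro order_tendstoD) auto
  then obtain n where n: "card B * b ^ n < e" by (auto simp: eventually_sequentially)
  have "((\<lambda>k. \<Sum>y\<in>B. infl n (C k) y) \<longlongrightarrow> (\<Sum>y\<in>B. infl n UNIV y)) G"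
    by (intro tendsto_sum infl_tendsto assms)
  moreover have "(\<Sum>y\<in>B. infl n UNIV y) < e"
  proof -
    have "(\<Sum>y\<in>B. infl n UNIV y) \<le> (\<Sum>y\<in>B. b ^ n)" by (intro sum_mono infl_UNIV_le)
    then show ?thesis using n by simp
  qed
  ultimately show ?thesis by (intro exI[of _ n] order_tendstoD(2))
qed

end

section \<open>Specifications\<close>

lemma Zpart_nonneg: "0 \<le> Zpart \<alpha> V \<Lambda> \<xi>"
  unfolding Zpart_def by (intro sum_nonneg boltz_nonneg)

lemma SL_subset: "SL \<Lambda> \<xi> \<subseteq> Sperm" by (auto simp: SL_def)

text \<open>\<open>measure_of\<close> yields the intended values only if the given set function is a
  measure; recognising it as the image of a finite point measure settles this.\<close>

lemma Gspec_eq_distr: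
  fixes \<xi> :: "('d::finite) perm"
  assumes "finite \<Lambda>" "\<xi> \<in> Sperm"
  shows "Gspec \<alpha> V \<Lambda> \<xi> = distr (point_measure (SL \<Lambda> \<xi>)
     (\<lambda>\<sigma>. ennreal (boltz \<alpha> (Ham V \<Lambda> \<sigma>) / Zpart \<alpha> V \<Lambda> \<xi>))) SM (\<lambda>\<sigma>. \<sigma>)"
proof -
  let ?f = "\<lambda>\<sigma>. ennreal (boltz \<alpha> (Ham V \<Lambda> \<sigma>) / Zpart \<alpha> V \<Lambda> \<xi>)"
  let ?P = "point_measure (SL \<Lambda> \<xi>) ?f"
  let ?N = "distr ?P SM (\<lambda>\<sigma>. \<sigma>)"
  have m: "(\<lambda>\<sigma>. \<sigma>) \<in> measurable ?P SM"
    using SL_subset[of \<Lambda> \<xi>] by (auto simp: measurable_def space_point_measure sets_point_measure)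
  have em: "emeasure ?N A = (\<Sum>\<sigma>\<in>SL \<Lambda> \<xi> \<inter> A. ?f \<sigma>)" if "A \<in> sets SM" for A
  proof -
    have "emeasure ?N A = emeasure ?P (SL \<Lambda> \<xi> \<inter> A)"
      using that m by (simp add: emeasure_distr space_point_measure Int_commute)
    also have "\<dots> = (\<Sum>\<sigma>\<in>SL \<Lambda> \<xi> \<inter> A. ?f \<sigma>)"
      by (rule emeasure_point_measure_finite) (use finite_SL[OF assms] in auto)
    finally show ?thesis .
  qed
  have "Gspec \<alpha> V \<Lambda> \<xi> = measure_of (space ?N) (sets ?N) (emeasure ?N)"
    unfolding Gspec_def space_distr sets_distr space_SM
  proof (rule measure_of_eq)
    show "sets SM \<subseteq> Pow (Sperm :: 'd perm set)"
      using sets.space_closed[of "SM :: 'd perm measure"] by simp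
    fix X assume "X \<in> sigma_sets (Sperm :: 'd perm set) (sets SM)"
    then have "X \<in> sets SM" using sets.sigma_sets_eq[of "SM :: 'd perm measure"] by simp
    then show "(\<Sum>\<sigma>\<in>SL \<Lambda> \<xi> \<inter> X. ?f \<sigma>) = emeasure ?N X" by (simp add: em)
  qed
  then show ?thesis using measure_of_of_measure[of ?N] by simp
qed

lemma sets_Gspec [simp]:
  fixes \<xi> :: "('d::finite) perm" assumes "finite \<Lambda>" "\<xi> \<in> Sperm"
  shows "sets (Gspec \<alpha> V \<Lambda> \<xi>) = sets SM"
  by (simp add: Gspec_eq_distr[OF assms])

lemma emeasure_Gspec:
  fixes \<xi> :: "('d::finite) perm"
  assumes "finite \<Lambda>" "\<xi> \<in> Sperm" "A \<in> sets SM"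
  shows "emeasure (Gspec \<alpha> V \<Lambda> \<xi>) A =
    ennreal (\<Sum>\<sigma>\<in>SL \<Lambda> \<xi> \<inter> A. boltz \<alpha> (Ham V \<Lambda> \<sigma>) / Zpart \<alpha> V \<Lambda> \<xi>)"
proof -
  let ?f = "\<lambda>\<sigma>. ennreal (boltz \<alpha> (Ham V \<Lambda> \<sigma>) / Zpart \<alpha> V \<Lambda> \<xi>)"
  let ?P = "point_measure (SL \<Lambda> \<xi>) ?f"
  have m: "(\<lambda>\<sigma>. \<sigma>) \<in> measurable ?P SM"
    using SL_subset[of \<Lambda> \<xi>] by (auto simp: measurable_def space_point_measure sets_point_measure)
  have "emeasure (Gspec \<alpha> V \<Lambda> \<xi>) A = emeasure ?P (SL \<Lambda> \<xi> \<inter> A)"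
    unfolding Gspec_eq_distr[OF assms(1,2)]
    using assms(3) m by (simp add: emeasure_distr space_point_measure Int_commute)
  also have "\<dots> = (\<Sum>\<sigma>\<in>SL \<Lambda> \<xi> \<inter> A. ?f \<sigma>)"
    by (rule emeasure_point_measure_finite) (use finite_SL[OF assms(1,2)] in auto)
  also have "\<dots> = ennreal (\<Sum>\<sigma>\<in>SL \<Lambda> \<xi> \<inter> A. boltz \<alpha> (Ham V \<Lambda> \<sigma>) / Zpart \<alpha> V \<Lambda> \<xi>)"
    by (rule sum_ennreal) (simp add: boltz_nonneg Zpart_nonneg)
  finally show ?thesis .
qed

lemma measure_Gspec:
  fixes \<xi> :: "('d::finite) perm"
  assumes "finite \<Lambda>" "\<xi> \<in> Sperm" "A \<in> sets SM"
  shows "measure (Gspec \<alpha> V \<Lambda> \<xi>) A = (\<Sum>\<sigma>\<in>SL \<Lambda> \<xi> \<inter> A. boltz \<alpha> (Ham V \<Lambda> \<sigma>)) / Zpart \<alpha> V \<Lambda> \<xi>"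
  unfolding measure_def emeasure_Gspec[OF assms]
  by (subst enn2real_ennreal) (auto simp: sum_divide_distrib boltz_nonneg Zpart_nonneg intro!: sum_nonneg)

lemma id_Sperm [simp]: "id \<in> Sperm" "(\<lambda>a. a) \<in> Sperm" by (simp_all add: Sperm_def flip: id_def)

text \<open>The map \<open>\<sigma> \<mapsto> \<sigma> \<circ> \<tau>\<close> is a bijection from
  fillings that fix \<open>D\<close> to fillings that equal \<open>\<tau>\<close> on
  \<open>D\<close>. On \<open>csupp \<tau>\<close> it replaces the factor 1 of fixed points by the
  factors of \<open>\<tau>\<close>; elsewhere no jump changes.\<close>

lemma finite_boltz_SL_sum_toggle:
  fixes \<xi> :: "('d::finite) perm"
  assumes V0: "V (\<lambda>_. 0) = 0" and fin: "finite \<Lambda>" and \<xi>: "\<xi> \<in> Sperm"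
    and \<tau>: "bij \<tau>" "csupp \<tau> \<subseteq> \<Lambda>" "csupp \<tau> \<subseteq> D"
  shows "(\<Sum>\<sigma>\<in>SL \<Lambda> \<xi> \<inter> cyl D \<tau>. boltz \<alpha> (Ham V \<Lambda> \<sigma>)) =
    cweight \<alpha> V \<tau> * (\<Sum>\<sigma>\<in>SL \<Lambda> \<xi> \<inter> cyl D id. boltz \<alpha> (Ham V \<Lambda> \<sigma>))"
proof -
  have fs: "finite (csupp \<tau>)" using fin \<tau>(2) finite_subset by blast
  have out: "\<tau> x = x" if "x \<notin> csupp \<tau>" for x using that by (simp add: csupp_def)
  have \<tau>in: "\<tau> x \<in> csupp \<tau>" if "x \<in> csupp \<tau>" for x
    using that \<tau>(1) unfolding csupp_def by (auto dest: bij_is_inj injD)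
  have bij: "bij_betw (\<lambda>\<sigma>. \<sigma> \<circ> \<tau>) (SL \<Lambda> \<xi> \<inter> cyl D id) (SL \<Lambda> \<xi> \<inter> cyl D \<tau>)"
  proof (rule bij_betw_byWitness[where f'="\<lambda>\<sigma>. \<sigma> \<circ> inv \<tau>"])
    have inv1: "\<tau> \<circ> inv \<tau> = id" "inv \<tau> \<circ> \<tau> = id" using \<tau>(1) by (auto simp: bij_def surj_iff)
    show "\<forall>\<sigma>\<in>SL \<Lambda> \<xi> \<inter> cyl D id. \<sigma> \<circ> \<tau> \<circ> inv \<tau> = \<sigma>" by (simp add: comp_assoc inv1)
    show "\<forall>\<sigma>\<in>SL \<Lambda> \<xi> \<inter> cyl D \<tau>. \<sigma> \<circ> inv \<tau> \<circ> \<tau> = \<sigma>" by (simp add: comp_assoc inv1)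
    have iout: "inv \<tau> x = x" if "x \<notin> csupp \<tau>" for x
      using out[OF that] \<tau>(1) by (metis bij_def inv_f_f)
    have iin: "inv \<tau> x \<in> csupp \<tau>" if "x \<in> csupp \<tau>" for x
      using that \<tau>(1) out by (metis bij_inv_eq_iff)
    show "(\<lambda>\<sigma>. \<sigma> \<circ> \<tau>) ` (SL \<Lambda> \<xi> \<inter> cyl D id) \<subseteq> SL \<Lambda> \<xi> \<inter> cyl D \<tau>"
    proof (intro image_subsetI)
      fix \<sigma> assume s: "\<sigma> \<in> SL \<Lambda> \<xi> \<inter> cyl D id"
      have "\<sigma> (\<tau> x) = \<xi> x" if "x \<notin> \<Lambda>" for x
      proof -
        have "\<tau> x = x" using that \<tau>(2) by (intro out) auto
        then show ?thesis using s that by (simp add: SL_def)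
      qed
      moreover have "\<sigma> (\<tau> x) = \<tau> x" if "x \<in> D" for x
        using s that \<tau>(3) out[of x] \<tau>in[of x] by (cases "x \<in> csupp \<tau>") (auto simp: cyl_def)
      ultimately show "\<sigma> \<circ> \<tau> \<in> SL \<Lambda> \<xi> \<inter> cyl D \<tau>"
        using s \<tau>(1) by (auto simp: SL_def cyl_def Sperm_def intro: bij_comp)
    qed
    show "(\<lambda>\<sigma>. \<sigma> \<circ> inv \<tau>) ` (SL \<Lambda> \<xi> \<inter> cyl D \<tau>) \<subseteq> SL \<Lambda> \<xi> \<inter> cyl D id"
    proof (intro image_subsetI)
      fix \<sigma> assume s: "\<sigma> \<in> SL \<Lambda> \<xi> \<inter> cyl D \<tau>"
      have "\<sigma> (inv \<tau> x) = \<xi> x" if "x \<notin> \<Lambda>" for x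
      proof -
        have "inv \<tau> x = x" using that \<tau>(2) by (intro iout) auto
        then show ?thesis using s that by (simp add: SL_def)
      qed
      moreover have "\<sigma> (inv \<tau> x) = x" if "x \<in> D" for x
      proof -
        have "inv \<tau> x \<in> D" using that iin[of x] iout[of x] \<tau>(3) by (cases "x \<in> csupp \<tau>") auto
        then have "\<sigma> (inv \<tau> x) = \<tau> (inv \<tau> x)" using s by (auto simp: cyl_def)
        then show ?thesis using \<tau>(1) by (simp add: bij_is_surj surj_f_inv_f)
      qed
      ultimately show "\<sigma> \<circ> inv \<tau> \<in> SL \<Lambda> \<xi> \<inter> cyl D id"
        using s \<tau>(1) by (auto simp: SL_def cyl_def Sperm_def intro: bij_comp bij_imp_bij_inv)
    qed
  qed
  have wt: "boltz \<alpha> (Ham V \<Lambda> (\<sigma> \<circ> \<tau>)) = cweight \<alpha> V \<tau> * boltz \<alpha> (Ham V \<Lambda> \<sigma>)"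
    if s: "\<sigma> \<in> SL \<Lambda> \<xi> \<inter> cyl D id" for \<sigma>
  proof -
    let ?e = "\<lambda>\<sigma> x. boltz \<alpha> (V (jump (\<sigma> x) x))"
    have fx: "\<sigma> x = x" if "x \<in> csupp \<tau>" for x using s that \<tau>(3) by (auto simp: cyl_def)
    have split: "prod (?e \<rho>) \<Lambda> = prod (?e \<rho>) (csupp \<tau>) * prod (?e \<rho>) (\<Lambda> - csupp \<tau>)" for \<rho>
      using prod.subset_diff[OF \<tau>(2) fin, of "?e \<rho>"] by (simp add: mult.commute)
    have "prod (?e (\<sigma> \<circ> \<tau>)) (csupp \<tau>) = prod (?e \<tau>) (csupp \<tau>)"
      using fx \<tau>in by (intro prod.cong) auto
    moreover have "prod (?e (\<sigma> \<circ> \<tau>)) (\<Lambda> - csupp \<tau>) = prod (?e \<sigma>) (\<Lambda> - csupp \<tau>)"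
      using out by (intro prod.cong) auto
    moreover have "prod (?e \<sigma>) (csupp \<tau>) = 1"
      using fx V0 by (intro prod.neutral) auto
    ultimately show ?thesis
      unfolding boltz_Ham split[of "\<sigma> \<circ> \<tau>"] split[of \<sigma>] cweight_def boltz_sum by simp
  qed
  show ?thesis
    unfolding sum_distrib_left sum.reindex_bij_betw[OF bij, symmetric] by (rule sum.cong) (auto simp: wt)
qed

text \<open>The ratio does not involve \<open>\<xi>\<close>, which is why the relation survives
  averaging over boundary conditions. For a vanishing partition function both sides are 0 by the
  convention for division.\<close>

lemma measure_Gspec_toggle:
  fixes \<xi> :: "('d::finite) perm"
  assumes "V (\<lambda>_. 0) = 0" "finite \<Lambda>" "\<xi> \<in> Sperm" "finite D"
    "bij \<tau>" "csupp \<tau> \<subseteq> \<Lambda>" "csupp \<tau> \<subseteq> D"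
  shows "measure (Gspec \<alpha> V \<Lambda> \<xi>) (cyl D \<tau>) =
    cweight \<alpha> V \<tau> * measure (Gspec \<alpha> V \<Lambda> \<xi>) (cyl D id)"
  using finite_boltz_SL_sum_toggle[where V=V, OF assms(1,2,3,5,6,7)] assms
  by (simp add: measure_Gspec cyl_in_SM)

lemma measure_Gspec_id_outside:
  assumes "finite \<Lambda>" "finite D" "csupp \<tau> \<subseteq> D" "\<not> csupp \<tau> \<subseteq> \<Lambda>"
  shows "measure (Gspec \<alpha> V \<Lambda> (id :: ('d::finite) perm)) (cyl D \<tau>) = 0"
proof -
  obtain x where x: "x \<in> csupp \<tau>" "x \<notin> \<Lambda>" using assms(4) by blast
  have "SL \<Lambda> id \<inter> cyl D \<tau> = {}"
  proof (rule equals0I)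
    fix \<sigma> assume s: "\<sigma> \<in> SL \<Lambda> id \<inter> cyl D \<tau>"
    then have "\<sigma> x = x" using x by (auto simp: SL_def)
    moreover have "\<sigma> x = \<tau> x" using s x assms(3) by (auto simp: cyl_def)
    ultimately show False using x(1) by (simp add: csupp_def)
  qed
  then show ?thesis by (simp add: measure_Gspec assms cyl_in_SM)
qed

lemma Zpart_id_pos:
  assumes "V (\<lambda>_. 0) = 0" "finite \<Lambda>"
  shows "0 < Zpart \<alpha> V \<Lambda> id"
proof -
  have "boltz \<alpha> (Ham V \<Lambda> id) = 1" using assms by (simp add: Ham_def)
  moreover have "boltz \<alpha> (Ham V \<Lambda> id) \<le> Zpart \<alpha> V \<Lambda> id"
    unfolding Zpart_def using finite_SL_id[OF assms(2)]
    by (intro member_le_sum boltz_nonneg) (auto simp: SL_def)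
  ultimately show ?thesis by simp
qed

lemma prob_space_Gspec_id:
  assumes "V (\<lambda>_. 0) = 0" "finite \<Lambda>"
  shows "prob_space (Gspec \<alpha> V \<Lambda> (id :: ('d::finite) perm))"
proof (rule prob_spaceI)
  have sp: "space (Gspec \<alpha> V \<Lambda> (id :: 'd perm)) = Sperm"
    using sets_eq_imp_space_eq[OF sets_Gspec[OF assms(2) id_Sperm(1)]] by simp
  have S: "Sperm \<in> sets (SM :: 'd perm measure)" using sets.top[of "SM :: 'd perm measure"] by simp
  have "(\<Sum>\<sigma>\<in>SL \<Lambda> id \<inter> Sperm. boltz \<alpha> (Ham V \<Lambda> \<sigma>) / Zpart \<alpha> V \<Lambda> id) = 1"
    using Zpart_id_pos[where V=V, OF assms, of \<alpha>] SL_subset[of \<Lambda> id]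
    by (simp add: Int_absorb2 Zpart_def flip: sum_divide_distrib)
  then show "emeasure (Gspec \<alpha> V \<Lambda> id) (space (Gspec \<alpha> V \<Lambda> (id :: 'd perm))) = 1"
    unfolding sp by (simp add: emeasure_Gspec[OF assms(2) id_Sperm(1) S])
qed

lemma SL_id_in_SM: "SL \<Lambda> id \<in> sets (SM :: ('d::finite) perm measure)"
proof -
  have "{\<sigma> \<in> space SM. \<forall>x. x \<notin> \<Lambda> \<longrightarrow> \<sigma> x = x} \<in> sets (SM :: 'd perm measure)"
    by (intro sets.sets_Collect_countable_All sets.sets_Collect_imp sets.sets_Collect_const) (auto simp: sets_SM_value)
  then show ?thesis by (simp add: SL_def)
qed

lemma AE_Gspec_id:
  assumes "finite \<Lambda>" "\<And>\<sigma>. \<sigma> \<in> SL \<Lambda> id \<Longrightarrow> P \<sigma>"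
  shows "AE \<sigma> in Gspec \<alpha> V \<Lambda> (id :: ('d::finite) perm). P \<sigma>"
proof (rule AE_I[of _ _ "Sperm - SL \<Lambda> id"])
  have sp: "space (Gspec \<alpha> V \<Lambda> (id :: 'd perm)) = Sperm"
    using sets_eq_imp_space_eq[OF sets_Gspec[OF assms(1) id_Sperm(1)]] by simp
  show "{\<sigma> \<in> space (Gspec \<alpha> V \<Lambda> id). \<not> P \<sigma>} \<subseteq> Sperm - SL \<Lambda> id" unfolding sp using assms(2) by auto
  have m: "Sperm - SL \<Lambda> id \<in> sets (SM :: 'd perm measure)"
    using sets.Diff[OF sets.top[of "SM :: 'd perm measure"] SL_id_in_SM[of \<Lambda>]] by simp
  then show "Sperm - SL \<Lambda> id \<in> sets (Gspec \<alpha> V \<Lambda> id)" by (simp add: assms)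
  show "emeasure (Gspec \<alpha> V \<Lambda> id) (Sperm - SL \<Lambda> id) = 0"
    by (simp add: emeasure_Gspec[OF assms(1) id_Sperm(1) m])
qed

section \<open>Void probabilities\<close>

text \<open>The answer depends on \<open>\<sigma>\<close>, \<open>x\<close> and \<open>A\<close>
  only, so two choices compatible with the same permutation coincide.\<close>

lemma choice_unique:
  assumes "c \<in> choice x A" "\<And>y. y \<in> csupp c \<Longrightarrow> \<sigma> y = c y" "c = id \<Longrightarrow> x \<notin> A \<Longrightarrow> \<sigma> x = x"
  shows "c = (if x \<in> A then id else cyc \<sigma> x)"
proof (cases "c = id")
  case True
  then show ?thesis using assms(3) by (auto simp: cyc_fixed)
next
  case False
  then have c: "is_finite_cycle c" "x \<in> csupp c" "csupp c \<inter> A = {}"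
    using assms(1) by (auto simp: choice_def through_def)
  then have "cyc \<sigma> x = c" using assms(2) by (intro cyc_unique) auto
  then show ?thesis using c by auto
qed

lemma cyl_choice_unique:
  assumes "c \<in> choice x A" "\<sigma> \<in> cyl (insert x A \<union> csupp c) c"
  shows "c = (if x \<in> A then id else cyc \<sigma> x)"
  using assms(2) by (intro choice_unique[OF assms(1)]) (auto simp: cyl_def)

lemma cyl_choice_exists:
  assumes "\<sigma> \<in> cyl A id" "finite_cycle_perm \<sigma>"
  shows "\<exists>c\<in>choice x A. \<sigma> \<in> cyl (insert x A \<union> csupp c) c"
proof (cases "\<sigma> x = x")
  case True
  then show ?thesis using assms by (intro bexI[of _ id]) (auto simp: choice_def cyl_def)
next
  case False
  have b: "bij \<sigma>" using assms(1) by (auto simp: cyl_def Sperm_def)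
  note cy = is_finite_cycle_cyc[OF b finite_orb_of_finite_cycle_perm[OF assms(2)] False]
  have disj: "y \<notin> orb \<sigma> x" if y: "y \<in> A" for y
  proof
    \<comment> \<open>A fixed point on the orbit of \<open>x\<close> would, after cancelling
      iterates, make \<open>x\<close> itself a fixed point.\<close>
    assume "y \<in> orb \<sigma> x"
    then obtain n where n: "y = (\<sigma> ^^ n) x" by (auto simp: orb_def)
    have "\<sigma> y = y" using assms(1) y by (auto simp: cyl_def)
    then have "(\<sigma> ^^ n) (\<sigma> x) = (\<sigma> ^^ n) x" unfolding n by (simp add: funpow_swap1)
    then show False using False funpow_bij[OF b, of n] by (auto dest: bij_is_inj injD)
  qed
  have "\<sigma> y = cyc \<sigma> x y" if "y \<in> insert x A \<union> orb \<sigma> x" for y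
    using that disj assms(1) orb_self[of x \<sigma>] by (auto simp: cyc_def cyl_def)
  then have "\<sigma> \<in> cyl (insert x A \<union> csupp (cyc \<sigma> x)) (cyc \<sigma> x)"
    unfolding cy(2) using assms(1) by (auto simp: cyl_def)
  moreover have "cyc \<sigma> x \<in> choice x A"
    using cy disj orb_self[of x \<sigma>] by (auto simp: choice_def through_def)
  ultimately show ?thesis by blast
qed

lemma choice_finite_csupp: "c \<in> choice x A \<Longrightarrow> finite (csupp c)"
  by (auto simp: choice_def throughD)

text \<open>Almost sure finiteness of cycles enters here: a permutation with an infinite cycle
  through \<open>x\<close> is compatible with no choice, and its mass would be missing from the
  sum.\<close>

lemma has_sum_measure_explore:
  fixes \<nu> :: "('d::finite) perm measure"
  assumes "prob_space \<nu>" "sets \<nu> = sets SM" "AE \<sigma> in \<nu>. finite_cycle_perm \<sigma>" "finite A"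
  shows "((\<lambda>c. measure \<nu> (cyl (insert x A \<union> csupp c) c)) has_sum measure \<nu> (cyl A id)) (choice x A)"
proof -
  interpret prob_space \<nu> by fact
  let ?E = "\<lambda>c. cyl (insert x A \<union> csupp c) c"
  have E: "?E c \<in> sets \<nu>" if "c \<in> choice x A" for c
    unfolding assms(2) using assms(4) choice_finite_csupp[OF that] by (intro cyl_in_SM) auto
  have "disjoint_family_on ?E (choice x A)"
    unfolding disjoint_family_on_def
  proof (intro ballI impI equals0I)
    fix c c' \<sigma> assume "c \<in> choice x A" "c' \<in> choice x A" "c \<noteq> c'" "\<sigma> \<in> ?E c \<inter> ?E c'"
    then show False using cyl_choice_unique[of c x A \<sigma>] cyl_choice_unique[of c' x A \<sigma>] by auto
  qed
  then have hs: "((\<lambda>c. measure \<nu> (?E c)) has_sum measure \<nu> (\<Union>c\<in>choice x A. ?E c)) (choice x A)"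
    by (intro has_sum_measure_UN countable_choice E)
  have "measure \<nu> (\<Union>c\<in>choice x A. ?E c) = measure \<nu> (cyl A id)"
  proof (rule finite_measure_eq_AE)
    have sub: "?E c \<subseteq> cyl A id" if "c \<in> choice x A" for c
    proof
      fix \<sigma> assume s: "\<sigma> \<in> ?E c"
      have "\<sigma> y = y" if y: "y \<in> A" for y
      proof -
        have "c y = y" using \<open>c \<in> choice x A\<close> y by (auto simp: choice_def csupp_def)
        then show ?thesis using s y by (auto simp: cyl_def)
      qed
      then show "\<sigma> \<in> cyl A id" using s by (auto simp: cyl_def)
    qed
    show "AE \<sigma> in \<nu>. (\<sigma> \<in> (\<Union>c\<in>choice x A. ?E c)) = (\<sigma> \<in> cyl A id)"
      using assms(3)
    proof eventually_elim
      case (elim \<sigma>)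
      show ?case using sub cyl_choice_exists[OF _ elim, of A x] by auto
    qed
    show "(\<Union>c\<in>choice x A. ?E c) \<in> sets \<nu>"
      by (rule sets.countable_UN''[OF countable_choice E])
    show "cyl A id \<in> sets \<nu>" unfolding assms(2) by (rule cyl_in_SM[OF assms(4)])
  qed
  then show ?thesis using hs by simp
qed

context cycle_gas
begin

text \<open>Shared by the finite-volume measures and by Gibbs measures with finite cycles. For
  \<open>\<Lambda> = UNIV\<close> the assumption \<open>out\<close> is vacuous.\<close>

lemma void_system_of_measure:
  fixes \<nu> :: "'d perm measure"
  assumes \<nu>: "prob_space \<nu>" "sets \<nu> = sets SM" "AE \<sigma> in \<nu>. finite_cycle_perm \<sigma>"
    and tog: "\<And>D c. finite D \<Longrightarrow> bij c \<Longrightarrow> csupp c \<subseteq> D \<Longrightarrow> csupp c \<subseteq> \<Lambda> \<Longrightarrow>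
        measure \<nu> (cyl D c) = w c * measure \<nu> (cyl D id)"
    and out: "\<And>D c. finite D \<Longrightarrow> csupp c \<subseteq> D \<Longrightarrow> \<not> csupp c \<subseteq> \<Lambda> \<Longrightarrow> measure \<nu> (cyl D c) = 0"
  shows "void_system \<Lambda> (\<lambda>A. measure \<nu> (cyl A id))"
  unfolding void_system_def
proof (intro conjI allI impI)
  interpret prob_space \<nu> by fact
  have "cyl {} id = space \<nu>" using sets_eq_imp_space_eq[OF \<nu>(2)] by (auto simp: cyl_def)
  then show "measure \<nu> (cyl {} id) = 1" by (simp add: prob_space)
  show "measure \<nu> (cyl B id) \<le> measure \<nu> (cyl A id)" if "finite B" "A \<subseteq> B" for A B
  proof (rule finite_measure_mono)
    show "cyl A id \<in> sets \<nu>" unfolding \<nu>(2) using that finite_subset by (intro cyl_in_SM) auto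
  qed (use that in \<open>auto simp: cyl_def\<close>)
  fix A :: "'d site set" and x assume A: "finite A"
  have "((\<lambda>c. measure \<nu> (cyl (insert x A \<union> csupp c) c)) has_sum measure \<nu> (cyl A id)) (choice x A)"
    by (rule has_sum_measure_explore[OF \<nu> A])
  also have "?this \<longleftrightarrow> ((\<lambda>c. w c * measure \<nu> (cyl (insert x A \<union> csupp c) id)) has_sum measure \<nu> (cyl A id))
      {c \<in> choice x A. csupp c \<subseteq> \<Lambda>}"
  proof (rule has_sum_cong_neutral)
    fix c assume c: "c \<in> choice x A \<inter> {c \<in> choice x A. csupp c \<subseteq> \<Lambda>}"
    have "bij c" using c finite_cycle_permutes permutes_bij by (auto simp: choice_def through_def) 
    then show "measure \<nu> (cyl (insert x A \<union> csupp c) c) = w c * measure \<nu> (cyl (insert x A \<union> csupp c) id)"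
      using c A choice_finite_csupp by (intro tog) auto
  next
    fix c assume c: "c \<in> choice x A - {c \<in> choice x A. csupp c \<subseteq> \<Lambda>}"
    then show "measure \<nu> (cyl (insert x A \<union> csupp c) c) = 0"
      using A choice_finite_csupp by (intro out) auto
  qed auto
  finally show "((\<lambda>c. w c * measure \<nu> (cyl (insert x A \<union> csupp c) id)) has_sum measure \<nu> (cyl A id))
      {c \<in> choice x A. csupp c \<subseteq> \<Lambda>}" .
qed auto

section \<open>Void probabilities in finite volume and their limit\<close>

definition void :: "'d site set \<Rightarrow> 'd site set \<Rightarrow> real" where
  "void \<Lambda> A = measure (Gspec \<alpha> V \<Lambda> id) (cyl A id)"

lemma void_system_void: "finite \<Lambda> \<Longrightarrow> void_system \<Lambda> (void \<Lambda>)"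
  unfolding void_def
proof (rule void_system_of_measure)
  assume fin: "finite \<Lambda>"
  show "prob_space (Gspec \<alpha> V \<Lambda> id)" by (rule prob_space_Gspec_id[where V=V, OF V0 fin])
  show "AE \<sigma> in Gspec \<alpha> V \<Lambda> id. finite_cycle_perm \<sigma>"
    using fin by (intro AE_Gspec_id) (auto simp: SL_id intro: finite_cycle_perm_permutes)
qed (auto intro: measure_Gspec_toggle[where V=V, OF V0] measure_Gspec_id_outside)

lemma void_in_unit: "finite \<Lambda> \<Longrightarrow> finite A \<Longrightarrow> 0 < void \<Lambda> A \<and> void \<Lambda> A \<le> 1"
  using void_pos[OF void_system_void] void_mono[OF void_system_void, of \<Lambda> A "{}"]
    void_empty[OF void_system_void] by fastforce

lemma void_Cauchy:
  assumes "finite A" "0 < e"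
  shows "\<exists>C. finite C \<and> (\<forall>L L'. finite L \<and> C \<subseteq> L \<and> finite L' \<and> C \<subseteq> L' \<longrightarrow> \<bar>void L A - void L' A\<bar> < e)"
proof -
  have "\<forall>\<^sub>F C in finite_subsets_at_top UNIV. y \<in> C" for y :: "'d site"
    unfolding eventually_finite_subsets_at_top by (intro exI[of _ "{y}"]) auto
  \<comment> \<open>The net of finite sets itself provides the windows. Any two volumes that contain
    \<open>C\<close> agree inside \<open>C\<close>, whatever they look like beyond it.\<close>
  from infl_sum_small[OF assms(1) this assms(2)] obtain n C where
    C: "finite C" "(\<Sum>y\<in>A. infl n C y) < e"
    unfolding eventually_finite_subsets_at_top by blast
  have "\<bar>void L A - void L' A\<bar> < e" if L: "finite L" "C \<subseteq> L" "finite L'" "C \<subseteq> L'" for L L'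
  proof -
    note r = void_system_void[OF L(1)] and r' = void_system_void[OF L(3)]
    have "\<bar>void L A - void L' A\<bar> \<le> \<bar>ln (void L A) - ln (void L' A)\<bar>"
      using void_in_unit L assms(1) by (intro abs_diff_le_ln_diff) auto
    also have "\<dots> = \<bar>(ln (void L {}) - ln (void L ({} \<union> A))) - (ln (void L' {}) - ln (void L' ({} \<union> A)))\<bar>"
      by (simp add: void_empty[OF r] void_empty[OF r'])
    also have "\<dots> \<le> (\<Sum>y\<in>A. infl n C y)"
      by (rule void_compare_set[OF r r']) (use assms L in auto)
    finally show ?thesis using C(2) by simp
  qed
  then show ?thesis using C(1) by blast
qed

definition void_lim :: "'d site set \<Rightarrow> real" where
  "void_lim A = Lim (finite_subsets_at_top UNIV) (\<lambda>\<Lambda>. void \<Lambda> A)"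

lemma void_tendsto:
  assumes "finite A"
  shows "((\<lambda>\<Lambda>. void \<Lambda> A) \<longlongrightarrow> void_lim A) (finite_subsets_at_top UNIV)"
proof -
  let ?F = "finite_subsets_at_top (UNIV :: 'd site set)"
  have "cauchy_filter (filtermap (\<lambda>\<Lambda>. void \<Lambda> A) ?F)"
    unfolding cauchy_filter_metric_filtermap
  proof (intro allI impI)
    fix e :: real assume "0 < e"
    from void_Cauchy[OF assms this] obtain C where C: "finite C"
      "\<forall>L L'. finite L \<and> C \<subseteq> L \<and> finite L' \<and> C \<subseteq> L' \<longrightarrow> \<bar>void L A - void L' A\<bar> < e" by (elim exE conjE)
    show "\<exists>P. eventually P ?F \<and> (\<forall>x y. P x \<and> P y \<longrightarrow> dist (void x A) (void y A) < e)"
    proof (intro exI conjI)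
      show "\<forall>\<^sub>F L in ?F. finite L \<and> C \<subseteq> L"
        unfolding eventually_finite_subsets_at_top using C(1) by auto
    qed (use C(2) in \<open>auto simp: dist_real_def\<close>)
  qed
  moreover have "uniform_space_class.complete (UNIV::real set)"
    by (meson Cauchy_convergent UNIV_I complete_def convergent_def)
  ultimately obtain l where "((\<lambda>\<Lambda>. void \<Lambda> A) \<longlongrightarrow> l) ?F"
    using complete_uniform[where S="UNIV :: real set"] by (force simp add: filterlim_def filtermap_bot_iff)
  then show ?thesis unfolding void_lim_def
    using tendsto_Lim[OF finite_subsets_at_top_neq_bot] by metis
qed

lemma finite_subsets_at_top_finite: "\<forall>\<^sub>F L in finite_subsets_at_top UNIV. finite L"
  by (rule eventually_finite_subsets_at_top_weakI) auto

lemma void_system_lim: "void_system UNIV void_lim"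
  unfolding void_system_def
proof (intro conjI allI impI)
  let ?F = "finite_subsets_at_top (UNIV :: 'd site set)"
  note nb = finite_subsets_at_top_neq_bot[of "UNIV :: 'd site set"]
  have "((\<lambda>\<Lambda>. void \<Lambda> {}) \<longlongrightarrow> 1) ?F"
    by (rule tendsto_eventually, rule eventually_mono[OF finite_subsets_at_top_finite])
       (simp add: void_empty[OF void_system_void])
  then show "void_lim {} = 1" using void_tendsto[of "{}"] tendsto_unique[OF nb] by blast
  show "0 \<le> void_lim B" if "finite B" "A \<subseteq> B" for A B
    using void_in_unit that(1)
    by (intro tendsto_lowerbound[OF void_tendsto[OF that(1)] _ nb] eventually_mono[OF finite_subsets_at_top_finite])
       (auto intro: less_imp_le)
  show "void_lim B \<le> void_lim A" if "finite B" "A \<subseteq> B" for A B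
    by (rule tendsto_le[OF nb void_tendsto void_tendsto])
       (use that finite_subset in \<open>auto intro!: eventually_mono[OF finite_subsets_at_top_finite] void_mono[OF void_system_void]\<close>)
  fix A :: "'d site set" and x assume A: "finite A"
  \<comment> \<open>Writing the constraint on the support as an indicator gives all volumes one
    index set; the weights then dominate uniformly.\<close>
  let ?a = "\<lambda>c \<Lambda>. if csupp c \<subseteq> \<Lambda> then w c * void \<Lambda> (insert x A \<union> csupp c) else 0"
  let ?b = "\<lambda>c. w c * void_lim (insert x A \<union> csupp c)"
  have wsum: "w summable_on choice x A"
  proof (rule summable_on_subset)
    have "(\<lambda>\<gamma>. w \<gamma> * 1) summable_on through x"
      by (rule dominated_summable) (use card_csupp_ge_1 in fastforce)
    then show "w summable_on insert id (through x)" by (simp add: summable_on_insert_iff)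
  qed (auto simp: choice_def)
  have fin: "finite (insert x A \<union> csupp c)" if "c \<in> choice x A" for c
    using A choice_finite_csupp[OF that] by auto
  have lim: "((\<lambda>\<Lambda>. \<Sum>\<^sub>\<infinity>c\<in>choice x A. ?a c \<Lambda>) \<longlongrightarrow> (\<Sum>\<^sub>\<infinity>c\<in>choice x A. ?b c)) ?F"
  proof (rule tendsto_infsum_dominated[OF wsum])
    show "\<forall>\<^sub>F \<Lambda> in ?F. \<forall>c\<in>choice x A. \<bar>?a c \<Lambda>\<bar> \<le> w c"
    proof (rule eventually_mono[OF finite_subsets_at_top_finite], intro ballI)
      fix L :: "'d site set" and c assume L: "finite L" and c: "c \<in> choice x A"
      show "\<bar>?a c L\<bar> \<le> w c"
        using void_in_unit[OF L fin[OF c]] w_nonneg[of c] by (auto simp: abs_mult mult_left_le)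
    qed
    fix c assume c: "c \<in> choice x A"
    have "((\<lambda>\<Lambda>. w c * void \<Lambda> (insert x A \<union> csupp c)) \<longlongrightarrow> ?b c) ?F"
      by (intro tendsto_intros void_tendsto fin c)
    moreover have "\<forall>\<^sub>F \<Lambda> in ?F. w c * void \<Lambda> (insert x A \<union> csupp c) = ?a c \<Lambda>"
      unfolding eventually_finite_subsets_at_top
      using choice_finite_csupp[OF c] by (intro exI[of _ "csupp c"]) auto
    ultimately show "(?a c \<longlongrightarrow> ?b c) ?F" by (rule Lim_transform_eventually)
  qed
  have "\<forall>\<^sub>F \<Lambda> in ?F. (\<Sum>\<^sub>\<infinity>c\<in>choice x A. ?a c \<Lambda>) = void \<Lambda> A"
  proof (rule eventually_mono[OF finite_subsets_at_top_finite])
    fix L :: "'d site set" assume L: "finite L"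
    have "((\<lambda>c. w c * void L (insert x A \<union> csupp c)) has_sum void L A) {c \<in> choice x A. csupp c \<subseteq> L}"
      using void_system_void[OF L] A unfolding void_system_def by blast
    then have "void L A = (\<Sum>\<^sub>\<infinity>c\<in>{c \<in> choice x A. csupp c \<subseteq> L}. w c * void L (insert x A \<union> csupp c))"
      by (simp add: infsumI)
    also have "\<dots> = (\<Sum>\<^sub>\<infinity>c\<in>choice x A. ?a c L)"
      by (rule infsum_cong_neutral) auto
    finally show "(\<Sum>\<^sub>\<infinity>c\<in>choice x A. ?a c L) = void L A" ..
  qed
  then have "((\<lambda>\<Lambda>. void \<Lambda> A) \<longlongrightarrow> (\<Sum>\<^sub>\<infinity>c\<in>choice x A. ?b c)) ?F"
    using lim by (rule Lim_transform_eventually[rotated])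
  then have eq: "void_lim A = (\<Sum>\<^sub>\<infinity>c\<in>choice x A. ?b c)"
    using void_tendsto[OF A] tendsto_unique[OF nb] by blast
  have "?b summable_on choice x A"
  proof (rule summable_on_comparison_test[OF wsum])
    fix c assume c: "c \<in> choice x A"
    have ev: "\<forall>\<^sub>F L in ?F. 0 \<le> void L (insert x A \<union> csupp c)" "\<forall>\<^sub>F L in ?F. void L (insert x A \<union> csupp c) \<le> 1"
      by (rule eventually_mono[OF finite_subsets_at_top_finite], use void_in_unit[OF _ fin[OF c]] less_imp_le in blast)+
    have b: "0 \<le> void_lim (insert x A \<union> csupp c)" "void_lim (insert x A \<union> csupp c) \<le> 1"
      by (rule tendsto_lowerbound[OF void_tendsto[OF fin[OF c]] ev(1) nb])
         (rule tendsto_upperbound[OF void_tendsto[OF fin[OF c]] ev(2) nb])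
    then show "?b c \<le> w c" using w_nonneg[of c] by (simp add: mult_left_le)
    show "0 \<le> ?b c" using b w_nonneg[of c] by simp
  qed
  then show "(?b has_sum void_lim A) {c \<in> choice x A. csupp c \<subseteq> UNIV}"
    unfolding eq by (simp add: has_sum_infsum)
qed

end

section \<open>The coupling\<close>

text \<open>A permutation is sampled by exploring the sites in the order \<open>from_nat 0, from_nat 1, \<dots>\<close>; at each
  unexplored site the cycle through it (or the identity, if it is a fixed point) is chosen. A list records
  the codes of the choices, latest first.\<close>

declare tree_path.simps(2) [simp del]

definition choices :: "('d::finite) perm set" where
  "choices = {c. c = id \<or> is_finite_cycle c}"

definition code :: "nat \<Rightarrow> ('d::finite) perm" where
  "code = from_nat_into choices"

text \<open>Keeping only canonical numbers makes \<open>code\<close> a bijection onto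
  \<open>choices\<close>, so that no choice gets its mass twice among the children of a
  node.\<close>

definition codes :: "('d::finite) itself \<Rightarrow> nat set" where
  "codes _ = {k. (code k :: 'd perm) \<in> choices \<and> to_nat_on choices (code k :: 'd perm) = k}"

lemma countable_choices: "countable (choices :: ('d::finite) perm set)"
proof -
  have "(choices :: 'd perm set) = insert id {c. is_finite_cycle c}" by (auto simp: choices_def)
  then show ?thesis using countable_finite_cycles countable_insert by metis
qed

lemma bij_betw_code: "bij_betw code (codes TYPE('d::finite)) (choices :: 'd perm set)"
proof (rule bij_betw_byWitness[where f'="to_nat_on choices"])
  show "\<forall>k\<in>codes TYPE('d). to_nat_on (choices :: 'd perm set) (code k) = k" by (auto simp: codes_def)
  have c: "code (to_nat_on choices c) = c" if "c \<in> choices" for c :: "'d perm"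
    unfolding code_def by (rule from_nat_into_to_nat_on[OF countable_choices that])
  then show "\<forall>c\<in>choices. code (to_nat_on choices c) = (c :: 'd perm)" by auto
  show "to_nat_on choices ` (choices :: 'd perm set) \<subseteq> codes TYPE('d)" using c by (auto simp: codes_def)
qed (auto simp: codes_def)

fun expl :: "nat list \<Rightarrow> ('d::finite) site set" where
  "expl [] = {}"
| "expl (k # s) = insert (from_nat (length s)) (expl s \<union> csupp (code k))"

fun pm :: "nat list \<Rightarrow> ('d::finite) perm" where
  "pm [] = id"
| "pm (k # s) = code k \<circ> pm s"

text \<open>Exploration also visits sites outside a finite volume and finds fixed points there.
  Hence the volume constrains \<open>msupp\<close>, the union of the chosen supports, and not
  \<open>expl\<close>.\<close>

fun msupp :: "nat list \<Rightarrow> ('d::finite) site set" where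
  "msupp [] = {}"
| "msupp (k # s) = csupp (code k) \<union> msupp s"

fun ok :: "('d::finite) itself \<Rightarrow> nat list \<Rightarrow> bool" where
  "ok d [] = True"
| "ok d (k # s) = (ok d s \<and> k \<in> codes d \<and> (code k :: 'd perm) \<in> choice (from_nat (length s)) (expl s))"

lemma choice_permutes: "c \<in> choice x A \<Longrightarrow> c permutes (csupp c)"
  by (auto simp: choice_def through_def finite_cycle_permutes permutes_id)

lemma finite_expl: "ok TYPE('d) s \<Longrightarrow> finite (expl s :: ('d::finite) site set)"
  by (induction s) (auto simp: choice_finite_csupp)

lemma msupp_subset_expl: "(msupp s :: ('d::finite) site set) \<subseteq> expl s"
  by (induction s) auto

lemma from_nat_in_expl: "i < length s \<Longrightarrow> from_nat i \<in> (expl s :: ('d::finite) site set)"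
  by (induction s) (auto simp: less_Suc_eq)

lemma pm_permutes: "ok TYPE('d) s \<Longrightarrow> pm s permutes (msupp s :: ('d::finite) site set)"
proof (induction s)
  case (Cons k s)
  have "code k permutes (csupp (code k) :: 'd site set)" using Cons.prems by (auto intro: choice_permutes)
  then have "code k permutes (msupp (k # s) :: 'd site set)" by (rule permutes_subset) auto
  moreover have "pm s permutes (msupp (k # s) :: 'd site set)"
    by (rule permutes_subset[of _ "msupp s"]) (use Cons in auto)
  ultimately show ?case unfolding pm.simps by (rule permutes_compose[rotated])
qed (simp add: permutes_id)

lemma pm_permutes_expl: "ok TYPE('d) s \<Longrightarrow> pm s permutes (expl s :: ('d::finite) site set)"
  using permutes_subset[OF pm_permutes msupp_subset_expl] .

text \<open>A new cycle avoids the explored sites, and the current permutation maps them among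
  themselves. So a value once decided is never revised.\<close>

lemma pm_Cons_expl:
  assumes "ok TYPE('d::finite) (k # s)" "x \<in> (expl s :: 'd site set)"
  shows "pm (k # s) x = pm s x"
proof -
  have "pm s x \<in> expl s" using permutes_in_image[OF pm_permutes_expl] assms by auto
  then have "pm s x \<notin> csupp (code k)" using assms(1) by (auto simp: choice_def)
  then show ?thesis by (simp add: csupp_def)
qed

lemma pm_Cons_csupp:
  assumes "ok TYPE('d::finite) (k # s)" "x \<notin> (expl s :: 'd site set)"
  shows "pm (k # s) x = code k x"
proof -
  have "x \<notin> msupp s" using msupp_subset_expl[of s] assms(2) by auto
  then have "pm s x = x" using pm_permutes[of s, where 'd='d] assms(1) permutes_not_in by fastforce
  then show ?thesis by simp
qed

text \<open>At each stage the choice can be read off from \<open>\<tau>\<close> and the sites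
  explored so far, so the permutation determines its exploration history.\<close>

lemma ok_list_unique:
  fixes \<tau> :: "('d::finite) perm"
  assumes "ok TYPE('d) s" "ok TYPE('d) s'" "length s = length s'"
    "\<And>x. x \<in> expl s \<Longrightarrow> pm s x = \<tau> x" "\<And>x. x \<in> expl s' \<Longrightarrow> pm s' x = \<tau> x"
  shows "s = s'"
  using assms
proof (induction s arbitrary: s')
  case (Cons k t)
  then obtain k' t' where s': "s' = k' # t'" by (cases s') auto
  have tt: "t = t'"
  proof (rule Cons.IH)
    show "pm t x = \<tau> x" if "x \<in> expl t" for x
      using pm_Cons_expl[OF Cons.prems(1) that] Cons.prems(4)[of x] that by simp
    show "pm t' x = \<tau> x" if "x \<in> expl t'" for x
      using pm_Cons_expl[OF Cons.prems(2)[unfolded s'] that] Cons.prems(5)[of x] that by (simp add: s')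
  qed (use Cons.prems s' in auto)
  have *: "code k = (if from_nat (length t) \<in> (expl t :: 'd site set) then id else cyc \<tau> (from_nat (length t)))"
    if o: "ok TYPE('d) (k # t)" and e: "\<And>x. x \<in> expl (k # t) \<Longrightarrow> pm (k # t) x = \<tau> x" for k
  proof (rule choice_unique)
    show c: "code k \<in> choice (from_nat (length t)) (expl t :: 'd site set)" using o by simp
    show "\<tau> y = code k y" if "y \<in> csupp (code k)" for y
    proof -
      have "y \<notin> expl t" using c that by (auto simp: choice_def)
      then show ?thesis using pm_Cons_csupp[OF o] e[of y] that by auto
    qed
    show "\<tau> (from_nat (length t)) = from_nat (length t)"
      if "code k = (id :: 'd perm)" "from_nat (length t) \<notin> (expl t :: 'd site set)"
      using pm_Cons_csupp[OF o that(2)] e[of "from_nat (length t)"] that(1) by simp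
  qed
  have "(code k :: 'd perm) = code k'"
    using *[of k] *[of k'] Cons.prems unfolding s' tt by auto
  moreover have "k \<in> codes TYPE('d)" "k' \<in> codes TYPE('d)" using Cons.prems s' by auto
  ultimately have "k = k'" using bij_betw_code[where 'd='d] by (auto simp: bij_betw_def inj_on_def)
  then show ?case using tt s' by simp
qed simp

lemma cweight_comp_disjoint:
  assumes "finite (csupp c)" "finite (csupp \<tau>)" "csupp c \<inter> csupp \<tau> = {}" "bij \<tau>"
  shows "cweight \<alpha> V (c \<circ> \<tau>) = cweight \<alpha> V c * cweight \<alpha> V \<tau>"
proof -
  have \<tau>in: "\<tau> x \<in> csupp \<tau>" if "x \<in> csupp \<tau>" for x
    using that assms(4) unfolding csupp_def by (auto dest: bij_is_inj injD)
  have 1: "(c \<circ> \<tau>) x = \<tau> x" if "x \<in> csupp \<tau>" for x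
    using \<tau>in[OF that] assms(3) by (auto simp: csupp_def)
  have 2: "(c \<circ> \<tau>) x = c x" if "x \<notin> csupp \<tau>" for x
    using that by (auto simp: csupp_def)
  have "csupp (c \<circ> \<tau>) = csupp c \<union> csupp \<tau>"
  proof (rule set_eqI)
    fix x show "x \<in> csupp (c \<circ> \<tau>) \<longleftrightarrow> x \<in> csupp c \<union> csupp \<tau>"
    proof (cases "x \<in> csupp \<tau>")
      case True
      then show ?thesis using 1[OF True] by (auto simp: csupp_def)
    next
      case False
      then show ?thesis using 2[OF False] by (auto simp: csupp_def)
    qed
  qed
  moreover have "(\<Sum>x\<in>csupp c. V (jump ((c \<circ> \<tau>) x) x)) = (\<Sum>x\<in>csupp c. V (jump (c x) x))"
    using 2 assms(3) by (intro sum.cong refl) (metis disjoint_iff)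
  moreover have "(\<Sum>x\<in>csupp \<tau>. V (jump ((c \<circ> \<tau>) x) x)) = (\<Sum>x\<in>csupp \<tau>. V (jump (\<tau> x) x))"
    using 1 by (intro sum.cong refl) metis
  ultimately show ?thesis
    unfolding cweight_def by (simp add: sum.union_disjoint[OF assms(1-3)] boltz_add del: comp_apply)
qed

lemma csupp_permutes: "\<pi> permutes A \<Longrightarrow> csupp \<pi> \<subseteq> A"
  by (auto simp: csupp_def dest: permutes_not_in)

lemma AE_unit_measure_not_countable:
  assumes "countable S" shows "AE u in unit_measure. u \<notin> S"
proof -
  have "AE u in lborel. u \<notin> S" by (rule AE_not_in[OF countable_imp_null_set_lborel[OF assms]])
  then show ?thesis unfolding unit_measure_def by (subst AE_restrict_space_iff) auto
qed

context cycle_gas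
begin

fun list_weight :: "nat list \<Rightarrow> real" where
  "list_weight [] = 1"
| "list_weight (k # s) = w (code k) * list_weight s"

lemma list_weight_nonneg: "0 \<le> list_weight s"
  by (induction s) (auto simp: w_nonneg)

lemma list_weight_eq: "ok TYPE('d) s \<Longrightarrow> list_weight s = w (pm s)"
proof (induction s)
  case (Cons k s)
  have o: "ok TYPE('d) s" "code k \<in> choice (from_nat (length s)) (expl s :: 'd site set)" using Cons.prems by auto
  have sub: "csupp (pm s) \<subseteq> (expl s :: 'd site set)" by (rule csupp_permutes[OF pm_permutes_expl[OF o(1)]])
  have "w (code k \<circ> pm s) = w (code k) * w (pm s)"
    by (rule cweight_comp_disjoint)
       (use o sub choice_finite_csupp[OF o(2)] finite_subset[OF sub finite_expl[OF o(1)]]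
         permutes_bij[OF pm_permutes[OF o(1)]] in \<open>auto simp: choice_def\<close>)
  then show ?case unfolding pm.simps list_weight.simps Cons.IH[OF o(1)] by (rule sym)
qed simp

definition void_any :: "'d site set \<Rightarrow> 'd site set \<Rightarrow> real" where
  "void_any \<Lambda> = (if \<Lambda> = UNIV then void_lim else void \<Lambda>)"

text \<open>The probability that the permutation equals \<open>pm s\<close> on
  \<open>expl s\<close>: the toggle relation turns it into the weight of the chosen cycles times a
  void probability. Inadmissible lists get mass 0 and are never visited.\<close>

definition node_mass :: "'d site set \<Rightarrow> nat list \<Rightarrow> real" where
  "node_mass \<Lambda> s = (if ok TYPE('d) s \<and> msupp s \<subseteq> \<Lambda> then list_weight s * void_any \<Lambda> (expl s) else 0)"

lemma infinite_UNIV_site: "infinite (UNIV :: 'd site set)"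
proof
  assume f: "finite (UNIV :: 'd site set)"
  have "inj (\<lambda>(n::nat) (i::'d). int n)" by (auto simp: inj_def fun_eq_iff)
  then show False using finite_imageD[of "\<lambda>(n::nat) (i::'d). int n" UNIV] finite_subset[OF subset_UNIV f] by auto
qed

lemma void_system_any: "finite \<Lambda> \<or> \<Lambda> = UNIV \<Longrightarrow> void_system \<Lambda> (void_any \<Lambda>)"
  using void_system_void void_system_lim by (auto simp: void_any_def)

text \<open>That the children share the mass of a node is the defining recursion of
  \<open>void_system\<close> at the next site, reindexed by codes.\<close>

lemma tree_mass_node_mass:
  assumes L: "finite \<Lambda> \<or> \<Lambda> = UNIV"
  shows "tree_mass (node_mass \<Lambda>)"
  unfolding tree_mass_def
proof (intro conjI allI)
  note r = void_system_any[OF L]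
  show "node_mass \<Lambda> [] = 1" by (simp add: node_mass_def void_empty[OF r])
  show nn: "0 \<le> node_mass \<Lambda> s" for s
    using list_weight_nonneg void_nonneg[OF r finite_expl] by (auto simp: node_mass_def)
  fix s :: "nat list"
  show "(\<lambda>k. node_mass \<Lambda> (k # s)) sums node_mass \<Lambda> s"
  proof (cases "ok TYPE('d) s \<and> msupp s \<subseteq> \<Lambda>")
    case True
    let ?x = "from_nat (length s) :: 'd site" and ?A = "expl s :: 'd site set"
    let ?T = "{c \<in> choice ?x ?A. csupp c \<subseteq> \<Lambda>}"
    let ?K = "{k \<in> codes TYPE('d). code k \<in> ?T}"
    let ?f = "\<lambda>c. w c * void_any \<Lambda> (insert ?x ?A \<union> csupp c)"
    have "(?f has_sum void_any \<Lambda> ?A) ?T"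
      using r finite_expl True unfolding void_system_def by blast
    moreover have "bij_betw code ?K ?T"
    proof -
      have "?T \<subseteq> choices" by (auto simp: choice_def choices_def through_def)
      then have "code ` ?K = ?T"
        using bij_betw_imp_surj_on[OF bij_betw_code[where 'd='d]] by (auto simp: image_iff)
      moreover have "inj_on (code :: nat \<Rightarrow> 'd perm) ?K"
        using bij_betw_imp_inj_on[OF bij_betw_code[where 'd='d]] by (rule inj_on_subset) auto
      ultimately show ?thesis by (simp add: bij_betw_def)
    qed
    ultimately have "((\<lambda>k. ?f (code k)) has_sum void_any \<Lambda> ?A) ?K"
      using has_sum_reindex_bij_betw[of code ?K ?T ?f] by blast
    then have "((\<lambda>k. list_weight s * ?f (code k)) has_sum (list_weight s * void_any \<Lambda> ?A)) ?K"
      by (rule has_sum_cmult_right)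
    also have "?this \<longleftrightarrow> ((\<lambda>k. node_mass \<Lambda> (k # s)) has_sum (list_weight s * void_any \<Lambda> ?A)) UNIV"
      using True by (intro has_sum_cong_neutral) (auto simp: node_mass_def)
    finally have "(\<lambda>k. node_mass \<Lambda> (k # s)) sums (list_weight s * void_any \<Lambda> ?A)" by (rule has_sum_imp_sums)
    then show ?thesis using True by (simp add: node_mass_def)
  next
    case False
    then have "node_mass \<Lambda> (k # s) = 0" for k by (auto simp: node_mass_def)
    moreover have "node_mass \<Lambda> s = 0" using False by (auto simp: node_mass_def)
    ultimately show ?thesis by simp
  qed
qed

lemma node_mass_tendsto: "((\<lambda>\<Lambda>. node_mass \<Lambda> s) \<longlongrightarrow> node_mass UNIV s) (finite_subsets_at_top UNIV)"
proof (cases "ok TYPE('d) s")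
  case True
  have fin: "finite (msupp s :: 'd site set)"
    using finite_subset[OF msupp_subset_expl finite_expl[OF True]] .
  have "((\<lambda>\<Lambda>. list_weight s * void \<Lambda> (expl s)) \<longlongrightarrow> list_weight s * void_lim (expl s)) (finite_subsets_at_top UNIV)"
    by (intro tendsto_intros void_tendsto finite_expl True)
  moreover have "\<forall>\<^sub>F \<Lambda> in finite_subsets_at_top UNIV. list_weight s * void \<Lambda> (expl s) = node_mass \<Lambda> s"
    unfolding eventually_finite_subsets_at_top
    using fin True infinite_UNIV_site by (intro exI[of _ "msupp s"]) (auto simp: node_mass_def void_any_def)
  ultimately have "((\<lambda>\<Lambda>. node_mass \<Lambda> s) \<longlongrightarrow> list_weight s * void_lim (expl s)) (finite_subsets_at_top UNIV)"
    by (rule Lim_transform_eventually)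
  then show ?thesis using True by (simp add: node_mass_def void_any_def)
qed (simp add: node_mass_def)

abbreviation path :: "'d site set \<Rightarrow> real \<Rightarrow> nat \<Rightarrow> nat list" where
  "path \<Lambda> \<equiv> tree_path (node_mass \<Lambda>)"

text \<open>After \<open>Suc (to_nat x)\<close> steps the site \<open>x\<close> has certainly been
  explored, and its image is final.\<close>

definition sample :: "'d site set \<Rightarrow> real \<Rightarrow> 'd perm" where
  "sample \<Lambda> u x = pm (path \<Lambda> u (Suc (to_nat x))) x"

context
  fixes \<Lambda> :: "'d site set" and u :: real
  assumes L: "finite \<Lambda> \<or> \<Lambda> = UNIV" and u: "u \<in> {0..<1}"
begin

text \<open>A half-open interval containing \<open>u\<close> has positive length, and only
  admissible lists have positive mass.\<close>

lemma path_ok: "ok TYPE('d) (path \<Lambda> u n)" "msupp (path \<Lambda> u n) \<subseteq> \<Lambda>"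
proof -
  have "0 < node_mass \<Lambda> (path \<Lambda> u n)"
    using tree_path_in[OF tree_mass_node_mass[OF L] u, of n] by auto
  then show "ok TYPE('d) (path \<Lambda> u n)" "msupp (path \<Lambda> u n) \<subseteq> \<Lambda>"
    by (auto simp: node_mass_def split: if_splits)
qed

lemma path_expl_stable:
  fixes x :: "'d site"
  assumes "n \<le> m" "x \<in> expl (path \<Lambda> u n)"
  shows "x \<in> expl (path \<Lambda> u m) \<and> pm (path \<Lambda> u m) x = pm (path \<Lambda> u n) x"
  using assms(1)
proof (induction m rule: dec_induct)
  case (step m)
  obtain k where k: "path \<Lambda> u (Suc m) = k # path \<Lambda> u m" by (simp add: tree_path.simps(2))
  have "pm (k # path \<Lambda> u m) x = pm (path \<Lambda> u m) x"
    by (rule pm_Cons_expl[OF path_ok(1)[of "Suc m", unfolded k]]) (use step in auto)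
  then show ?case using step unfolding k by auto
qed (use assms(2) in simp)

lemma site_in_expl: "(x :: 'd site) \<in> expl (path \<Lambda> u (Suc (to_nat x)))"
  using from_nat_in_expl[of "to_nat x" "path \<Lambda> u (Suc (to_nat x))", where 'd='d] by simp

lemma sample_eq:
  fixes x :: "'d site"
  assumes "x \<in> expl (path \<Lambda> u n)" shows "sample \<Lambda> u x = pm (path \<Lambda> u n) x"
  using path_expl_stable[OF max.cobounded1 assms, of "Suc (to_nat x)"]
    path_expl_stable[OF max.cobounded2 site_in_expl, of x n]
  by (simp add: sample_def)

lemma bij_sample: "bij (sample \<Lambda> u)"
proof (rule bijI)
  show "inj (sample \<Lambda> u)"
  proof (rule injI)
    fix x y :: "'d site" assume xy: "sample \<Lambda> u x = sample \<Lambda> u y"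
    define n where "n = max (Suc (to_nat x)) (Suc (to_nat y))"
    have "x \<in> expl (path \<Lambda> u n)" "y \<in> expl (path \<Lambda> u n)"
      using path_expl_stable[OF _ site_in_expl] by (auto simp: n_def)
    then have "pm (path \<Lambda> u n) x = pm (path \<Lambda> u n) y" using xy sample_eq by metis
    then show "x = y" using permutes_inj[OF pm_permutes[OF path_ok(1)]] by (auto dest: injD)
  qed
  show "surj (sample \<Lambda> u)"
  proof (rule surjI)
    fix y :: "'d site"
    let ?s = "path \<Lambda> u (Suc (to_nat y))"
    have p: "pm ?s permutes (expl ?s :: 'd site set)" by (rule pm_permutes_expl[OF path_ok(1)])
    have "inv (pm ?s) y \<in> expl ?s" using permutes_in_image[OF permutes_inv[OF p]] site_in_expl by blast
    then show "sample \<Lambda> u (inv (pm (path \<Lambda> u (Suc (to_nat y)))) y) = y"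
      using sample_eq permutes_inverses(1)[OF p] by simp
  qed
qed

lemma sample_in_SL: "sample \<Lambda> u \<in> SL \<Lambda> id"
  unfolding SL_def Sperm_def
proof (intro CollectI conjI allI impI bij_sample)
  fix x assume "x \<notin> \<Lambda>"
  then have "x \<notin> msupp (path \<Lambda> u (Suc (to_nat x)))" using path_ok(2) by auto
  then show "sample \<Lambda> u x = id x"
    unfolding sample_def using permutes_not_in[OF pm_permutes[OF path_ok(1)]] by simp
qed

lemma finite_cycle_perm_sample: "finite_cycle_perm (sample \<Lambda> u)"
  unfolding finite_cycle_perm_def
proof
  fix x :: "'d site"
  let ?s = "path \<Lambda> u (Suc (to_nat x))"
  have "sample \<Lambda> u ` expl ?s \<subseteq> expl ?s"
  proof (rule image_subsetI)
    fix y :: "'d site" assume y: "y \<in> expl ?s"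
    show "sample \<Lambda> u y \<in> expl ?s"
      unfolding sample_eq[OF y] using permutes_in_image[OF pm_permutes_expl[OF path_ok(1)]] y by blast
  qed
  then show "finite (cycle_through (sample \<Lambda> u) x)"
    by (rule finite_cycle_through[OF bij_sample finite_expl[OF path_ok(1)] site_in_expl])
qed

end

lemma measurable_sample:
  assumes "finite \<Lambda> \<or> \<Lambda> = UNIV" shows "sample \<Lambda> \<in> measurable unit_measure SM"
proof (rule measurable_SM_I)
  show "sample \<Lambda> \<in> space unit_measure \<rightarrow> Sperm"
    using sample_in_SL[OF assms] SL_subset by (auto simp: SL_def)
  show "{u \<in> space unit_measure. sample \<Lambda> u x = y} \<in> sets unit_measure" for x y
    using measurable_tree_path[OF tree_mass_node_mass[OF assms], of "\<lambda>s. pm s x = y" "Suc (to_nat x)"]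
    by (simp add: sample_def)
qed

text \<open>The exceptional values of \<open>u\<close> are the left end points of the limiting
  intervals, countably many and chosen before \<open>x\<close>; one null set serves all
  sites.\<close>

lemma sample_eventually_eq:
  "AE u in unit_measure. \<forall>x. \<forall>\<^sub>F \<Lambda> in finite_subsets_at_top UNIV. sample \<Lambda> u x = sample UNIV u x"
proof -
  have "AE u in unit_measure. u \<notin> range (lft (node_mass UNIV))"
    by (rule AE_unit_measure_not_countable) simp
  then show ?thesis
  proof (rule AE_mp, intro AE_I2 impI allI)
    fix u and x :: "'d site" assume u: "u \<in> space unit_measure" "u \<notin> range (lft (node_mass UNIV))"
    have "\<forall>\<^sub>F \<Lambda> in finite_subsets_at_top UNIV. path \<Lambda> u (Suc (to_nat x)) = path UNIV u (Suc (to_nat x))"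
    proof (rule tree_path_eventually_eq)
      show "tree_mass (node_mass UNIV)" by (rule tree_mass_node_mass) simp
      show "\<forall>\<^sub>F L in finite_subsets_at_top UNIV. tree_mass (node_mass L)"
        by (rule eventually_mono[OF finite_subsets_at_top_finite]) (simp add: tree_mass_node_mass)
    qed (use u node_mass_tendsto in auto)
    then show "\<forall>\<^sub>F \<Lambda> in finite_subsets_at_top UNIV. sample \<Lambda> u x = sample UNIV u x"
      by eventually_elim (simp add: sample_def)
  qed
qed

lemma void_full:
  assumes "finite \<Lambda>" "\<Lambda> \<subseteq> A" "finite A"
  shows "void \<Lambda> A = 1 / Zpart \<alpha> V \<Lambda> id"
proof -
  have "SL \<Lambda> id \<inter> cyl A id = {id}"
    using assms(2) by (auto simp: SL_def cyl_def fun_eq_iff) blast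
  then show ?thesis
    unfolding void_def using assms V0 by (simp add: measure_Gspec cyl_in_SM Ham_def)
qed

text \<open>All seeds producing \<open>\<sigma>0\<close> follow one path up to a depth where
  \<open>\<Lambda>\<close> is exhausted, hence lie in one interval, whose length is the Gibbs
  weight. An upper bound is enough because both sides are probability vectors on the same finite
  set.\<close>

lemma sample_prob_le:
  assumes fin: "finite \<Lambda>" and s0: "\<sigma>0 \<in> SL \<Lambda> id"
  shows "measure unit_measure {u \<in> {0..<1}. sample \<Lambda> u = \<sigma>0} \<le> boltz \<alpha> (Ham V \<Lambda> \<sigma>0) / Zpart \<alpha> V \<Lambda> id"
proof (cases "\<exists>u0\<in>{0..<1}. sample \<Lambda> u0 = \<sigma>0")
  case True
  then obtain u0 where u0: "u0 \<in> {0..<1}" "sample \<Lambda> u0 = \<sigma>0" by auto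
  have L: "finite \<Lambda> \<or> \<Lambda> = UNIV" using fin by simp
  \<comment> \<open>Beyond the code of every site of \<open>\<Lambda>\<close>; inserting 0 keeps
    \<open>Max\<close> meaningful for empty \<open>\<Lambda>\<close>.\<close>
  define N where "N = Suc (Max (insert 0 (to_nat ` \<Lambda>)))"
  define s where "s = path \<Lambda> u0 N"
  interpret U: prob_space unit_measure by (rule prob_space_unit_measure)
  have sub: "\<Lambda> \<subseteq> expl s"
  proof
    fix x :: "'d site" assume "x \<in> \<Lambda>"
    then have "to_nat x < N" unfolding N_def using fin by (simp add: le_imp_less_Suc)
    then show "x \<in> expl s" using from_nat_in_expl[of "to_nat x" s, where 'd='d] by (simp add: s_def)
  qed
  have os: "ok TYPE('d) s" "msupp s \<subseteq> \<Lambda>" unfolding s_def using path_ok[OF L u0(1)] by auto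
  have eq: "path \<Lambda> u N = s" if u: "u \<in> {0..<1}" "sample \<Lambda> u = \<sigma>0" for u
  proof (rule ok_list_unique[where \<tau>=\<sigma>0])
    show "ok TYPE('d) (path \<Lambda> u N)" using path_ok[OF L u(1)] by auto
    show "pm (path \<Lambda> u N) x = \<sigma>0 x" if "x \<in> expl (path \<Lambda> u N)" for x
      using sample_eq[OF L u(1) that] u(2) by simp
    show "pm s x = \<sigma>0 x" if "x \<in> expl s" for x
      using sample_eq[OF L u0(1), of x N] that u0(2) by (simp add: s_def)
  qed (use os in \<open>auto simp: s_def\<close>)
  have "pm s = \<sigma>0"
  proof
    fix x show "pm s x = \<sigma>0 x"
    proof (cases "x \<in> expl s")
      case True
      then show ?thesis using sample_eq[OF L u0(1), of x N] u0(2) by (simp add: s_def)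
    next
      case False
      then have "x \<notin> \<Lambda>" "x \<notin> msupp s" using sub msupp_subset_expl by auto
      then show ?thesis using s0 permutes_not_in[OF pm_permutes[OF os(1)]] by (auto simp: SL_def)
    qed
  qed
  then have w: "list_weight s = boltz \<alpha> (Ham V \<Lambda> \<sigma>0)"
    using list_weight_eq[OF os(1)] cweight_eq_boltz_Ham[where V=V, OF V0 fin, of \<sigma>0] s0
    by (auto simp: SL_id dest: csupp_permutes)
  have "\<Lambda> \<noteq> UNIV" using fin infinite_UNIV_site by auto
  then have mass: "node_mass \<Lambda> s = boltz \<alpha> (Ham V \<Lambda> \<sigma>0) / Zpart \<alpha> V \<Lambda> id"
    using os w void_full[OF fin sub finite_expl[OF os(1)]] by (simp add: node_mass_def void_any_def)
  have "measure unit_measure {u \<in> {0..<1}. sample \<Lambda> u = \<sigma>0} \<le>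
      measure unit_measure {u \<in> {0..<1}. path \<Lambda> u (length s) = s}"
    by (rule U.finite_measure_mono)
       (use eq measurable_tree_path[OF tree_mass_node_mass[OF L], of "\<lambda>t. t = s"] in \<open>auto simp: s_def\<close>)
  also have "\<dots> = node_mass \<Lambda> s" by (rule measure_tree_path[OF tree_mass_node_mass[OF L]])
  finally show ?thesis unfolding mass .
next
  case False
  then have e: "{u \<in> {0..<1}. sample \<Lambda> u = \<sigma>0} = {}" by auto
  show ?thesis unfolding e by (simp add: boltz_nonneg Zpart_nonneg)
qed

lemma singleton_SL_in_SM:
  assumes "finite \<Lambda>" "\<sigma> \<in> SL \<Lambda> id" shows "{\<sigma>} \<in> sets (SM :: 'd perm measure)"
proof -
  have "{\<sigma>} = SL \<Lambda> id \<inter> cyl \<Lambda> \<sigma>"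
  proof -
    have "\<tau> = \<sigma>" if "\<tau> \<in> SL \<Lambda> id \<inter> cyl \<Lambda> \<sigma>" for \<tau>
    proof
      fix x show "\<tau> x = \<sigma> x" using that assms(2) by (cases "x \<in> \<Lambda>") (auto simp: SL_def cyl_def)
    qed
    then show ?thesis using assms(2) by (auto simp: SL_def cyl_def)
  qed
  then show ?thesis using SL_id_in_SM cyl_in_SM[OF assms(1)] by auto
qed

lemma distr_sample:
  assumes fin: "finite \<Lambda>"
  shows "distr unit_measure SM (sample \<Lambda>) = Gspec \<alpha> V \<Lambda> id"
proof (rule measure_eqI)
  have L: "finite \<Lambda> \<or> \<Lambda> = UNIV" using fin by simp
  interpret U: prob_space unit_measure by (rule prob_space_unit_measure)
  note [measurable] = measurable_sample[OF L]
  let ?P = "\<lambda>\<sigma>. measure unit_measure {u \<in> {0..<1}. sample \<Lambda> u = \<sigma>}"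
  let ?Q = "\<lambda>\<sigma>. boltz \<alpha> (Ham V \<Lambda> \<sigma>) / Zpart \<alpha> V \<Lambda> id"
  have fS: "finite (SL \<Lambda> (id :: 'd perm))" by (rule finite_SL_id[OF fin])
  have ev: "{u \<in> {0..<1}. sample \<Lambda> u = \<sigma>} \<in> sets unit_measure" if "\<sigma> \<in> SL \<Lambda> id" for \<sigma>
  proof -
    have "sample \<Lambda> -` {\<sigma>} \<inter> space unit_measure \<in> sets unit_measure"
      using singleton_SL_in_SM[OF fin that] by measurable
    moreover have "sample \<Lambda> -` {\<sigma>} \<inter> space unit_measure = {u \<in> {0..<1}. sample \<Lambda> u = \<sigma>}" by auto
    ultimately show ?thesis by simp
  qed
  have add: "measure unit_measure (sample \<Lambda> -` A \<inter> space unit_measure) = (\<Sum>\<sigma>\<in>SL \<Lambda> id \<inter> A. ?P \<sigma>)" for A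
  proof -
    have "sample \<Lambda> -` A \<inter> space unit_measure = (\<Union>\<sigma>\<in>SL \<Lambda> id \<inter> A. {u \<in> {0..<1}. sample \<Lambda> u = \<sigma>})"
      using sample_in_SL[OF L] by auto
    also have "measure unit_measure \<dots> = (\<Sum>\<sigma>\<in>SL \<Lambda> id \<inter> A. ?P \<sigma>)"
      using fS ev by (intro U.finite_measure_finite_Union) (auto simp: disjoint_family_on_def)
    finally show ?thesis .
  qed
  have sumP: "(\<Sum>\<sigma>\<in>SL \<Lambda> id. ?P \<sigma>) = 1" using add[of UNIV] U.prob_space by simp
  have sumQ: "(\<Sum>\<sigma>\<in>SL \<Lambda> id. ?Q \<sigma>) = 1"
    using Zpart_id_pos[where V=V, OF V0 fin, of \<alpha>] by (simp add: Zpart_def flip: sum_divide_distrib)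
  have eq: "?P \<sigma> = ?Q \<sigma>" if "\<sigma> \<in> SL \<Lambda> id" for \<sigma>
  proof -
    \<comment> \<open>The differences are nonnegative by \<open>sample_prob_le\<close> and sum to 0,
      so each of them vanishes.\<close>
    have "(\<Sum>\<sigma>\<in>SL \<Lambda> id. ?Q \<sigma> - ?P \<sigma>) = 0" by (simp only: sum_subtractf sumP sumQ)
    then have "?Q \<sigma> - ?P \<sigma> = 0"
      using sum_nonneg_eq_0_iff[OF fS, of "\<lambda>\<sigma>. ?Q \<sigma> - ?P \<sigma>"] sample_prob_le[OF fin] that by auto
    then show ?thesis by simp
  qed
  show "sets (distr unit_measure SM (sample \<Lambda>)) = sets (Gspec \<alpha> V \<Lambda> id)" using fin by simp
  fix A assume "A \<in> sets (distr unit_measure SM (sample \<Lambda>))"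
  then have A: "A \<in> sets SM" by simp
  have "emeasure (distr unit_measure SM (sample \<Lambda>)) A =
      ennreal (measure unit_measure (sample \<Lambda> -` A \<inter> space unit_measure))"
    using A by (simp add: emeasure_distr U.emeasure_eq_measure)
  also have "\<dots> = ennreal (\<Sum>\<sigma>\<in>SL \<Lambda> id \<inter> A. ?P \<sigma>)" by (simp only: add)
  also have "\<dots> = emeasure (Gspec \<alpha> V \<Lambda> id) A"
    unfolding emeasure_Gspec[OF fin id_Sperm(1) A]
    by (rule arg_cong[where f=ennreal], rule sum.cong[OF refl]) (use eq in blast)
  finally show "emeasure (distr unit_measure SM (sample \<Lambda>)) A = emeasure (Gspec \<alpha> V \<Lambda> id) A" .
qed

end

section \<open>Invariant cylinders determine measures on finite-cycle permutations\<close>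

text \<open>The cylinders whose base is a union of complete cycles: on these the limiting law has a
  closed form. A permutation having only infinite cycles lies in none with nonempty base, so they
  control measures only on \<open>fin_orbs\<close>.\<close>

definition icyls :: "'d perm set set" where
  "icyls = {cyl D \<tau> | D \<tau>. finite D \<and> \<tau> permutes D}"

definition fin_orbs :: "'d perm set" where
  "fin_orbs = {\<sigma> \<in> Sperm. \<forall>x. finite (orb \<sigma> x)}"

lemma icyls_subset_cylinders: "icyls \<subseteq> cylinders"
  by (auto simp: icyls_def cylinders_def)

lemma countable_icyls: "countable (icyls :: ('d::finite) perm set set)"
  by (rule countable_subset[OF icyls_subset_cylinders countable_cylinders])

lemma icyls_subset_Pow: "icyls \<subseteq> Pow Sperm"
  by (auto simp: icyls_def cyl_def)

lemma invariant_restriction_permutes: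
  assumes "bij \<sigma>" "\<sigma> ` D = D"
  shows "(\<lambda>x. if x \<in> D then \<sigma> x else x) permutes D"
  by (rule bij_imp_permutes)
     (use assms in \<open>auto simp: bij_betw_def inj_on_def bij_def dest: injD\<close>)

lemma cyl_permutes_image:
  assumes "\<sigma> \<in> cyl D \<tau>" "\<tau> permutes D" shows "\<sigma> ` D = D"
proof -
  have "\<sigma> ` D = \<tau> ` D" using assms(1) by (intro image_cong) (auto simp: cyl_def)
  then show ?thesis using permutes_image[OF assms(2)] by simp
qed

text \<open>A permutation in both cylinders leaves both bases invariant, hence also their union, and
  its restriction to the union is the joint prescription.\<close>

lemma Int_stable_icyls: "Int_stable (insert {} (icyls :: 'd perm set set))"
proof (rule Int_stableI)
  fix a c :: "'d perm set" assume ac: "a \<in> insert {} icyls" "c \<in> insert {} icyls"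
  show "a \<inter> c \<in> insert {} icyls"
  proof (cases "a \<inter> c = {}")
    case False
    then obtain \<sigma> where s: "\<sigma> \<in> a" "\<sigma> \<in> c" by auto
    obtain D \<tau> where a: "a = cyl D \<tau>" "finite D" "\<tau> permutes D" using ac s by (auto simp: icyls_def)
    obtain D' \<tau>' where c: "c = cyl D' \<tau>'" "finite D'" "\<tau>' permutes D'" using ac s by (auto simp: icyls_def)
    have im: "\<sigma> ` (D \<union> D') = D \<union> D'"
      using cyl_permutes_image[OF s(1)[unfolded a(1)] a(3)] cyl_permutes_image[OF s(2)[unfolded c(1)] c(3)]
      by (simp add: image_Un)
    let ?\<rho> = "\<lambda>x. if x \<in> D \<union> D' then \<sigma> x else x"
    have "?\<rho> permutes (D \<union> D')"
      using s(1) by (intro invariant_restriction_permutes im) (auto simp: a(1) cyl_def Sperm_def)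
    moreover have "a \<inter> c = cyl (D \<union> D') ?\<rho>"
      using s unfolding a(1) c(1) by (auto simp: cyl_def)
    ultimately show ?thesis using a(2) c(2) unfolding icyls_def by blast
  qed simp
qed

lemma fin_orbs_invariant_superset:
  assumes "\<sigma> \<in> fin_orbs" "finite A"
  obtains D where "finite D" "A \<subseteq> D" "\<sigma> ` D = D"
proof -
  have o: "\<sigma> ` orb \<sigma> x = orb \<sigma> x" for x
  proof -
    have "inj_on \<sigma> (orb \<sigma> x)" using assms(1) by (auto simp: fin_orbs_def Sperm_def bij_def intro: inj_on_subset)
    moreover have "\<sigma> ` orb \<sigma> x \<subseteq> orb \<sigma> x" using orb_step by blast
    moreover have "finite (orb \<sigma> x)" using assms(1) by (simp add: fin_orbs_def)
    ultimately show ?thesis by (simp add: card_image card_subset_eq)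
  qed
  show ?thesis
  proof (rule that[of "\<Union>x\<in>A. orb \<sigma> x"])
    show "finite (\<Union>x\<in>A. orb \<sigma> x)" using assms by (auto simp: fin_orbs_def)
    show "A \<subseteq> (\<Union>x\<in>A. orb \<sigma> x)" using orb_self by auto
    show "\<sigma> ` (\<Union>x\<in>A. orb \<sigma> x) = (\<Union>x\<in>A. orb \<sigma> x)" unfolding image_UN o ..
  qed
qed

lemma fin_orbs_icyl:
  assumes "\<sigma> \<in> fin_orbs" "finite A"
  shows "\<exists>D \<tau>. finite D \<and> A \<subseteq> D \<and> \<tau> permutes D \<and> \<sigma> \<in> cyl D \<tau>"
proof -
  obtain D where D: "finite D" "A \<subseteq> D" "\<sigma> ` D = D" using fin_orbs_invariant_superset[OF assms] .
  have "bij \<sigma>" using assms(1) by (simp add: fin_orbs_def Sperm_def)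
  then have "(\<lambda>x. if x \<in> D then \<sigma> x else x) permutes D" by (rule invariant_restriction_permutes[OF _ D(3)])
  moreover have "\<sigma> \<in> cyl D (\<lambda>x. if x \<in> D then \<sigma> x else x)" using assms(1) by (simp add: fin_orbs_def cyl_def)
  ultimately show ?thesis using D by blast
qed

lemma fin_orbs_eq:
  "fin_orbs = Sperm \<inter> (\<Inter>x. \<Union>{cyl D \<tau> | D \<tau>. finite D \<and> x \<in> D \<and> \<tau> permutes D})"
proof (intro equalityI subsetI)
  fix \<sigma> :: "'d perm" assume s: "\<sigma> \<in> fin_orbs"
  show "\<sigma> \<in> Sperm \<inter> (\<Inter>x. \<Union>{cyl D \<tau> | D \<tau>. finite D \<and> x \<in> D \<and> \<tau> permutes D})"
  proof (intro IntI INT_I)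
    show "\<sigma> \<in> Sperm" using s by (simp add: fin_orbs_def)
    fix x
    obtain D \<tau> where "finite D" "{x} \<subseteq> D" "\<tau> permutes D" "\<sigma> \<in> cyl D \<tau>"
      using fin_orbs_icyl[OF s, of "{x}"] by auto
    then show "\<sigma> \<in> \<Union>{cyl D \<tau> | D \<tau>. finite D \<and> x \<in> D \<and> \<tau> permutes D}" by blast
  qed
next
  fix \<sigma> :: "'d perm" assume s: "\<sigma> \<in> Sperm \<inter> (\<Inter>x. \<Union>{cyl D \<tau> | D \<tau>. finite D \<and> x \<in> D \<and> \<tau> permutes D})"
  have "finite (orb \<sigma> x)" for x
  proof -
    have "\<sigma> \<in> \<Union>{cyl D \<tau> | D \<tau>. finite D \<and> x \<in> D \<and> \<tau> permutes D}" using s by auto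
    then obtain D \<tau> where D: "finite D" "x \<in> D" "\<tau> permutes D" "\<sigma> \<in> cyl D \<tau>" by auto
    have im: "\<sigma> ` D = D" by (rule cyl_permutes_image[OF D(4,3)])
    have "(\<sigma> ^^ n) x \<in> D" for n by (induction n) (use D(2) im in auto)
    then have "orb \<sigma> x \<subseteq> D" by (auto simp: orb_def)
    then show ?thesis using D(1) finite_subset by blast
  qed
  then show "\<sigma> \<in> fin_orbs" using s by (simp add: fin_orbs_def)
qed

lemma fin_orbs_in_icyl_sigma: "fin_orbs \<in> sigma_sets Sperm (insert {} (icyls :: ('d::finite) perm set set))"
proof -
  interpret sigma_algebra "Sperm :: 'd perm set" "sigma_sets Sperm (insert {} (icyls :: 'd perm set set))"
    by (rule sigma_algebra_sigma_sets) (use icyls_subset_Pow in auto)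
  have "\<Union>{cyl D \<tau> | D \<tau>. finite D \<and> x \<in> D \<and> \<tau> permutes D} \<in> sigma_sets Sperm (insert {} (icyls :: 'd perm set set))" for x
  proof (rule sigma_sets_UNION)
    show "countable {cyl D \<tau> | D \<tau>. finite D \<and> x \<in> D \<and> \<tau> permutes D}"
      by (rule countable_subset[OF _ countable_icyls]) (auto simp: icyls_def)
  qed (auto simp: icyls_def)
  then have "(\<Inter>x. \<Union>{cyl D \<tau> | D \<tau>. finite D \<and> x \<in> D \<and> \<tau> permutes D}) \<in> sigma_sets Sperm (insert {} (icyls :: 'd perm set set))"
    by (intro countable_INT') auto
  then show ?thesis unfolding fin_orbs_eq using top by (intro Int)
qed

text \<open>For finite cycles any finite base can be enlarged to a finite invariant one by adding
  orbits, so within \<open>fin_orbs\<close> each cylinder is a countable union of members of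
  \<open>icyls\<close>.\<close>

lemma SM_Int_fin_orbs:
  assumes "X \<in> sets (SM :: ('d::finite) perm measure)"
  shows "X \<inter> fin_orbs \<in> sigma_sets Sperm (insert {} icyls)"
proof -
  let ?S = "sigma_sets Sperm (insert {} (icyls :: 'd perm set set))"
  interpret sigma_algebra "Sperm :: 'd perm set" ?S
    by (rule sigma_algebra_sigma_sets) (use icyls_subset_Pow in auto)
  note F = fin_orbs_in_icyl_sigma[where 'd='d]
  have "X \<in> sigma_sets Sperm cylinders" using assms by (simp add: sets_SM)
  then show ?thesis
  proof (induction rule: sigma_sets.induct)
    case (Basic C)
    then obtain A \<xi> where C: "C = cyl A \<xi>" "finite A" by (auto simp: cylinders_def)
    have eq: "C \<inter> fin_orbs = \<Union>{E \<in> icyls. E \<subseteq> C} \<inter> fin_orbs"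
    proof (intro equalityI subsetI)
      fix \<sigma> assume s: "\<sigma> \<in> C \<inter> fin_orbs"
      then obtain D \<tau> where D: "finite D" "A \<subseteq> D" "\<tau> permutes D" "\<sigma> \<in> cyl D \<tau>"
        using fin_orbs_icyl[of \<sigma> A] C(2) by auto
      have "cyl D \<tau> \<subseteq> C"
      proof
        fix \<rho> assume r: "\<rho> \<in> cyl D \<tau>"
        have "\<rho> x = \<xi> x" if x: "x \<in> A" for x
        proof -
          have "\<rho> x = \<sigma> x" using r D(2,4) x by (auto simp: cyl_def)
          then show ?thesis using s x by (auto simp: C cyl_def)
        qed
        then show "\<rho> \<in> C" using r by (auto simp: C cyl_def)
      qed
      then show "\<sigma> \<in> \<Union>{E \<in> icyls. E \<subseteq> C} \<inter> fin_orbs" using s D by (auto simp: icyls_def)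
    qed auto
    have U: "\<Union>{E \<in> icyls. E \<subseteq> C} \<in> ?S"
      by (rule sigma_sets_UNION) (auto intro: countable_subset[OF _ countable_icyls])
    show ?case unfolding eq by (rule Int[OF U F])
  next
    case (Compl X)
    have "(Sperm - X) \<inter> fin_orbs = fin_orbs - X \<inter> fin_orbs" by (auto simp: fin_orbs_def)
    then show ?case using Compl F by auto
  next
    case (Union X)
    have eq: "(\<Union>i. X i) \<inter> fin_orbs = (\<Union>i. X i \<inter> fin_orbs)" by auto
    show ?case unfolding eq by (rule sigma_sets.Union) (rule Union)
  qed (simp add: sigma_sets.Empty)
qed

lemma icyl_sigma_subset_SM: "sigma_sets Sperm (insert {} icyls) \<subseteq> sets (SM :: ('d::finite) perm measure)"
  unfolding sets_SM_insert by (rule sigma_sets_mono') (use icyls_subset_cylinders in auto)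

text \<open>The usual induction over a generator stable under intersections, with the extra case
  \<open>null\<close> to pass from the trace on \<open>fin_orbs\<close> to the event itself. For
  measures carried by \<open>fin_orbs\<close> that case costs nothing.\<close>

lemma SM_induct_icyls [consumes 1, case_names icyl empty compl union null]:
  fixes P :: "('d::finite) perm set \<Rightarrow> bool"
  assumes X: "X \<in> sets SM"
    and icyl: "\<And>D \<tau>. finite D \<Longrightarrow> \<tau> permutes D \<Longrightarrow> P (cyl D \<tau>)"
    and empty: "P {}"
    and compl: "\<And>X. X \<in> sets SM \<Longrightarrow> P X \<Longrightarrow> P (Sperm - X)"
    and union: "\<And>X. disjoint_family X \<Longrightarrow> (\<And>i::nat. X i \<in> sets SM) \<Longrightarrow> (\<And>i. P (X i)) \<Longrightarrow> P (\<Union>i. X i)"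
    and null: "\<And>X. X \<in> sets SM \<Longrightarrow> P (X \<inter> fin_orbs) \<Longrightarrow> P X"
  shows "P X"
proof (rule null[OF X])
  have "insert {} icyls \<subseteq> Pow (Sperm :: 'd perm set)" using icyls_subset_Pow by auto
  from Int_stable_icyls this SM_Int_fin_orbs[OF X] show "P (X \<inter> fin_orbs)"
  proof (induction rule: sigma_sets_induct_disjoint)
    case (basic A)
    then show ?case using icyl empty by (auto simp: icyls_def)
  next
    case (compl A)
    then show ?case using assms(4) icyl_sigma_subset_SM by blast
  next
    case (union A)
    then show ?case using icyl_sigma_subset_SM by (intro assms(5)) auto
  qed (rule empty)
qed

lemma fin_orbs_in_SM: "fin_orbs \<in> sets (SM :: ('d::finite) perm measure)"
  using fin_orbs_in_icyl_sigma icyl_sigma_subset_SM by blast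

lemma prob_measure_eqI_icyls:
  fixes m1 m2 :: "('d::finite) perm measure"
  assumes p: "prob_space m1" "prob_space m2" and s: "sets m1 = sets SM" "sets m2 = sets SM"
    and AE: "AE \<sigma> in m1. \<sigma> \<in> fin_orbs" "AE \<sigma> in m2. \<sigma> \<in> fin_orbs"
    and eq: "\<And>D \<tau>. finite D \<Longrightarrow> \<tau> permutes D \<Longrightarrow> measure m1 (cyl D \<tau>) = measure m2 (cyl D \<tau>)"
  shows "m1 = m2"
proof (rule measure_eqI)
  interpret m1: prob_space m1 by fact
  interpret m2: prob_space m2 by fact
  have sp: "space m1 = Sperm" "space m2 = Sperm" using s[THEN sets_eq_imp_space_eq] by auto
  fix X assume "X \<in> sets m1"
  then have "X \<in> sets SM" by (simp add: s)
  then have "measure m1 X = measure m2 X"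
  proof (induction rule: SM_induct_icyls)
    case (compl X)
    then show ?case using m1.prob_compl[of X] m2.prob_compl[of X] by (simp add: s sp)
  next
    case (union X)
    have r: "range X \<subseteq> sets m1" "range X \<subseteq> sets m2" using union(2) by (auto simp: s)
    have "(\<lambda>i. measure m1 (X i)) sums measure m1 (\<Union>i. X i)" "(\<lambda>i. measure m2 (X i)) sums measure m2 (\<Union>i. X i)"
      by (rule m1.finite_measure_UNION[OF r(1) union(1)], rule m2.finite_measure_UNION[OF r(2) union(1)])
    then show ?case unfolding union(3) by (rule sums_unique2)
  next
    case (null X)
    have "measure m1 (X \<inter> fin_orbs) = measure m1 X"
      by (rule m1.finite_measure_eq_AE) (use AE null fin_orbs_in_SM s in auto)
    moreover have "measure m2 (X \<inter> fin_orbs) = measure m2 X"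
      by (rule m2.finite_measure_eq_AE) (use AE null fin_orbs_in_SM s in auto)
    ultimately show ?case using null by simp
  qed (use eq in auto)
  then show "emeasure m1 X = emeasure m2 X" by (simp add: m1.emeasure_eq_measure m2.emeasure_eq_measure)
qed (simp add: s)

lemma finite_cycle_perm_fin_orbs: "\<sigma> \<in> Sperm \<Longrightarrow> finite_cycle_perm \<sigma> \<Longrightarrow> \<sigma> \<in> fin_orbs"
  by (simp add: fin_orbs_def finite_orb_of_finite_cycle_perm)

section \<open>Translations of orbits, cylinders and choices\<close>

lemma orb_shift: "orb (shift z \<sigma>) (tr z x) = tr z ` orb \<sigma> x"
proof -
  have "(shift z \<sigma> ^^ n) (tr z x) = tr z ((\<sigma> ^^ n) x)" for n by (induction n) auto
  then show ?thesis by (auto simp: orb_def)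
qed

lemma shift_fin_orbs_iff: "shift z \<sigma> \<in> fin_orbs \<longleftrightarrow> \<sigma> \<in> fin_orbs"
proof -
  have *: "shift z \<sigma> \<in> fin_orbs" if s: "\<sigma> \<in> fin_orbs" for z and \<sigma> :: "'d perm"
  proof -
    have "finite (orb (shift z \<sigma>) x)" for x
      using orb_shift[of z \<sigma> "tr (neg z) x"] s by (simp add: fin_orbs_def)
    then show ?thesis using s bij_shift by (auto simp: fin_orbs_def Sperm_def)
  qed
  show ?thesis using *[of \<sigma> z] *[of "shift z \<sigma>" "neg z"] by auto
qed

lemma shift_Sperm_iff: "shift z \<sigma> \<in> Sperm \<longleftrightarrow> \<sigma> \<in> Sperm"
  using bij_shift[of \<sigma> z] bij_shift[of "shift z \<sigma>" "neg z"] by (auto simp: Sperm_def)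

lemma shift_vimage_cyl: "{\<sigma> \<in> Sperm. shift z \<sigma> \<in> cyl D \<tau>} = cyl (tr (neg z) ` D) (shift (neg z) \<tau>)"
proof -
  have "(\<forall>x\<in>D. shift z \<sigma> x = \<tau> x) \<longleftrightarrow> (\<forall>x\<in>tr (neg z) ` D. \<sigma> x = shift (neg z) \<tau> x)" for \<sigma>
    by (simp add: shift_apply) (metis tr_neg)
  then show ?thesis by (auto simp: cyl_def shift_Sperm_iff)
qed

lemma measurable_shift: "shift z \<in> measurable SM (SM :: ('d::finite) perm measure)"
proof (rule measurable_SM_I)
  fix x y :: "'d site"
  have "{\<sigma> \<in> Sperm. shift z \<sigma> x = y} = {\<sigma> \<in> Sperm. \<sigma> (tr (neg z) x) = tr (neg z) y}"
    by (auto simp: shift_apply)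
  then show "{m \<in> space SM. shift z m x = y} \<in> sets SM" by (simp add: sets_SM_value)
qed (simp add: shift_Sperm_iff)

lemma permutes_shift: "\<tau> permutes D \<Longrightarrow> shift z \<tau> permutes (tr z ` D)"
proof -
  assume t: "\<tau> permutes D"
  have "shift z \<tau> \<in> SL (tr z ` D) id"
    unfolding SL_def
  proof (intro CollectI conjI allI impI)
    show "shift z \<tau> \<in> Sperm" using permutes_bij[OF t] bij_shift by (auto simp: Sperm_def)
    fix x assume "x \<notin> tr z ` D"
    then have "tr (neg z) x \<notin> D" by (metis imageI tr_neg(1))
    then show "shift z \<tau> x = id x" using permutes_not_in[OF t] by (simp add: shift_apply)
  qed
  then show ?thesis by (simp add: SL_id)
qed

lemma bij_betw_shift_choice: "bij_betw (shift z) (choice x A) (choice (tr z x) (tr z ` A))"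
proof (rule bij_betw_byWitness[where f'="shift (neg z)"])
  have si: "shift z id = id" for z :: "'d site" by (auto simp: shift_apply)
  have *: "shift z c \<in> choice (tr z x) (tr z ` A)" if c: "c \<in> choice x A" for z x A and c :: "'d perm"
  proof -
    have "shift z c = id \<or> shift z c \<in> through (tr z x)"
      using c bij_betw_apply[OF bij_betw_shift_through, of c x z] si by (auto simp: choice_def)
    moreover have "csupp (shift z c) \<inter> tr z ` A = {}"
      using c unfolding csupp_shift by (auto simp: choice_def)
    ultimately show ?thesis by (simp add: choice_def)
  qed
  show "shift z ` choice x A \<subseteq> choice (tr z x) (tr z ` A)" using * by blast
  show "shift (neg z) ` choice (tr z x) (tr z ` A) \<subseteq> choice x A"
    using *[of _ "tr z x" "tr z ` A" "neg z"] by (auto simp: image_image)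
qed auto

section \<open>The sigma-algebra of the outside of a set\<close>

lemma space_Fout [simp]: "space (Fout \<Lambda>) = Sperm"
  unfolding Fout_def by (rule space_measure_of) auto

lemma sets_Fout: "sets (Fout \<Lambda>) = sigma_sets Sperm {{\<sigma> \<in> Sperm. \<sigma> x = y} | x y. x \<notin> \<Lambda>}"
  unfolding Fout_def by (rule sets_measure_of) auto

lemma sets_Fout_subset: "sets (Fout \<Lambda>) \<subseteq> sets (SM :: ('d::finite) perm measure)"
  unfolding sets_Fout
  using sets.sigma_sets_subset[of "{{\<sigma> \<in> Sperm. \<sigma> x = y} | x y. x \<notin> \<Lambda>}" "SM :: 'd perm measure"] sets_SM_value
  by auto

section \<open>The limiting measure\<close>

context cycle_gas
begin

definition mu :: "'d perm measure" where
  "mu = distr unit_measure SM (sample UNIV)"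

lemma sets_mu [simp]: "sets mu = sets SM" and space_mu [simp]: "space mu = Sperm"
  by (simp_all add: mu_def)

lemma prob_space_mu: "prob_space mu"
proof -
  interpret prob_space unit_measure by (rule prob_space_unit_measure)
  show ?thesis unfolding mu_def by (rule prob_space_distr[OF measurable_sample]) simp
qed

lemma finite_cycle_perm_iff_fin_orbs: "\<sigma> \<in> Sperm \<Longrightarrow> finite_cycle_perm \<sigma> \<longleftrightarrow> \<sigma> \<in> fin_orbs"
proof
  assume s: "\<sigma> \<in> Sperm" "\<sigma> \<in> fin_orbs"
  show "finite_cycle_perm \<sigma>"
    unfolding finite_cycle_perm_def
  proof
    fix x show "finite (cycle_through \<sigma> x)"
      using s orb_self[of x \<sigma>] orb_step[of _ \<sigma> x]
      by (intro finite_cycle_through[where B="orb \<sigma> x"]) (auto simp: fin_orbs_def Sperm_def)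
  qed
qed (rule finite_cycle_perm_fin_orbs)

lemma AE_mu_finite_cycle: "AE \<sigma> in mu. finite_cycle_perm \<sigma>" and AE_mu_fin_orbs: "AE \<sigma> in mu. \<sigma> \<in> fin_orbs"
proof -
  have m: "sample UNIV \<in> measurable unit_measure SM" by (rule measurable_sample) simp
  have "AE u in unit_measure. sample UNIV u \<in> fin_orbs"
  proof (rule AE_I2)
    fix u assume "u \<in> space unit_measure"
    then have u: "u \<in> {0..<1}" by simp
    show "sample UNIV u \<in> fin_orbs"
      using bij_sample[OF _ u] finite_cycle_perm_sample[OF _ u]
      by (intro finite_cycle_perm_fin_orbs) (auto simp: Sperm_def)
  qed
  then show A: "AE \<sigma> in mu. \<sigma> \<in> fin_orbs"
    unfolding mu_def using fin_orbs_in_SM[where 'd='d]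
    by (subst AE_distr_iff[OF m]) (auto simp: fin_orbs_def cong: conj_cong)
  show "AE \<sigma> in mu. finite_cycle_perm \<sigma>"
    using A by (rule AE_mp) (intro AE_I2 impI, simp add: finite_cycle_perm_iff_fin_orbs)
qed

text \<open>Under the coupling the integrands converge almost surely: a neighbourhood of the
  limiting permutation is given by finitely many sites, and at each of these the samples are
  eventually constant.\<close>

lemma Gspec_integral_tendsto:
  assumes f: "continuous_map Stop euclideanreal f" and B: "\<And>\<sigma>. \<sigma> \<in> Sperm \<Longrightarrow> \<bar>f \<sigma>\<bar> \<le> B"
  shows "((\<lambda>\<Lambda>. \<integral>\<sigma>. f \<sigma> \<partial>Gspec \<alpha> V \<Lambda> id) \<longlongrightarrow> (\<integral>\<sigma>. f \<sigma> \<partial>mu)) (finite_subsets_at_top UNIV)"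
proof -
  interpret U: prob_space unit_measure by (rule prob_space_unit_measure)
  have fm: "f \<in> borel_measurable SM" by (rule continuous_map_Stop_measurable[OF f])
  note sm = measurable_sample
  have "((\<lambda>\<Lambda>. \<integral>u. f (sample \<Lambda> u) \<partial>unit_measure) \<longlongrightarrow> (\<integral>u. f (sample UNIV u) \<partial>unit_measure)) (finite_subsets_at_top UNIV)"
  proof (rule U.integral_dominated_convergence_finite_subsets[where B=B])
    show "(\<lambda>u. f (sample L u)) \<in> borel_measurable unit_measure" if "finite L" for L
      using that by (intro measurable_compose[OF sm fm]) simp
    show "(\<lambda>u. f (sample UNIV u)) \<in> borel_measurable unit_measure"
      by (intro measurable_compose[OF sm fm]) simp
    show "\<bar>f (sample L u)\<bar> \<le> B" if "finite L" "u \<in> space unit_measure" for L u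
      using that by (intro B) (auto simp: Sperm_def intro!: bij_sample)
    show "AE u in unit_measure. ((\<lambda>L. f (sample L u)) \<longlongrightarrow> f (sample UNIV u)) (finite_subsets_at_top UNIV)"
      using sample_eventually_eq
    proof (rule AE_mp, intro AE_I2 impI)
      fix u assume u: "u \<in> space unit_measure"
        and ev: "\<forall>x. \<forall>\<^sub>F \<Lambda> in finite_subsets_at_top UNIV. sample \<Lambda> u x = sample UNIV u x"
      have us: "sample UNIV u \<in> Sperm" using u bij_sample[of UNIV u] by (auto simp: Sperm_def)
      show "((\<lambda>L. f (sample L u)) \<longlongrightarrow> f (sample UNIV u)) (finite_subsets_at_top UNIV)"
      proof (rule topological_tendstoI)
        fix S assume S: "open S" "f (sample UNIV u) \<in> S"
        have "openin Stop {\<sigma> \<in> topspace Stop. f \<sigma> \<in> S}" using f S(1) by (auto simp: continuous_map_def)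
        then obtain D where D: "finite D" "cyl D (sample UNIV u) \<subseteq> {\<sigma> \<in> topspace Stop. f \<sigma> \<in> S}"
          using openin_Stop_nbhd[of "{\<sigma> \<in> topspace Stop. f \<sigma> \<in> S}" "sample UNIV u"] us S(2)
          by (auto simp: topspace_Stop)
        have "\<forall>\<^sub>F L in finite_subsets_at_top UNIV. \<forall>x\<in>D. sample L u x = sample UNIV u x"
          using D(1) ev by (intro eventually_ball_finite) auto
        then show "\<forall>\<^sub>F L in finite_subsets_at_top UNIV. f (sample L u) \<in> S"
          using finite_subsets_at_top_finite
        proof eventually_elim
          case (elim L)
          then have "sample L u \<in> cyl D (sample UNIV u)"
            using u bij_sample[of L u] by (auto simp: cyl_def Sperm_def)
          then show ?case using D(2) by auto
        qed
      qed
    qed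
  qed
  moreover have "\<forall>\<^sub>F \<Lambda> in finite_subsets_at_top UNIV.
      (\<integral>u. f (sample \<Lambda> u) \<partial>unit_measure) = (\<integral>\<sigma>. f \<sigma> \<partial>Gspec \<alpha> V \<Lambda> id)"
    by (rule eventually_mono[OF finite_subsets_at_top_finite])
       (simp add: distr_sample[symmetric] integral_distr[OF sm fm])
  moreover have "(\<integral>u. f (sample UNIV u) \<partial>unit_measure) = (\<integral>\<sigma>. f \<sigma> \<partial>mu)"
    unfolding mu_def by (simp add: integral_distr[OF sm fm])
  ultimately show ?thesis using Lim_transform_eventually by fastforce
qed

lemma weak_conv_mu: "weak_conv_net (\<lambda>\<Lambda>. Gspec \<alpha> V \<Lambda> id) mu"
  unfolding weak_conv_net_def using Gspec_integral_tendsto by blast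

lemma Gspec_cyl_tendsto:
  assumes "finite D"
  shows "((\<lambda>\<Lambda>. measure (Gspec \<alpha> V \<Lambda> id) (cyl D \<tau>)) \<longlongrightarrow> measure mu (cyl D \<tau>)) (finite_subsets_at_top UNIV)"
proof -
  have "((\<lambda>\<Lambda>. \<integral>\<sigma>. indicator (cyl D \<tau>) \<sigma> \<partial>Gspec \<alpha> V \<Lambda> id) \<longlongrightarrow> (\<integral>\<sigma>. indicator (cyl D \<tau>) \<sigma> \<partial>mu :: real)) (finite_subsets_at_top UNIV)"
  proof (rule Gspec_integral_tendsto[where B=1])
    show "continuous_map Stop euclideanreal (indicator (cyl D \<tau>))"
      by (rule continuous_map_Stop_local[OF assms]) (auto simp: cyl_def indicator_def)
  qed (simp add: indicator_def)
  moreover have "\<forall>\<^sub>F \<Lambda> in finite_subsets_at_top UNIV.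
      (\<integral>\<sigma>. indicator (cyl D \<tau>) \<sigma> \<partial>Gspec \<alpha> V \<Lambda> id) = measure (Gspec \<alpha> V \<Lambda> id) (cyl D \<tau>)"
  proof (rule eventually_mono[OF finite_subsets_at_top_finite])
    fix L :: "'d site set" assume L: "finite L"
    have "cyl D \<tau> \<inter> space (Gspec \<alpha> V L id) = cyl D \<tau>"
      using sets_eq_imp_space_eq[OF sets_Gspec[OF L id_Sperm(1)]] by (auto simp: cyl_def)
    then show "(\<integral>\<sigma>. indicator (cyl D \<tau>) \<sigma> \<partial>Gspec \<alpha> V L id) = measure (Gspec \<alpha> V L id) (cyl D \<tau>)" by simp
  qed
  moreover have "(\<integral>\<sigma>. indicator (cyl D \<tau>) \<sigma> \<partial>mu) = measure mu (cyl D \<tau>)"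
  proof -
    have "cyl D \<tau> \<inter> space mu = cyl D \<tau>" by (auto simp: cyl_def)
    then show ?thesis by simp
  qed
  ultimately show ?thesis using Lim_transform_eventually by fastforce
qed

lemma measure_mu_icyl:
  assumes D: "finite D" and t: "\<tau> permutes D"
  shows "measure mu (cyl D \<tau>) = w \<tau> * void_lim D"
proof -
  have "((\<lambda>\<Lambda>. w \<tau> * void \<Lambda> D) \<longlongrightarrow> w \<tau> * void_lim D) (finite_subsets_at_top UNIV)"
    by (intro tendsto_intros void_tendsto D)
  moreover have "\<forall>\<^sub>F \<Lambda> in finite_subsets_at_top UNIV. w \<tau> * void \<Lambda> D = measure (Gspec \<alpha> V \<Lambda> id) (cyl D \<tau>)"
    unfolding eventually_finite_subsets_at_top
  proof (intro exI[of _ D] conjI allI impI)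
    fix L assume L: "finite L \<and> D \<subseteq> L \<and> L \<subseteq> UNIV"
    show "w \<tau> * void L D = measure (Gspec \<alpha> V L id) (cyl D \<tau>)"
      unfolding void_def
      using measure_Gspec_toggle[where V=V, OF V0 _ id_Sperm(1) D permutes_bij[OF t], of L] L csupp_permutes[OF t] by auto
  qed (use D in auto)
  ultimately have "((\<lambda>\<Lambda>. measure (Gspec \<alpha> V \<Lambda> id) (cyl D \<tau>)) \<longlongrightarrow> w \<tau> * void_lim D) (finite_subsets_at_top UNIV)"
    by (rule Lim_transform_eventually)
  then show ?thesis using Gspec_cyl_tendsto[OF D] tendsto_unique[OF finite_subsets_at_top_neq_bot] by blast
qed

lemma mu_eqI:
  assumes \<nu>: "prob_space \<nu>" "sets \<nu> = sets SM" "AE \<sigma> in \<nu>. \<sigma> \<in> fin_orbs"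
    and eq: "\<And>D \<tau>. finite D \<Longrightarrow> \<tau> permutes D \<Longrightarrow> measure \<nu> (cyl D \<tau>) = w \<tau> * void_lim D"
  shows "\<nu> = mu"
  by (rule prob_measure_eqI_icyls[OF \<nu>(1) prob_space_mu \<nu>(2) sets_mu \<nu>(3) AE_mu_fin_orbs])
     (simp add: eq measure_mu_icyl)

text \<open>Integrating the conditional law inside \<open>D\<close> yields the toggle relation for
  \<open>\<nu>\<close>. With finite cycles this makes its void probabilities a solution of the
  recursion on the whole lattice, and there is only one.\<close>

lemma gibbs_unique:
  assumes g: "gibbs \<alpha> V \<nu>" and fc: "AE \<sigma> in \<nu>. finite_cycle_perm \<sigma>"
  shows "\<nu> = mu"
proof -
  have p: "prob_space \<nu>" and s: "sets \<nu> = sets SM" using g by (auto simp: gibbs_def)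
  interpret prob_space \<nu> by fact
  have sp: "space \<nu> = Sperm" using sets_eq_imp_space_eq[OF s] by simp
  have tog: "measure \<nu> (cyl D c) = w c * measure \<nu> (cyl D id)"
    if D: "finite D" and c: "bij c" "csupp c \<subseteq> D" for D c
  proof -
    have sub: "subalgebra \<nu> (Fout D)"
      by (simp add: subalgebra_def sp s sets_Fout_subset)
    interpret finite_measure_subalgebra \<nu> "Fout D" by unfold_locales (rule sub)
    have m: "cyl D c \<in> sets SM" "cyl D id \<in> sets SM" using D by (auto intro: cyl_in_SM)
    have i: "integrable \<nu> (indicator (cyl D c) :: 'd perm \<Rightarrow> real)" "integrable \<nu> (indicator (cyl D id) :: 'd perm \<Rightarrow> real)"
      using m by (auto simp: s emeasure_eq_measure intro!: integrable_real_indicator)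
    have "measure \<nu> (cyl D c) = (\<integral>\<xi>. real_cond_exp \<nu> (Fout D) (indicator (cyl D c)) \<xi> \<partial>\<nu>)"
      using real_cond_exp_int(2)[OF i(1)] m(1) by (simp add: s sets.Int_space_eq2)
    also have "\<dots> = (\<integral>\<xi>. w c * real_cond_exp \<nu> (Fout D) (indicator (cyl D id)) \<xi> \<partial>\<nu>)"
    proof (rule integral_cong_AE)
      have "AE \<xi> in \<nu>. real_cond_exp \<nu> (Fout D) (indicator (cyl D c)) \<xi> = measure (Gspec \<alpha> V D \<xi>) (cyl D c)"
           "AE \<xi> in \<nu>. real_cond_exp \<nu> (Fout D) (indicator (cyl D id)) \<xi> = measure (Gspec \<alpha> V D \<xi>) (cyl D id)"
        using g D m unfolding gibbs_def by blast+
      then show "AE \<xi> in \<nu>. real_cond_exp \<nu> (Fout D) (indicator (cyl D c)) \<xi> =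
           w c * real_cond_exp \<nu> (Fout D) (indicator (cyl D id)) \<xi>"
        using AE_space
      proof eventually_elim
        case (elim \<xi>)
        then show ?case
          using measure_Gspec_toggle[where V=V, OF V0 D _ D c(1) c(2) c(2), of \<xi>] by (simp add: sp)
      qed
    qed auto
    also have "\<dots> = w c * measure \<nu> (cyl D id)"
      using real_cond_exp_int(2)[OF i(2)] m(2) by (simp add: s sets.Int_space_eq2)
    finally show ?thesis .
  qed
  have vs: "void_system UNIV (\<lambda>A. measure \<nu> (cyl A id))"
    by (rule void_system_of_measure[OF p s fc tog]) simp_all
  show ?thesis
  proof (rule mu_eqI[OF p s])
    show "AE \<sigma> in \<nu>. \<sigma> \<in> fin_orbs"
      using fc AE_space by eventually_elim (simp add: sp finite_cycle_perm_fin_orbs)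
    show "measure \<nu> (cyl D \<tau>) = w \<tau> * void_lim D" if "finite D" "\<tau> permutes D" for D \<tau>
      using tog[OF that(1) permutes_bij[OF that(2)] csupp_permutes[OF that(2)]]
        void_unique[OF vs void_system_lim that(1)] by simp
  qed
qed

text \<open>Translated void probabilities solve the same recursion, so uniqueness identifies them
  with the original ones.\<close>

lemma void_lim_tr:
  assumes "finite A" shows "void_lim (tr z ` A) = void_lim A"
proof (rule void_unique[OF _ void_system_lim assms])
  note r = void_system_lim
  show "void_system UNIV (\<lambda>A. void_lim (tr z ` A))"
    unfolding void_system_def
  proof (intro conjI allI impI)
    show "void_lim (tr z ` {}) = 1" using void_empty[OF r] by simp
    show "0 \<le> void_lim (tr z ` B)" if "finite B" for B using that by (intro void_nonneg[OF r]) auto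
    show "void_lim (tr z ` B) \<le> void_lim (tr z ` A)" if "finite B" "A \<subseteq> B" for A B
      using that by (intro void_mono[OF r]) auto
    fix A :: "'d site set" and x assume A: "finite A"
    have "((\<lambda>c. w c * void_lim (insert (tr z x) (tr z ` A) \<union> csupp c)) has_sum void_lim (tr z ` A))
        {c \<in> choice (tr z x) (tr z ` A). csupp c \<subseteq> UNIV}"
      using r[unfolded void_system_def, THEN conjunct2, THEN conjunct2, rule_format, of "tr z ` A" "tr z x"] A by simp
    then have "((\<lambda>c. w (shift z c) * void_lim (insert (tr z x) (tr z ` A) \<union> csupp (shift z c)))
        has_sum void_lim (tr z ` A)) (choice x A)"
      using has_sum_reindex_bij_betw[OF bij_betw_shift_choice[of z x A],
        of "\<lambda>c. w c * void_lim (insert (tr z x) (tr z ` A) \<union> csupp c)"] by simp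
    then show "((\<lambda>c. w c * void_lim (tr z ` (insert x A \<union> csupp c))) has_sum void_lim (tr z ` A))
        {c \<in> choice x A. csupp c \<subseteq> UNIV}"
      by (simp add: cweight_shift csupp_shift image_Un)
  qed
qed

lemma distr_shift_mu: "distr mu SM (shift z) = mu"
proof (rule mu_eqI)
  interpret prob_space mu by (rule prob_space_mu)
  have m: "shift z \<in> measurable mu SM" using measurable_shift[of z] by (simp cong: measurable_cong_sets)
  show "prob_space (distr mu SM (shift z))" by (rule prob_space_distr[OF m])
  show "AE \<sigma> in distr mu SM (shift z). \<sigma> \<in> fin_orbs"
  proof (subst AE_distr_iff[OF m])
    show "{x \<in> space SM. x \<in> fin_orbs} \<in> sets (SM :: 'd perm measure)"
      using fin_orbs_in_SM[where 'd='d] by (simp add: fin_orbs_def)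
    show "AE x in mu. shift z x \<in> fin_orbs" using AE_mu_fin_orbs by (simp add: shift_fin_orbs_iff)
  qed
  fix D \<tau> assume D: "finite D" "\<tau> permutes (D :: 'd site set)"
  have "measure (distr mu SM (shift z)) (cyl D \<tau>) = measure mu {\<sigma> \<in> Sperm. shift z \<sigma> \<in> cyl D \<tau>}"
    using D by (subst measure_distr[OF m]) (auto intro!: cyl_in_SM arg_cong[where f="measure mu"])
  also have "\<dots> = measure mu (cyl (tr (neg z) ` D) (shift (neg z) \<tau>))" unfolding shift_vimage_cyl ..
  also have "\<dots> = w \<tau> * void_lim D"
    using D by (simp add: measure_mu_icyl permutes_shift cweight_shift void_lim_tr)
  finally show "measure (distr mu SM (shift z)) (cyl D \<tau>) = w \<tau> * void_lim D" .
qed simp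

lemma measure_mu_shift:
  assumes "X \<in> sets SM" shows "measure mu {\<sigma> \<in> Sperm. shift z \<sigma> \<in> X} = measure mu X"
proof -
  have m: "shift z \<in> measurable mu SM" using measurable_shift[of z] by (simp cong: measurable_cong_sets)
  have "measure mu X = measure (distr mu SM (shift z)) X" by (simp add: distr_shift_mu)
  also have "\<dots> = measure mu {\<sigma> \<in> Sperm. shift z \<sigma> \<in> X}"
    by (subst measure_distr[OF m assms]) (auto intro!: arg_cong[where f="measure mu"])
  finally show ?thesis ..
qed

end

section \<open>Mixing and ergodicity\<close>

definition diag :: "nat \<Rightarrow> 'd site" where
  "diag n = (\<lambda>_. int n)"

lemma eventually_notin_tr_diag:
  assumes "finite D"
  shows "\<forall>\<^sub>F n in sequentially. y \<notin> tr (neg (diag n)) ` D"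
proof -
  have "\<forall>\<^sub>F n in sequentially. \<forall>x\<in>D. y \<noteq> tr (neg (diag n)) x"
  proof (rule eventually_ball_finite[OF assms], intro ballI)
    fix x assume "x \<in> D"
    \<comment> \<open>The index type is inhabited, so the diagonal translation does move sites;
      following one coordinate is enough.\<close>
    fix i :: 'a
    have "\<forall>\<^sub>F n in sequentially. int n \<noteq> x i - y i"
      by (rule eventually_sequentiallyI[of "Suc (nat (x i - y i))"]) linarith
    then show "\<forall>\<^sub>F n in sequentially. y \<noteq> tr (neg (diag n)) x"
      by eventually_elim (auto simp: tr_def neg_def diag_def)
  qed
  then show ?thesis by eventually_elim auto
qed

lemma cyl_Int_disjoint:
  assumes "\<tau> permutes D" "\<tau>' permutes D'" "D \<inter> D' = {}"
  shows "cyl D \<tau> \<inter> cyl D' \<tau>' = cyl (D \<union> D') (\<tau> \<circ> \<tau>')" "(\<tau> \<circ> \<tau>') permutes (D \<union> D')"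
proof -
  have 1: "(\<tau> \<circ> \<tau>') x = \<tau> x" if "x \<in> D" for x
  proof -
    have "x \<notin> D'" using that assms(3) by blast
    then show ?thesis using permutes_not_in[OF assms(2)] by simp
  qed
  have 2: "(\<tau> \<circ> \<tau>') x = \<tau>' x" if "x \<in> D'" for x
  proof -
    have "\<tau>' x \<notin> D" using permutes_in_image[OF assms(2), of x] that assms(3) by blast
    then show ?thesis using permutes_not_in[OF assms(1)] by simp
  qed
  show "cyl D \<tau> \<inter> cyl D' \<tau>' = cyl (D \<union> D') (\<tau> \<circ> \<tau>')"
    using 1 2 unfolding cyl_def by (auto simp del: comp_apply)
  show "(\<tau> \<circ> \<tau>') permutes (D \<union> D')"
    by (rule permutes_compose[OF permutes_subset[OF assms(2)] permutes_subset[OF assms(1)]]) auto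
qed

context cycle_gas
begin

text \<open>Adding \<open>D\<close> to the distant void set is compared with adding it to the empty
  one. The two environments agree off the distant set, so its complement serves as window and
  exhausts the lattice as the set recedes.\<close>

lemma void_lim_mixing:
  assumes D: "finite D" and D': "finite D'"
  shows "(\<lambda>n. void_lim (D \<union> tr (neg (diag n)) ` D')) \<longlonglongrightarrow> void_lim D * void_lim D'"
proof -
  note r = void_system_lim
  let ?D = "\<lambda>n. tr (neg (diag n)) ` D'"
  have pos: "0 < void_lim D" "0 < void_lim D'" "\<And>n. 0 < void_lim (?D n)" "\<And>n. 0 < void_lim (D \<union> ?D n)"
    using D D' by (auto intro!: void_pos[OF r])
  have "(\<lambda>n. ln (void_lim (D \<union> ?D n))) \<longlonglongrightarrow> ln (void_lim D) + ln (void_lim D')"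
  proof (rule tendstoI)
    fix e :: real assume e: "0 < e"
    have out: "\<forall>\<^sub>F n in sequentially. y \<in> - ?D n" for y
      using eventually_notin_tr_diag[OF D', of y] by simp
    obtain m where m: "\<forall>\<^sub>F n in sequentially. (\<Sum>y\<in>D. infl m (- ?D n) y) < e"
      using infl_sum_small[OF D out e] by auto
    have "\<forall>\<^sub>F n in sequentially. \<forall>y\<in>D. y \<notin> ?D n"
      using eventually_notin_tr_diag[OF D'] D by (intro eventually_ball_finite) auto
    then show "\<forall>\<^sub>F n in sequentially. dist (ln (void_lim (D \<union> ?D n))) (ln (void_lim D) + ln (void_lim D')) < e"
      using m
    proof eventually_elim
      case (elim n)
      have "\<bar>(ln (void_lim (?D n)) - ln (void_lim (?D n \<union> D))) - (ln (void_lim {}) - ln (void_lim ({} \<union> D)))\<bar>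
          \<le> (\<Sum>y\<in>D. infl m (- ?D n) y)"
        by (rule void_compare_set[OF r r]) (use elim D D' in auto)
      then have "\<bar>ln (void_lim D') - ln (void_lim (D \<union> ?D n)) + ln (void_lim D)\<bar> < e"
        using elim(2) by (simp add: void_empty[OF r] void_lim_tr[OF D'] Un_commute)
      then show ?case by (simp add: dist_real_def abs_minus_commute algebra_simps)
    qed
  qed
  then have "(\<lambda>n. exp (ln (void_lim (D \<union> ?D n)))) \<longlonglongrightarrow> exp (ln (void_lim D) + ln (void_lim D'))"
    by (intro tendsto_intros)
  then show ?thesis using pos by (simp add: exp_add)
qed

lemma shift_vimage_in_SM: "X \<in> sets SM \<Longrightarrow> {\<sigma> \<in> Sperm. shift z \<sigma> \<in> X} \<in> sets (SM :: 'd perm measure)"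
proof -
  assume X: "X \<in> sets (SM :: 'd perm measure)"
  have "{\<sigma> \<in> Sperm. shift z \<sigma> \<in> X} = shift z -` X \<inter> space SM" by auto
  then show ?thesis using measurable_sets[OF measurable_shift X] by simp
qed

text \<open>For two invariant cylinders with disjoint bases the weights multiply and the void
  probabilities decouple. Keeping the first event fixed, the second is extended to arbitrary events
  by induction.\<close>

lemma mu_mixing:
  assumes X: "X \<in> sets SM" and D: "finite D" and t: "\<tau> permutes D"
  shows "(\<lambda>n. measure mu (cyl D \<tau> \<inter> {\<sigma> \<in> Sperm. shift (diag n) \<sigma> \<in> X})) \<longlonglongrightarrow> measure mu (cyl D \<tau>) * measure mu X"
  using X
proof (induction rule: SM_induct_icyls)
  interpret prob_space mu by (rule prob_space_mu)
  let ?E = "cyl D \<tau>"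
  let ?S = "\<lambda>n X. {\<sigma> \<in> Sperm. shift (diag n) \<sigma> \<in> X}"
  have E: "?E \<in> sets SM" by (rule cyl_in_SM[OF D])
  have Ssets: "?S n X \<in> sets SM" if "X \<in> sets SM" for n and X :: "'d perm set"
    by (rule shift_vimage_in_SM[OF that])
  {
    case (icyl D' \<tau>')
    let ?D = "\<lambda>n. tr (neg (diag n)) ` D'"
    have "(\<lambda>n. w \<tau> * w \<tau>' * void_lim (D \<union> ?D n)) \<longlonglongrightarrow> w \<tau> * w \<tau>' * (void_lim D * void_lim D')"
      by (intro tendsto_intros void_lim_mixing D icyl)
    moreover have "\<forall>\<^sub>F n in sequentially. w \<tau> * w \<tau>' * void_lim (D \<union> ?D n) = measure mu (?E \<inter> ?S n (cyl D' \<tau>'))"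
    proof -
      have "\<forall>\<^sub>F n in sequentially. \<forall>y\<in>D. y \<notin> ?D n"
        using eventually_notin_tr_diag[OF icyl(1)] D by (intro eventually_ball_finite) auto
      then show ?thesis
      proof eventually_elim
        case (elim n)
        let ?t = "shift (neg (diag n)) \<tau>'"
        have t': "?t permutes ?D n" by (rule permutes_shift[OF icyl(2)])
        have disj: "D \<inter> ?D n = {}" using elim by auto
        note j = cyl_Int_disjoint[OF t t' disj]
        have fin: "finite (?D n)" using icyl(1) by simp
        have "w (\<tau> \<circ> ?t) = w \<tau> * w ?t"
          by (rule cweight_comp_disjoint)
             (use csupp_permutes[OF t] csupp_permutes[OF t'] finite_subset D fin disj permutes_bij[OF t'] in blast)+
        then show ?case
          unfolding shift_vimage_cyl j(1) using D fin j(2) by (simp add: measure_mu_icyl cweight_shift del: comp_apply)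
      qed
    qed
    ultimately have "(\<lambda>n. measure mu (?E \<inter> ?S n (cyl D' \<tau>'))) \<longlonglongrightarrow> w \<tau> * w \<tau>' * (void_lim D * void_lim D')"
      by (rule Lim_transform_eventually)
    then show ?case by (simp add: measure_mu_icyl D t icyl mult_ac)
  next
    case empty
    show ?case by simp
  next
    case (compl X)
    have eq: "measure mu (?E \<inter> ?S n (Sperm - X)) = measure mu ?E - measure mu (?E \<inter> ?S n X)" for n
    proof -
      have "?E \<inter> ?S n (Sperm - X) = ?E - (?E \<inter> ?S n X)" by (auto simp: shift_Sperm_iff cyl_def)
      then show ?thesis using E Ssets[OF compl(1)] by (simp add: finite_measure_Diff sets.Int)
    qed
    have "measure mu (Sperm - X) = 1 - measure mu X" using prob_compl[of X] compl(1) by simp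
    then have "measure mu ?E * measure mu (Sperm - X) = measure mu ?E - measure mu ?E * measure mu X"
      by (simp add: right_diff_distrib)
    then show ?case unfolding eq by (simp add: tendsto_diff[OF tendsto_const compl(2)])
  next
    case (union X)
    have hs: "((\<lambda>i. measure mu (?E \<inter> ?S n (X i))) has_sum measure mu (\<Union>i. ?E \<inter> ?S n (X i))) UNIV" for n
      by (rule has_sum_measure_UN)
         (use union(1) E Ssets[OF union(2)] in \<open>auto simp: disjoint_family_on_def\<close>)
    have eq: "(\<Union>i. ?E \<inter> ?S n (X i)) = ?E \<inter> ?S n (\<Union>i. X i)" for n by auto
    have hX: "((\<lambda>i. measure mu (X i)) has_sum measure mu (\<Union>i. X i)) UNIV"
      by (rule has_sum_measure_UN) (use union in auto)
    \<comment> \<open>Translation invariance bounds each summand by \<open>measure mu (X i)\<close>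
      for every \<open>n\<close>, which is the dominating series.\<close>
    have "(\<lambda>n. \<Sum>\<^sub>\<infinity>i. measure mu (?E \<inter> ?S n (X i))) \<longlonglongrightarrow> (\<Sum>\<^sub>\<infinity>i. measure mu ?E * measure mu (X i))"
    proof (rule tendsto_infsum_dominated[OF has_sum_imp_summable[OF hX]])
      show "\<forall>\<^sub>F n in sequentially. \<forall>i\<in>UNIV. \<bar>measure mu (?E \<inter> ?S n (X i))\<bar> \<le> measure mu (X i)"
      proof (intro always_eventually allI ballI)
        fix n i
        have "measure mu (?E \<inter> ?S n (X i)) \<le> measure mu (?S n (X i))"
          by (rule finite_measure_mono) (use Ssets[OF union(2)] in auto)
        then show "\<bar>measure mu (?E \<inter> ?S n (X i))\<bar> \<le> measure mu (X i)"
          by (simp add: measure_mu_shift[OF union(2)])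
      qed
    qed (rule union(3))
    moreover have "(\<Sum>\<^sub>\<infinity>i. measure mu ?E * measure mu (X i)) = measure mu ?E * measure mu (\<Union>i. X i)"
      using infsumI[OF hX] by (simp add: infsum_cmult_right')
    ultimately show ?case using infsumI[OF hs] unfolding eq by simp
  next
    case (null X)
    have "measure mu (?E \<inter> ?S n (X \<inter> fin_orbs)) = measure mu (?E \<inter> ?S n X)" for n
    proof (rule finite_measure_eq_AE)
      show "AE \<sigma> in mu. (\<sigma> \<in> ?E \<inter> ?S n (X \<inter> fin_orbs)) = (\<sigma> \<in> ?E \<inter> ?S n X)"
        using AE_mu_fin_orbs by eventually_elim (auto simp: shift_fin_orbs_iff)
      show "?E \<inter> ?S n (X \<inter> fin_orbs) \<in> sets mu" "?E \<inter> ?S n X \<in> sets mu"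
        using sets.Int[OF E Ssets[OF null(1)]] sets.Int[OF E Ssets[OF sets.Int[OF null(1) fin_orbs_in_SM]]]
        by (simp_all only: sets_mu)
    qed
    moreover have "measure mu (X \<inter> fin_orbs) = measure mu X"
      by (rule finite_measure_eq_AE) (use AE_mu_fin_orbs null(1) fin_orbs_in_SM in auto)
    ultimately show ?case using null(2) by simp
  }
qed

text \<open>For an invariant event the mixing sequence is constant, so the event is independent of
  every invariant cylinder, hence of every event, in particular of itself.\<close>

lemma ergodic_mu: "ergodic mu"
  unfolding ergodic_def
proof (intro conjI allI ballI impI)
  show "distr mu SM (shift z) = mu" for z by (rule distr_shift_mu)
  interpret prob_space mu by (rule prob_space_mu)
  fix A assume A: "A \<in> sets (SM :: 'd perm measure)" and inv: "\<forall>z. {\<sigma> \<in> Sperm. shift z \<sigma> \<in> A} = A"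
  have "measure mu (X \<inter> A) = measure mu X * measure mu A" if "X \<in> sets SM" for X
    using that
  proof (induction rule: SM_induct_icyls)
    case (icyl D \<tau>)
    have "(\<lambda>n::nat. measure mu (cyl D \<tau> \<inter> A)) \<longlonglongrightarrow> measure mu (cyl D \<tau>) * measure mu A"
      using mu_mixing[OF A icyl] inv by simp
    then show ?case by (simp add: LIMSEQ_const_iff)
  next
    case (compl X)
    have "(Sperm - X) \<inter> A = A - X \<inter> A" using sets.sets_into_space[OF A] by auto
    then have "measure mu ((Sperm - X) \<inter> A) = measure mu A - measure mu (X \<inter> A)"
      using A compl(1) by (simp add: finite_measure_Diff sets.Int)
    moreover have "measure mu (Sperm - X) = 1 - measure mu X" using prob_compl[of X] compl(1) by simp
    ultimately show ?case using compl(2) by (simp add: left_diff_distrib)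
  next
    case (union X)
    have "((\<lambda>i. measure mu (X i \<inter> A)) has_sum measure mu (\<Union>i. X i \<inter> A)) UNIV"
      by (rule has_sum_measure_UN) (use union A in \<open>auto simp: disjoint_family_on_def\<close>)
    moreover have "((\<lambda>i. measure mu (X i) * measure mu A) has_sum measure mu (\<Union>i. X i) * measure mu A) UNIV"
      by (intro has_sum_cmult_left has_sum_measure_UN) (use union in auto)
    ultimately have eq: "measure mu (\<Union>i. X i \<inter> A) = measure mu (\<Union>i. X i) * measure mu A"
      unfolding union(3) by (rule has_sum_unique)
    have un: "(\<Union>i. X i) \<inter> A = (\<Union>i. X i \<inter> A)" by auto
    show ?case unfolding un by (rule eq)
  next
    case (null X)
    have "measure mu (X \<inter> fin_orbs \<inter> A) = measure mu (X \<inter> A)"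
      by (rule finite_measure_eq_AE) (use AE_mu_fin_orbs null(1) A fin_orbs_in_SM in auto)
    moreover have "measure mu (X \<inter> fin_orbs) = measure mu X"
      by (rule finite_measure_eq_AE) (use AE_mu_fin_orbs null(1) fin_orbs_in_SM in auto)
    ultimately show ?case using null(2) by simp
  qed simp
  from this[OF A] have "measure mu A = measure mu A * measure mu A" by simp
  then have "measure mu A = 0 \<or> measure mu A = 1" by (metis mult_cancel_left1)
  then show "emeasure mu A = 0 \<or> emeasure mu A = 1" by (auto simp: emeasure_eq_measure)
qed

end

section \<open>The limiting measure is a Gibbs measure\<close>

lemma measurable_comp_right:
  assumes "bij \<pi>" shows "(\<lambda>\<xi>. \<xi> \<circ> \<pi>) \<in> measurable SM (SM :: ('d::finite) perm measure)"
proof (rule measurable_SM_I)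
  show "(\<lambda>\<xi>. \<xi> \<circ> \<pi>) \<in> space SM \<rightarrow> (Sperm :: 'd perm set)" using assms by (auto simp: Sperm_def intro: bij_comp)
  show "{\<xi> \<in> space SM. (\<xi> \<circ> \<pi>) x = y} \<in> sets (SM :: 'd perm measure)" for x y
    using sets_SM_value[of "\<pi> x" y] by simp
qed

lemma boltz_Ham_local: "(\<And>x. x \<in> \<Lambda> \<Longrightarrow> \<sigma> x = \<tau> x) \<Longrightarrow> boltz \<alpha> (Ham V \<Lambda> \<sigma>) = boltz \<alpha> (Ham V \<Lambda> \<tau>)"
  by (simp add: Ham_def cong: sum.cong)

lemma measurable_boltz_Ham:
  "finite \<Lambda> \<Longrightarrow> (\<lambda>\<sigma>. boltz \<alpha> (Ham V \<Lambda> \<sigma>)) \<in> borel_measurable (SM :: ('d::finite) perm measure)"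
  by (intro continuous_map_Stop_measurable continuous_map_Stop_local[where D=\<Lambda>])
     (auto intro: boltz_Ham_local)

lemma Fout_value: "x \<notin> \<Lambda> \<Longrightarrow> {\<sigma> \<in> Sperm. \<sigma> x = y} \<in> sets (Fout \<Lambda>)"
  unfolding sets_Fout by (rule sigma_sets.Basic) auto

lemma Fout_invariant:
  assumes "B \<in> sets (Fout \<Lambda>)" "\<pi> permutes \<Lambda>" "\<xi> \<in> Sperm"
  shows "\<xi> \<circ> \<pi> \<in> B \<longleftrightarrow> \<xi> \<in> B"
proof -
  have S: "\<xi> \<circ> \<pi> \<in> Sperm" using assms permutes_bij[OF assms(2)] by (auto simp: Sperm_def intro: bij_comp)
  have "B \<in> sigma_sets Sperm {{\<sigma> \<in> Sperm. \<sigma> x = y} | x y. x \<notin> \<Lambda>}" using assms(1) by (simp add: sets_Fout)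
  then show ?thesis
  proof (induction rule: sigma_sets.induct)
    case (Basic a)
    then obtain x y where "a = {\<sigma> \<in> Sperm. \<sigma> x = y}" "x \<notin> \<Lambda>" by auto
    then show ?case using S assms(3) permutes_not_in[OF assms(2)] by (simp add: comp_def)
  next
    case (Compl a)
    then show ?case using S assms(3) by blast
  qed (use S assms in auto)
qed

text \<open>The filling depends on \<open>\<xi>\<close> only through the set \<open>\<xi> ` \<Lambda>\<close>, which is the complement of the image of
  the sites outside \<open>\<Lambda>\<close>; this makes it measurable with respect to the outside.\<close>

definition refill :: "'d site set \<Rightarrow> 'd perm \<Rightarrow> 'd perm" where
  "refill \<Lambda> \<xi> x = (if x \<in> \<Lambda> then (SOME f. bij_betw f \<Lambda> (\<xi> ` \<Lambda>)) x else \<xi> x)"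

lemma refill_in_SL:
  assumes "\<xi> \<in> Sperm" shows "refill \<Lambda> \<xi> \<in> SL \<Lambda> \<xi>"
proof -
  have b: "bij \<xi>" using assms by (simp add: Sperm_def)
  let ?f = "SOME f. bij_betw f \<Lambda> (\<xi> ` \<Lambda>)"
  have "bij_betw \<xi> \<Lambda> (\<xi> ` \<Lambda>)" using b by (auto simp: bij_betw_def bij_def intro: inj_on_subset)
  then have "bij_betw ?f \<Lambda> (\<xi> ` \<Lambda>)" by (rule someI[of "\<lambda>f. bij_betw f \<Lambda> (\<xi> ` \<Lambda>)"])
  then have 1: "bij_betw (refill \<Lambda> \<xi>) \<Lambda> (\<xi> ` \<Lambda>)" by (rule bij_betw_cong[THEN iffD1, rotated]) (simp add: refill_def)
  have "bij_betw \<xi> (- \<Lambda>) (- \<xi> ` \<Lambda>)"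
    using b by (metis bij_betw_def bij_def bij_image_Compl_eq inj_on_subset subset_UNIV)
  then have 2: "bij_betw (refill \<Lambda> \<xi>) (- \<Lambda>) (- \<xi> ` \<Lambda>)" by (rule bij_betw_cong[THEN iffD1, rotated]) (simp add: refill_def)
  have "bij (refill \<Lambda> \<xi>)" using bij_betw_combine[OF 1 2] by simp
  then show ?thesis by (auto simp: SL_def Sperm_def refill_def)
qed

lemma image_eq_in_Fout:
  assumes "finite \<Lambda>"
  shows "{\<xi> \<in> Sperm. \<xi> ` \<Lambda> = B} \<in> sets (Fout (\<Lambda> :: ('d::finite) site set))"
proof (cases "finite B \<and> card B = card \<Lambda>")
  case True
  have eq: "(\<xi> ` \<Lambda> = B) \<longleftrightarrow> (\<forall>x. x \<notin> \<Lambda> \<longrightarrow> (\<forall>y. y \<in> B \<longrightarrow> \<xi> x \<noteq> y))" if x: "\<xi> \<in> Sperm" for \<xi>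
  proof
    assume "\<xi> ` \<Lambda> = B"
    then show "\<forall>x. x \<notin> \<Lambda> \<longrightarrow> (\<forall>y. y \<in> B \<longrightarrow> \<xi> x \<noteq> y)"
      using x by (auto simp: Sperm_def dest: bij_is_inj injD)
  next
    assume h: "\<forall>x. x \<notin> \<Lambda> \<longrightarrow> (\<forall>y. y \<in> B \<longrightarrow> \<xi> x \<noteq> y)"
    have "B \<subseteq> \<xi> ` \<Lambda>"
    proof
      fix y assume y: "y \<in> B"
      obtain x where "y = \<xi> x" using \<open>\<xi> \<in> Sperm\<close> by (auto simp: Sperm_def bij_def surj_def)
      then show "y \<in> \<xi> ` \<Lambda>" using h y by auto
    qed
    moreover have "card (\<xi> ` \<Lambda>) = card B"
      using True x by (auto simp: Sperm_def bij_def intro: card_image inj_on_subset)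
    ultimately show "\<xi> ` \<Lambda> = B" using assms by (metis card_subset_eq finite_imageI)
  qed
  have "{\<xi> \<in> space (Fout \<Lambda>). \<forall>x. x \<notin> \<Lambda> \<longrightarrow> (\<forall>y. y \<in> B \<longrightarrow> \<xi> x \<noteq> y)} \<in> sets (Fout \<Lambda>)"
  proof (intro sets.sets_Collect_countable_All)
    fix x show "{\<xi> \<in> space (Fout \<Lambda>). x \<notin> \<Lambda> \<longrightarrow> (\<forall>y. y \<in> B \<longrightarrow> \<xi> x \<noteq> y)} \<in> sets (Fout \<Lambda>)"
    proof (cases "x \<in> \<Lambda>")
      case False
      have "{\<xi> \<in> space (Fout \<Lambda>). \<forall>y. y \<in> B \<longrightarrow> \<xi> x \<noteq> y} \<in> sets (Fout \<Lambda>)"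
        by (intro sets.sets_Collect_countable_All sets.sets_Collect_imp sets.sets_Collect_neg sets.sets_Collect_const)
           (use Fout_value[OF False] in simp)
      then show ?thesis using False by simp
    qed (simp add: sets.top[of "Fout \<Lambda>", simplified])
  qed
  moreover have "{\<xi> \<in> Sperm. \<xi> ` \<Lambda> = B} = {\<xi> \<in> space (Fout \<Lambda>). \<forall>x. x \<notin> \<Lambda> \<longrightarrow> (\<forall>y. y \<in> B \<longrightarrow> \<xi> x \<noteq> y)}"
    unfolding space_Fout by (rule Collect_cong, rule conj_cong[OF refl], rule eq)
  ultimately show ?thesis by simp
next
  case False
  have "card (\<xi> ` \<Lambda>) = card \<Lambda>" if "\<xi> \<in> Sperm" for \<xi> :: "'d perm"
    using that by (auto simp: Sperm_def bij_def intro: card_image inj_on_subset)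
  then have e: "{\<xi> \<in> Sperm. \<xi> ` \<Lambda> = B} = {}" using False assms by auto
  show ?thesis unfolding e by simp
qed

lemma measurable_refill:
  assumes "finite \<Lambda>"
  shows "refill \<Lambda> \<in> measurable (Fout \<Lambda>) (SM :: ('d::finite) perm measure)"
proof (rule measurable_SM_I)
  show "refill \<Lambda> \<in> space (Fout \<Lambda>) \<rightarrow> Sperm" using refill_in_SL SL_subset by (auto simp: SL_def)
  fix x y :: "'d site"
  show "{\<xi> \<in> space (Fout \<Lambda>). refill \<Lambda> \<xi> x = y} \<in> sets (Fout \<Lambda>)"
  proof (cases "x \<in> \<Lambda>")
    case True
    have "{\<xi> \<in> space (Fout \<Lambda>). refill \<Lambda> \<xi> x = y} =
      (\<Union>B\<in>{B. finite B \<and> (SOME f. bij_betw f \<Lambda> B) x = y}. {\<xi> \<in> Sperm. \<xi> ` \<Lambda> = B})"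
      using True assms by (auto simp: refill_def)
    also have "\<dots> \<in> sets (Fout \<Lambda>)"
    proof (rule sets.countable_UN'')
      show "countable {B. finite B \<and> (SOME f. bij_betw f \<Lambda> B) x = y}"
        by (rule countable_subset[of _ "{B. finite B}"]) (auto simp: countable_Collect_finite)
    qed (rule image_eq_in_Fout[OF assms])
    finally show ?thesis .
  next
    case False
    then show ?thesis using Fout_value[OF False] by (simp add: refill_def)
  qed
qed

lemma integral_Gspec_id:
  assumes "finite \<Lambda>" "f \<in> borel_measurable (SM :: ('d::finite) perm measure)"
  shows "(\<integral>\<sigma>. f \<sigma> \<partial>Gspec \<alpha> V \<Lambda> id) = (\<Sum>\<sigma>\<in>SL \<Lambda> id. f \<sigma> * boltz \<alpha> (Ham V \<Lambda> \<sigma>)) / Zpart \<alpha> V \<Lambda> id"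
proof -
  let ?g = "\<lambda>\<sigma>. boltz \<alpha> (Ham V \<Lambda> \<sigma>) / Zpart \<alpha> V \<Lambda> id"
  let ?P = "point_measure (SL \<Lambda> (id :: 'd perm)) (\<lambda>\<sigma>. ennreal (?g \<sigma>))"
  have m: "(\<lambda>\<sigma>. \<sigma>) \<in> measurable ?P SM"
    using SL_subset[of \<Lambda> id] by (auto simp: measurable_def space_point_measure sets_point_measure)
  have "(\<integral>\<sigma>. f \<sigma> \<partial>Gspec \<alpha> V \<Lambda> id) = (\<integral>\<sigma>. f \<sigma> \<partial>?P)"
    unfolding Gspec_eq_distr[OF assms(1) id_Sperm(1)] by (rule integral_distr[OF m assms(2)])
  also have "\<dots> = (\<Sum>\<sigma>\<in>SL \<Lambda> id. ?g \<sigma> *\<^sub>R f \<sigma>)"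
    by (rule lebesgue_integral_point_measure_finite[OF finite_SL_id[OF assms(1)]])
       (simp add: boltz_nonneg Zpart_nonneg)
  finally show ?thesis by (simp add: sum_divide_distrib mult.commute)
qed

lemma measure_Gspec_comp:
  fixes \<xi> :: "('d::finite) perm"
  assumes "finite \<Lambda>" "\<xi> \<in> Sperm" "A \<in> sets SM"
  shows "measure (Gspec \<alpha> V \<Lambda> \<xi>) A =
    (\<Sum>\<pi>\<in>SL \<Lambda> id. indicator A (\<xi> \<circ> \<pi>) * boltz \<alpha> (Ham V \<Lambda> (\<xi> \<circ> \<pi>))) / (\<Sum>\<pi>\<in>SL \<Lambda> id. boltz \<alpha> (Ham V \<Lambda> (\<xi> \<circ> \<pi>)))"
proof -
  have "(\<Sum>\<sigma>\<in>SL \<Lambda> \<xi> \<inter> A. boltz \<alpha> (Ham V \<Lambda> \<sigma>)) = (\<Sum>\<sigma>\<in>SL \<Lambda> \<xi>. indicator A \<sigma> * boltz \<alpha> (Ham V \<Lambda> \<sigma>))"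
    using finite_SL[OF assms(1,2)] by (intro sum.mono_neutral_cong_left) (auto simp: indicator_def)
  also have "\<dots> = (\<Sum>\<pi>\<in>SL \<Lambda> id. indicator A (\<xi> \<circ> \<pi>) * boltz \<alpha> (Ham V \<Lambda> (\<xi> \<circ> \<pi>)))"
    unfolding SL_eq_image[OF assms(2)] by (subst sum.reindex[OF inj_on_comp_SL[OF assms(2)]]) (simp add: comp_def)
  moreover have "Zpart \<alpha> V \<Lambda> \<xi> = (\<Sum>\<pi>\<in>SL \<Lambda> id. boltz \<alpha> (Ham V \<Lambda> (\<xi> \<circ> \<pi>)))"
    unfolding Zpart_def SL_eq_image[OF assms(2)] by (subst sum.reindex[OF inj_on_comp_SL[OF assms(2)]]) (simp add: comp_def)
  ultimately show ?thesis unfolding measure_Gspec[OF assms] by simp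
qed

context cycle_gas
begin

section \<open>The exchange identity inside a fixed finite set\<close>

context
  fixes \<Lambda> :: "'d site set" assumes fin: "finite \<Lambda>"
begin

abbreviation en :: "'d perm \<Rightarrow> real" where "en \<sigma> \<equiv> boltz \<alpha> (Ham V \<Lambda> \<sigma>)"

lemma en_local_continuous:
  assumes "finite D" "\<And>x. x \<in> \<Lambda> \<Longrightarrow> \<pi> x \<in> D"
    and "\<And>\<sigma> \<tau>. \<sigma> \<in> Sperm \<Longrightarrow> \<tau> \<in> Sperm \<Longrightarrow> (\<And>x. x \<in> D \<Longrightarrow> \<sigma> x = \<tau> x) \<Longrightarrow> g \<sigma> = g \<tau>"
  shows "continuous_map Stop euclideanreal (\<lambda>\<sigma>. g \<sigma> * en (\<sigma> \<circ> \<pi>))"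
proof (rule continuous_map_Stop_local[OF assms(1)])
  fix \<sigma> \<tau> :: "'d perm" assume s: "\<sigma> \<in> Sperm" "\<tau> \<in> Sperm" "\<And>x. x \<in> D \<Longrightarrow> \<sigma> x = \<tau> x"
  have "en (\<sigma> \<circ> \<pi>) = en (\<tau> \<circ> \<pi>)" by (rule boltz_Ham_local) (use s(3) assms(2) in auto)
  then show "g \<sigma> * en (\<sigma> \<circ> \<pi>) = g \<tau> * en (\<tau> \<circ> \<pi>)" using assms(3)[OF s] by simp
qed

text \<open>Rearranging inside \<open>\<Lambda>\<close> leaves the energy of
  \<open>\<Delta> - \<Lambda>\<close> untouched. The resulting balance \<open>ex\<close> multiplies
  each side by the inner factor of the other, since a quotient could be 0 over 0.\<close>

lemma Gspec_exchange:
  assumes D: "finite \<Delta>" "\<Lambda> \<subseteq> \<Delta>" and p: "\<pi> permutes \<Lambda>" and g: "g \<in> borel_measurable SM"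
  shows "(\<integral>\<sigma>. g \<sigma> * en (\<sigma> \<circ> \<pi>) \<partial>Gspec \<alpha> V \<Delta> id) =
    (\<integral>\<sigma>. g (\<sigma> \<circ> inv \<pi>) * en (\<sigma> \<circ> inv \<pi>) \<partial>Gspec \<alpha> V \<Delta> id)"
proof -
  have bp: "bij \<pi>" "bij (inv \<pi>)" using permutes_bij[OF p] bij_imp_bij_inv by auto
  note m1 = measurable_comp_right[OF bp(1)] and m2 = measurable_comp_right[OF bp(2)]
  note me = measurable_boltz_Ham[OF fin, of \<alpha> V]
  have meas1: "(\<lambda>\<sigma>. g \<sigma> * en (\<sigma> \<circ> \<pi>)) \<in> borel_measurable SM"
    by (intro borel_measurable_times g measurable_compose[OF m1 me])
  have meas2: "(\<lambda>\<sigma>. g (\<sigma> \<circ> inv \<pi>) * en (\<sigma> \<circ> inv \<pi>)) \<in> borel_measurable SM"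
    by (intro borel_measurable_times measurable_compose[OF m2 g] measurable_compose[OF m2 me])
  have inv1: "inv \<pi> \<circ> \<pi> = id" "\<pi> \<circ> inv \<pi> = id" using permutes_inv_o[OF p] by auto
  have pD: "\<pi> permutes \<Delta>" "inv \<pi> permutes \<Delta>" using permutes_subset[OF p D(2)] permutes_inv by auto
  have bij: "bij_betw (\<lambda>\<sigma>. \<sigma> \<circ> \<pi>) (SL \<Delta> id) (SL \<Delta> id)"
    by (rule bij_betw_byWitness[where f'="\<lambda>\<sigma>. \<sigma> \<circ> inv \<pi>"])
       (auto simp: SL_id comp_assoc inv1 intro: permutes_compose pD)
  have ex: "en \<sigma> * boltz \<alpha> (Ham V \<Delta> (\<sigma> \<circ> \<pi>)) = en (\<sigma> \<circ> \<pi>) * boltz \<alpha> (Ham V \<Delta> \<sigma>)" for \<sigma>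
  proof -
    let ?e = "\<lambda>\<sigma> x. boltz \<alpha> (V (jump (\<sigma> x) x))"
    have split: "prod (?e \<rho>) \<Delta> = prod (?e \<rho>) \<Lambda> * prod (?e \<rho>) (\<Delta> - \<Lambda>)" for \<rho>
      using prod.subset_diff[OF D(2,1), of "?e \<rho>"] by (simp add: mult.commute)
    have "prod (?e (\<sigma> \<circ> \<pi>)) (\<Delta> - \<Lambda>) = prod (?e \<sigma>) (\<Delta> - \<Lambda>)"
      using permutes_not_in[OF p] by (intro prod.cong) auto
    then show ?thesis unfolding boltz_Ham split[of "\<sigma> \<circ> \<pi>"] split[of \<sigma>] by (simp add: mult_ac del: comp_apply)
  qed
  have "(\<Sum>\<sigma>\<in>SL \<Delta> id. (g (\<sigma> \<circ> inv \<pi>) * en (\<sigma> \<circ> inv \<pi>)) * boltz \<alpha> (Ham V \<Delta> \<sigma>)) =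
      (\<Sum>\<sigma>\<in>SL \<Delta> id. (g (\<sigma> \<circ> \<pi> \<circ> inv \<pi>) * en (\<sigma> \<circ> \<pi> \<circ> inv \<pi>)) * boltz \<alpha> (Ham V \<Delta> (\<sigma> \<circ> \<pi>)))"
    by (rule sum.reindex_bij_betw[OF bij, symmetric])
  also have "\<dots> = (\<Sum>\<sigma>\<in>SL \<Delta> id. (g \<sigma> * en (\<sigma> \<circ> \<pi>)) * boltz \<alpha> (Ham V \<Delta> \<sigma>))"
  proof (rule sum.cong[OF refl])
    fix \<sigma> :: "'d perm"
    have "\<sigma> \<circ> \<pi> \<circ> inv \<pi> = \<sigma>" by (simp add: comp_assoc inv1)
    then show "g (\<sigma> \<circ> \<pi> \<circ> inv \<pi>) * en (\<sigma> \<circ> \<pi> \<circ> inv \<pi>) * boltz \<alpha> (Ham V \<Delta> (\<sigma> \<circ> \<pi>)) =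
        g \<sigma> * en (\<sigma> \<circ> \<pi>) * boltz \<alpha> (Ham V \<Delta> \<sigma>)"
      using ex[of \<sigma>] by (simp only: mult.assoc)
  qed
  finally show ?thesis unfolding integral_Gspec_id[OF D(1) meas1] integral_Gspec_id[OF D(1) meas2] by simp
qed

lemma en_bounds: "0 \<le> en \<sigma>" "en \<sigma> \<le> 1"
  by (simp_all add: boltz_nonneg boltz_le_1 alpha_nonneg)

lemma mu_exchange_cyl:
  assumes A: "finite A" and p: "\<pi> permutes \<Lambda>"
  shows "(\<integral>\<sigma>. indicator (cyl A \<tau>) \<sigma> * en (\<sigma> \<circ> \<pi>) \<partial>mu) =
    (\<integral>\<sigma>. indicator (cyl A \<tau>) (\<sigma> \<circ> inv \<pi>) * en (\<sigma> \<circ> inv \<pi>) \<partial>mu)"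
proof -
  let ?F = "finite_subsets_at_top (UNIV :: 'd site set)"
  let ?g = "indicator (cyl A \<tau>) :: 'd perm \<Rightarrow> real"
  let ?D = "A \<union> \<Lambda>"
  have p': "inv \<pi> permutes \<Lambda>" by (rule permutes_inv[OF p])
  have loc: "?g \<sigma> = ?g \<rho>" if "\<sigma> \<in> Sperm" "\<rho> \<in> Sperm" "\<And>x. x \<in> A \<Longrightarrow> \<sigma> x = \<rho> x" for \<sigma> \<rho>
    using that by (auto simp: cyl_def indicator_def)
  have invD: "inv \<pi> x \<in> ?D" if "x \<in> ?D" for x
    using that permutes_in_image[OF p', of x] permutes_not_in[OF p', of x] by (cases "x \<in> \<Lambda>") auto
  have b: "bij (inv \<pi>)" using permutes_bij[OF p'] .
  have lim1: "((\<lambda>\<Delta>. \<integral>\<sigma>. ?g \<sigma> * en (\<sigma> \<circ> \<pi>) \<partial>Gspec \<alpha> V \<Delta> id) \<longlongrightarrow> (\<integral>\<sigma>. ?g \<sigma> * en (\<sigma> \<circ> \<pi>) \<partial>mu)) ?F"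
  proof (rule Gspec_integral_tendsto[where B=1])
    show "continuous_map Stop euclideanreal (\<lambda>\<sigma>. ?g \<sigma> * en (\<sigma> \<circ> \<pi>))"
    proof (rule en_local_continuous[where D="?D"])
      show "finite ?D" using A fin by simp
      show "\<pi> x \<in> ?D" if "x \<in> \<Lambda>" for x using that permutes_in_image[OF p] by auto
      show "?g \<sigma> = ?g \<rho>" if "\<sigma> \<in> Sperm" "\<rho> \<in> Sperm" "\<And>x. x \<in> ?D \<Longrightarrow> \<sigma> x = \<rho> x" for \<sigma> \<rho>
        by (rule loc[OF that(1,2)]) (simp add: that(3))
    qed
  qed (use en_bounds in \<open>auto simp: indicator_def\<close>)
  have lim2: "((\<lambda>\<Delta>. \<integral>\<sigma>. ?g (\<sigma> \<circ> inv \<pi>) * en (\<sigma> \<circ> inv \<pi>) \<partial>Gspec \<alpha> V \<Delta> id) \<longlongrightarrow>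
      (\<integral>\<sigma>. ?g (\<sigma> \<circ> inv \<pi>) * en (\<sigma> \<circ> inv \<pi>) \<partial>mu)) ?F"
  proof (rule Gspec_integral_tendsto[where B=1])
    show "continuous_map Stop euclideanreal (\<lambda>\<sigma>. ?g (\<sigma> \<circ> inv \<pi>) * en (\<sigma> \<circ> inv \<pi>))"
    proof (rule en_local_continuous[where D="?D"])
      fix \<sigma> \<rho> :: "'d perm" assume s: "\<sigma> \<in> Sperm" "\<rho> \<in> Sperm" "\<And>x. x \<in> ?D \<Longrightarrow> \<sigma> x = \<rho> x"
      show "?g (\<sigma> \<circ> inv \<pi>) = ?g (\<rho> \<circ> inv \<pi>)"
      proof (rule loc)
        show "\<sigma> \<circ> inv \<pi> \<in> Sperm" "\<rho> \<circ> inv \<pi> \<in> Sperm" using s(1,2) b by (auto simp: Sperm_def intro: bij_comp)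
        show "(\<sigma> \<circ> inv \<pi>) x = (\<rho> \<circ> inv \<pi>) x" if "x \<in> A" for x
          using s(3)[OF invD, of x] that by simp
      qed
    qed (use A fin invD in auto)
  qed (use en_bounds in \<open>auto simp: indicator_def\<close>)
  have "\<forall>\<^sub>F \<Delta> in ?F. (\<integral>\<sigma>. ?g \<sigma> * en (\<sigma> \<circ> \<pi>) \<partial>Gspec \<alpha> V \<Delta> id) =
      (\<integral>\<sigma>. ?g (\<sigma> \<circ> inv \<pi>) * en (\<sigma> \<circ> inv \<pi>) \<partial>Gspec \<alpha> V \<Delta> id)"
    unfolding eventually_finite_subsets_at_top
  proof (intro exI[of _ \<Lambda>] conjI allI impI)
    fix Y assume Y: "finite Y \<and> \<Lambda> \<subseteq> Y \<and> Y \<subseteq> UNIV"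
    have "?g \<in> borel_measurable SM" using cyl_in_SM[OF A] by simp
    then show "(\<integral>\<sigma>. ?g \<sigma> * en (\<sigma> \<circ> \<pi>) \<partial>Gspec \<alpha> V Y id) =
      (\<integral>\<sigma>. ?g (\<sigma> \<circ> inv \<pi>) * en (\<sigma> \<circ> inv \<pi>) \<partial>Gspec \<alpha> V Y id)"
      using Gspec_exchange[OF _ _ p] Y by blast
  qed (use fin in auto)
  from Lim_transform_eventually[OF lim1 this] show ?thesis
    using lim2 tendsto_unique[OF finite_subsets_at_top_neq_bot] by blast
qed

text \<open>Both sides integrate \<open>g\<close> against a finite measure, a density and an image
  of a density. By \<open>mu_exchange_cyl\<close> the two measures agree on cylinders, hence
  coincide.\<close>

lemma mu_exchange:
  assumes p: "\<pi> permutes \<Lambda>" and g: "g \<in> borel_measurable SM"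
  shows "(\<integral>\<^sup>+\<sigma>. g \<sigma> * ennreal (en (\<sigma> \<circ> \<pi>)) \<partial>mu) =
    (\<integral>\<^sup>+\<sigma>. g (\<sigma> \<circ> inv \<pi>) * ennreal (en (\<sigma> \<circ> inv \<pi>)) \<partial>mu)"
proof -
  interpret prob_space mu by (rule prob_space_mu)
  have bp: "bij \<pi>" "bij (inv \<pi>)" using permutes_bij[OF p] bij_imp_bij_inv by auto
  have cs: "measurable mu N = measurable SM N" "measurable N' mu = measurable N' SM" for N :: "'z measure" and N' :: "'y measure"
    by (simp_all cong: measurable_cong_sets)
  have m2: "(\<lambda>\<xi>. \<xi> \<circ> inv \<pi>) \<in> measurable mu SM" unfolding cs by (rule measurable_comp_right[OF bp(2)])
  have e1: "(\<lambda>\<sigma>. en (\<sigma> \<circ> \<pi>)) \<in> borel_measurable mu" and e2: "(\<lambda>\<sigma>. en (\<sigma> \<circ> inv \<pi>)) \<in> borel_measurable mu"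
    unfolding cs
    by (rule measurable_compose[OF measurable_comp_right[OF bp(1)] measurable_boltz_Ham[OF fin]],
        rule measurable_compose[OF measurable_comp_right[OF bp(2)] measurable_boltz_Ham[OF fin]])
  define m1 where "m1 = density mu (\<lambda>\<sigma>. ennreal (en (\<sigma> \<circ> \<pi>)))"
  define m2 where "m2 = distr (density mu (\<lambda>\<sigma>. ennreal (en (\<sigma> \<circ> inv \<pi>)))) SM (\<lambda>\<xi>. \<xi> \<circ> inv \<pi>)"
  have md: "(\<lambda>\<xi>. \<xi> \<circ> inv \<pi>) \<in> measurable (density mu (\<lambda>\<sigma>. ennreal (en (\<sigma> \<circ> inv \<pi>)))) SM"
    using m2 by simp
  have em1: "emeasure m1 X = (\<integral>\<^sup>+\<sigma>. ennreal (indicator X \<sigma> * en (\<sigma> \<circ> \<pi>)) \<partial>mu)" if X: "X \<in> sets SM" for X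
    unfolding m1_def using X e1
    by (subst emeasure_density) (auto intro!: nn_integral_cong simp: indicator_def)
  have em2: "emeasure m2 X = (\<integral>\<^sup>+\<sigma>. ennreal (indicator X (\<sigma> \<circ> inv \<pi>) * en (\<sigma> \<circ> inv \<pi>)) \<partial>mu)" if X: "X \<in> sets SM" for X
  proof -
    have "(\<lambda>\<xi>. \<xi> \<circ> inv \<pi>) -` X \<inter> Sperm \<in> sets mu" using measurable_sets[OF m2 X] by simp
    then show ?thesis
      unfolding m2_def using X e2 md
      by (subst emeasure_distr[OF md X], subst emeasure_density)
         (auto intro!: nn_integral_cong simp: indicator_def)
  qed
  have i1: "integrable mu (\<lambda>\<sigma>. indicator (cyl A \<tau>) \<sigma> * en (\<sigma> \<circ> \<pi>))" if "finite A" for A \<tau>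
  proof (rule integrable_const_bound[where B=1])
    have "(indicator (cyl A \<tau>) :: 'd perm \<Rightarrow> real) \<in> borel_measurable mu"
      using cyl_in_SM[OF that, of \<tau>] by (intro borel_measurable_indicator) simp
    then show "(\<lambda>\<sigma>. indicator (cyl A \<tau>) \<sigma> * en (\<sigma> \<circ> \<pi>)) \<in> borel_measurable mu"
      using e1 by (rule borel_measurable_times)
  qed (use en_bounds in \<open>auto simp: indicator_def\<close>)
  have i2: "integrable mu (\<lambda>\<sigma>. indicator (cyl A \<tau>) (\<sigma> \<circ> inv \<pi>) * en (\<sigma> \<circ> inv \<pi>))" if "finite A" for A \<tau>
  proof (rule integrable_const_bound[where B=1])
    have "(\<lambda>\<sigma>. indicator (cyl A \<tau>) (\<sigma> \<circ> inv \<pi>) :: real) \<in> borel_measurable mu"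
      by (rule measurable_compose[OF m2]) (use cyl_in_SM[OF that] in simp)
    then show "(\<lambda>\<sigma>. indicator (cyl A \<tau>) (\<sigma> \<circ> inv \<pi>) * en (\<sigma> \<circ> inv \<pi>)) \<in> borel_measurable mu"
      using e2 by (rule borel_measurable_times)
  qed (use en_bounds in \<open>auto simp: indicator_def\<close>)
  have "m1 = m2"
  proof (rule measure_eqI_cylinders)
    show "sets m1 = sets SM" "sets m2 = sets SM" by (simp_all add: m1_def m2_def)
    show "emeasure m1 (cyl D \<tau>) = emeasure m2 (cyl D \<tau>)" if D: "finite D" for D \<tau>
      unfolding em1[OF cyl_in_SM[OF D]] em2[OF cyl_in_SM[OF D]]
      using nn_integral_eq_integral[OF i1[OF D, of \<tau>]] nn_integral_eq_integral[OF i2[OF D, of \<tau>]] mu_exchange_cyl[OF D p, of \<tau>]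
      by (simp add: en_bounds del: comp_apply)
    have "emeasure m1 Sperm \<le> (\<integral>\<^sup>+\<sigma>. 1 \<partial>mu)"
    proof -
      have "emeasure m1 Sperm = (\<integral>\<^sup>+\<sigma>. ennreal (indicator Sperm \<sigma> * en (\<sigma> \<circ> \<pi>)) \<partial>mu)"
        using sets.top[of "SM :: 'd perm measure"] by (intro em1) simp
      also have "\<dots> \<le> (\<integral>\<^sup>+\<sigma>. 1 \<partial>mu)"
        by (intro nn_integral_mono) (auto simp: indicator_def en_bounds ennreal_le_1)
      finally show ?thesis .
    qed
    also have "\<dots> = 1" using emeasure_space_1 by simp
    finally show "emeasure m1 Sperm \<noteq> \<infinity>" by (auto simp: top_unique)
  qed
  have gm: "g \<in> borel_measurable mu" unfolding cs by (rule g)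
  have "(\<integral>\<^sup>+\<sigma>. g \<sigma> * ennreal (en (\<sigma> \<circ> \<pi>)) \<partial>mu) = (\<integral>\<^sup>+\<sigma>. g \<sigma> \<partial>m1)"
    unfolding m1_def using e1 gm by (subst nn_integral_density) (auto simp: mult.commute)
  also have "\<dots> = (\<integral>\<^sup>+\<sigma>. g \<sigma> \<partial>m2)" using \<open>m1 = m2\<close> by simp
  also have "\<dots> = (\<integral>\<^sup>+\<sigma>. g (\<sigma> \<circ> inv \<pi>) \<partial>density mu (\<lambda>\<sigma>. ennreal (en (\<sigma> \<circ> inv \<pi>))))"
    unfolding m2_def by (rule nn_integral_distr[OF md]) (use g in simp)
  also have "\<dots> = (\<integral>\<^sup>+\<sigma>. ennreal (en (\<sigma> \<circ> inv \<pi>)) * g (\<sigma> \<circ> inv \<pi>) \<partial>mu)"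
    by (rule nn_integral_density) (use e2 measurable_compose[OF m2 g] in auto)
  finally show ?thesis by (simp add: mult.commute)
qed

text \<open>Zero weight inside \<open>\<Lambda>\<close> is a local event, so its indicator is
  continuous, and it has probability 0 in every finite volume containing \<open>\<Lambda>\<close>.
  This keeps the normalisation away from 0 almost surely.\<close>

lemma AE_mu_en_pos: "AE \<sigma> in mu. 0 < en \<sigma>"
proof -
  interpret prob_space mu by (rule prob_space_mu)
  let ?F = "finite_subsets_at_top (UNIV :: 'd site set)"
  let ?f = "\<lambda>\<sigma>. if en \<sigma> = 0 then 1 else 0 :: real"
  have cont: "continuous_map Stop euclideanreal ?f"
    by (rule continuous_map_Stop_local[OF fin]) (metis boltz_Ham_local)
  have meas: "?f \<in> borel_measurable SM" by (rule continuous_map_Stop_measurable[OF cont])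
  have lim: "((\<lambda>\<Delta>. \<integral>\<sigma>. ?f \<sigma> \<partial>Gspec \<alpha> V \<Delta> id) \<longlongrightarrow> (\<integral>\<sigma>. ?f \<sigma> \<partial>mu)) ?F"
    by (rule Gspec_integral_tendsto[OF cont, where B=1]) auto
  have ev: "\<forall>\<^sub>F \<Delta> in ?F. (\<integral>\<sigma>. ?f \<sigma> \<partial>Gspec \<alpha> V \<Delta> id) = 0"
    unfolding eventually_finite_subsets_at_top
  proof (intro exI[of _ \<Lambda>] conjI allI impI)
    fix Y assume Y: "finite Y \<and> \<Lambda> \<subseteq> Y \<and> Y \<subseteq> UNIV"
    have "?f \<sigma> * boltz \<alpha> (Ham V Y \<sigma>) = 0" for \<sigma>
    proof (cases "en \<sigma> = 0")
      case True
      then obtain x where "x \<in> \<Lambda>" "boltz \<alpha> (V (jump (\<sigma> x) x)) = 0" using fin by (auto simp: boltz_Ham)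
      then have "boltz \<alpha> (Ham V Y \<sigma>) = 0" using Y by (auto simp: boltz_Ham)
      then show ?thesis by simp
    qed simp
    then have "(\<Sum>\<sigma>\<in>SL Y id. ?f \<sigma> * boltz \<alpha> (Ham V Y \<sigma>)) = 0" by (intro sum.neutral ballI)
    moreover have "finite Y" using Y by simp
    ultimately show "(\<integral>\<sigma>. ?f \<sigma> \<partial>Gspec \<alpha> V Y id) = 0" using integral_Gspec_id[OF _ meas, of Y \<alpha> V] by simp
  qed (use fin in auto)
  have "(\<integral>\<sigma>. ?f \<sigma> \<partial>mu) = 0"
    by (rule tendsto_unique[OF finite_subsets_at_top_neq_bot lim tendsto_eventually[OF ev]])
  moreover have "integrable mu ?f"
    by (rule integrable_const_bound[where B=1]) (use meas in \<open>auto cong: measurable_cong_sets\<close>)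
  ultimately have "AE \<sigma> in mu. ?f \<sigma> = 0"
    by (subst (asm) integral_nonneg_eq_0_iff_AE) auto
  then show ?thesis by eventually_elim (use en_bounds(1) in \<open>auto simp: less_le split: if_splits\<close>)
qed

definition sum_en :: "'d perm \<Rightarrow> real" where
  "sum_en \<xi> = (\<Sum>\<pi>\<in>SL \<Lambda> id. en (\<xi> \<circ> \<pi>))"

lemma sum_en_comp: "\<rho> permutes \<Lambda> \<Longrightarrow> sum_en (\<xi> \<circ> \<rho>) = sum_en \<xi>"
proof -
  assume r: "\<rho> permutes \<Lambda>"
  have inv1: "\<rho> \<circ> inv \<rho> = id" "inv \<rho> \<circ> \<rho> = id" using permutes_inv_o[OF r] by auto
  have "bij_betw (\<lambda>\<pi>. \<rho> \<circ> \<pi>) (SL \<Lambda> id) (SL \<Lambda> id)"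
    by (rule bij_betw_byWitness[where f'="\<lambda>\<pi>. inv \<rho> \<circ> \<pi>"])
       (auto simp: SL_id inv1 intro: permutes_compose r permutes_inv simp flip: comp_assoc)
  from sum.reindex_bij_betw[OF this, of "\<lambda>\<pi>. en (\<xi> \<circ> \<pi>)"] show ?thesis
    unfolding sum_en_def by (simp add: comp_assoc)
qed

lemma sum_en_pos: "0 < en \<xi> \<Longrightarrow> 0 < sum_en \<xi>"
proof -
  assume "0 < en \<xi>"
  moreover have "en (\<xi> \<circ> id) \<le> sum_en \<xi>"
    unfolding sum_en_def using finite_SL_id[OF fin] en_bounds by (intro member_le_sum) (auto simp: SL_def)
  ultimately show ?thesis by simp
qed

text \<open>For an outside event \<open>B\<close>, the constant 1 is spread as the sum of
  \<open>en (\<xi> \<circ> \<pi>) / sum_en \<xi>\<close> over \<pi>; exchanging term by term moves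
  \<pi> into the indicator of \<open>A\<close>, while \<open>B\<close> and \<open>sum_en\<close> are
  unaffected by rearrangement. What appears is the specification integrated over
  \<open>B\<close>.\<close>

lemma gibbs_mu_aux:
  assumes A: "A \<in> sets SM"
  shows "AE \<xi> in mu. real_cond_exp mu (Fout \<Lambda>) (indicator A) \<xi> = measure (Gspec \<alpha> V \<Lambda> \<xi>) A"
proof -
  interpret prob_space mu by (rule prob_space_mu)
  have cs: "measurable mu N = measurable SM N" for N :: "'z measure"
    by (simp cong: measurable_cong_sets)
  interpret finite_measure_subalgebra mu "Fout \<Lambda>"
    by unfold_locales (simp add: subalgebra_def sets_Fout_subset)
  define h where "h = (\<lambda>\<xi>. (\<Sum>\<pi>\<in>SL \<Lambda> id. indicator A (\<xi> \<circ> \<pi>) * en (\<xi> \<circ> \<pi>)) / sum_en \<xi>)"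
  have h_eq: "measure (Gspec \<alpha> V \<Lambda> \<xi>) A = h \<xi>" if "\<xi> \<in> Sperm" for \<xi>
    unfolding h_def sum_en_def by (rule measure_Gspec_comp[OF fin that A])
  have ps: "\<pi> permutes \<Lambda>" "bij \<pi>" if "\<pi> \<in> SL \<Lambda> id" for \<pi>
    using that permutes_bij by (auto simp: SL_id)
  have en_m: "(\<lambda>\<xi>. en (\<xi> \<circ> \<pi>)) \<in> borel_measurable SM" if "\<pi> \<in> SL \<Lambda> id" for \<pi>
    by (rule measurable_compose[OF measurable_comp_right[OF ps(2)[OF that]] measurable_boltz_Ham[OF fin]])
  have ind_m: "(\<lambda>\<xi>. indicator A (\<xi> \<circ> \<pi>) :: real) \<in> borel_measurable SM" if "\<pi> \<in> SL \<Lambda> id" for \<pi>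
    by (rule measurable_compose[OF measurable_comp_right[OF ps(2)[OF that]]]) (use A in simp)
  have sum_m: "sum_en \<in> borel_measurable SM"
    unfolding sum_en_def[abs_def] by (intro borel_measurable_sum en_m)
  have h_m: "h \<in> borel_measurable SM"
    unfolding h_def by (intro borel_measurable_divide borel_measurable_sum borel_measurable_times en_m ind_m sum_m)
  have h_bounds: "0 \<le> h \<xi>" "h \<xi> \<le> 1" for \<xi>
  proof -
    have 0: "0 \<le> sum_en \<xi>" unfolding sum_en_def by (intro sum_nonneg en_bounds)
    have "(\<Sum>\<pi>\<in>SL \<Lambda> id. indicator A (\<xi> \<circ> \<pi>) * en (\<xi> \<circ> \<pi>)) \<le> sum_en \<xi>"
      unfolding sum_en_def by (intro sum_mono) (auto simp: indicator_def en_bounds)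
    then show "h \<xi> \<le> 1" unfolding h_def using 0 by (cases "sum_en \<xi> = 0") (auto simp: divide_le_eq_1)
    show "0 \<le> h \<xi>" unfolding h_def using 0 by (intro divide_nonneg_nonneg sum_nonneg) (auto simp: en_bounds)
  qed
  \<comment> \<open>The specification depends on \<open>\<xi>\<close> only through its admissible
    fillings, and \<open>refill \<Lambda> \<xi>\<close> has the same ones while being measurable
    from the outside.\<close>
  have h_Fout: "h \<in> borel_measurable (Fout \<Lambda>)"
  proof -
    have "(\<lambda>\<xi>. h (refill \<Lambda> \<xi>)) \<in> borel_measurable (Fout \<Lambda>)"
      by (rule measurable_compose[OF measurable_refill[OF fin] h_m])
    moreover have "h (refill \<Lambda> \<xi>) = h \<xi>" if x: "\<xi> \<in> space (Fout \<Lambda>)" for \<xi>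
    proof -
      have xS: "\<xi> \<in> Sperm" using x by simp
      have r: "refill \<Lambda> \<xi> \<in> SL \<Lambda> \<xi>" by (rule refill_in_SL[OF xS])
      have rS: "refill \<Lambda> \<xi> \<in> Sperm" using r SL_subset by auto
      have "SL \<Lambda> (refill \<Lambda> \<xi>) = SL \<Lambda> \<xi>" using r by (auto simp: SL_def)
      then have "measure (Gspec \<alpha> V \<Lambda> (refill \<Lambda> \<xi>)) A = measure (Gspec \<alpha> V \<Lambda> \<xi>) A"
        by (simp add: measure_Gspec[OF fin _ A] xS rS Zpart_def)
      then show ?thesis using h_eq xS rS by simp
    qed
    ultimately show ?thesis using measurable_cong[of "Fout \<Lambda>" "\<lambda>\<xi>. h (refill \<Lambda> \<xi>)" h borel] by blast
  qed
  have "AE \<xi> in mu. real_cond_exp mu (Fout \<Lambda>) (indicator A) \<xi> = h \<xi>"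
  proof (rule real_cond_exp_charact)
    show "integrable mu (indicator A :: 'd perm \<Rightarrow> real)"
    proof (rule integrable_const_bound[where B=1])
      show "(indicator A :: 'd perm \<Rightarrow> real) \<in> borel_measurable mu" using A by (intro borel_measurable_indicator) simp
    qed (auto simp: indicator_def)
    show hi: "integrable mu h"
      by (rule integrable_const_bound[where B=1]) (use h_m h_bounds in \<open>auto simp: cs\<close>)
    show "h \<in> borel_measurable (Fout \<Lambda>)" by (rule h_Fout)
    fix B assume B: "B \<in> sets (Fout \<Lambda>)"
    have BS: "B \<in> sets SM" using B sets_Fout_subset by auto
    define G where "G = (\<lambda>\<xi>. ennreal (indicator (A \<inter> B) \<xi> / sum_en \<xi>))"
    have Gm: "G \<in> borel_measurable SM"
      unfolding G_def using A BS sum_m by (intro measurable_compose[OF _ measurable_ennreal] borel_measurable_divide) auto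
    have sum0: "0 \<le> sum_en \<xi>" for \<xi> unfolding sum_en_def by (intro sum_nonneg en_bounds)
    have "emeasure mu (A \<inter> B) = (\<integral>\<^sup>+\<xi>. indicator (A \<inter> B) \<xi> \<partial>mu)" using A BS by simp
    also have "\<dots> = (\<integral>\<^sup>+\<xi>. (\<Sum>\<pi>\<in>SL \<Lambda> id. G \<xi> * ennreal (en (\<xi> \<circ> \<pi>))) \<partial>mu)"
    proof (rule nn_integral_cong_AE)
      show "AE \<xi> in mu. indicator (A \<inter> B) \<xi> = (\<Sum>\<pi>\<in>SL \<Lambda> id. G \<xi> * ennreal (en (\<xi> \<circ> \<pi>)))"
        using AE_mu_en_pos
      proof eventually_elim
        case (elim \<xi>)
        have "(\<Sum>\<pi>\<in>SL \<Lambda> id. G \<xi> * ennreal (en (\<xi> \<circ> \<pi>))) = G \<xi> * ennreal (sum_en \<xi>)"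
          unfolding sum_en_def sum_ennreal[OF en_bounds(1), symmetric] by (rule sum_distrib_left[symmetric])
        also have "\<dots> = ennreal (indicator (A \<inter> B) \<xi> / sum_en \<xi> * sum_en \<xi>)"
          unfolding G_def using sum0 by (subst ennreal_mult') auto
        also have "\<dots> = indicator (A \<inter> B) \<xi>" using sum_en_pos[OF elim] by (auto simp: indicator_def)
        finally show ?case ..
      qed
    qed
    also have "\<dots> = (\<Sum>\<pi>\<in>SL \<Lambda> id. \<integral>\<^sup>+\<xi>. G \<xi> * ennreal (en (\<xi> \<circ> \<pi>)) \<partial>mu)"
      by (rule nn_integral_sum) (use Gm en_m in \<open>auto simp: cs\<close>)
    also have "\<dots> = (\<Sum>\<pi>\<in>SL \<Lambda> id. \<integral>\<^sup>+\<xi>. G (\<xi> \<circ> inv \<pi>) * ennreal (en (\<xi> \<circ> inv \<pi>)) \<partial>mu)"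
      by (rule sum.cong[OF refl], rule mu_exchange[OF ps(1) Gm])
    also have "\<dots> = (\<Sum>\<pi>\<in>SL \<Lambda> id. \<integral>\<^sup>+\<xi>. G (\<xi> \<circ> \<pi>) * ennreal (en (\<xi> \<circ> \<pi>)) \<partial>mu)"
    \<comment> \<open>Inversion permutes the index set, so the inverses created by the exchange
      disappear from the sum.\<close>
    proof (rule sum.reindex_bij_betw)
      show "bij_betw inv (SL \<Lambda> id) (SL \<Lambda> id)"
        by (rule bij_betw_byWitness[where f'=inv])
           (auto simp: SL_id permutes_inv permutes_inv_inv)
    qed
    also have "\<dots> = (\<integral>\<^sup>+\<xi>. (\<Sum>\<pi>\<in>SL \<Lambda> id. G (\<xi> \<circ> \<pi>) * ennreal (en (\<xi> \<circ> \<pi>))) \<partial>mu)"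
    proof (rule nn_integral_sum[symmetric])
      fix \<pi> :: "'d perm" assume p: "\<pi> \<in> SL \<Lambda> id"
      show "(\<lambda>\<xi>. G (\<xi> \<circ> \<pi>) * ennreal (en (\<xi> \<circ> \<pi>))) \<in> borel_measurable mu"
        unfolding cs
        by (intro borel_measurable_times_ennreal measurable_compose[OF en_m[OF p] measurable_ennreal]
             measurable_compose[OF measurable_comp_right[OF ps(2)[OF p]] Gm])
    qed
    also have "\<dots> = (\<integral>\<^sup>+\<xi>. ennreal (indicator B \<xi> * h \<xi>) \<partial>mu)"
    proof (rule nn_integral_cong)
      fix \<xi> assume "\<xi> \<in> space mu"
      then have x: "\<xi> \<in> Sperm" by simp
      have "(\<Sum>\<pi>\<in>SL \<Lambda> id. G (\<xi> \<circ> \<pi>) * ennreal (en (\<xi> \<circ> \<pi>))) =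
          (\<Sum>\<pi>\<in>SL \<Lambda> id. ennreal (indicator B \<xi> * (indicator A (\<xi> \<circ> \<pi>) * en (\<xi> \<circ> \<pi>)) / sum_en \<xi>))"
      proof (rule sum.cong[OF refl])
        fix \<pi> :: "'d perm" assume p: "\<pi> \<in> SL \<Lambda> id"
        have "indicator (A \<inter> B) (\<xi> \<circ> \<pi>) = (indicator B \<xi> * indicator A (\<xi> \<circ> \<pi>) :: real)"
          using Fout_invariant[OF B ps(1)[OF p] x] by (auto simp: indicator_def)
        then have "G (\<xi> \<circ> \<pi>) = ennreal (indicator B \<xi> * indicator A (\<xi> \<circ> \<pi>) / sum_en \<xi>)"
          unfolding G_def sum_en_comp[OF ps(1)[OF p]] by simp
        then show "G (\<xi> \<circ> \<pi>) * ennreal (en (\<xi> \<circ> \<pi>)) =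
            ennreal (indicator B \<xi> * (indicator A (\<xi> \<circ> \<pi>) * en (\<xi> \<circ> \<pi>)) / sum_en \<xi>)"
          using sum0[of \<xi>] en_bounds(1)[of "\<xi> \<circ> \<pi>"]
          by (simp add: ennreal_mult'[symmetric] mult.assoc del: comp_apply)
      qed
      also have "\<dots> = ennreal (\<Sum>\<pi>\<in>SL \<Lambda> id. indicator B \<xi> * (indicator A (\<xi> \<circ> \<pi>) * en (\<xi> \<circ> \<pi>)) / sum_en \<xi>)"
        by (rule sum_ennreal) (use sum0 en_bounds in auto)
      also have "\<dots> = ennreal (indicator B \<xi> * h \<xi>)"
        unfolding h_def by (simp add: sum_distrib_left sum_divide_distrib)
      finally show "(\<Sum>\<pi>\<in>SL \<Lambda> id. G (\<xi> \<circ> \<pi>) * ennreal (en (\<xi> \<circ> \<pi>))) = ennreal (indicator B \<xi> * h \<xi>)" .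
    qed
    also have "\<dots> = ennreal (\<integral>\<xi>. indicator B \<xi> * h \<xi> \<partial>mu)"
    proof (rule nn_integral_eq_integral)
      show "integrable mu (\<lambda>\<xi>. indicator B \<xi> * h \<xi>)"
        using integrable_mult_indicator[OF _ hi, of B] BS by simp
    qed (use h_bounds in auto)
    finally have "measure mu (A \<inter> B) = (\<integral>\<xi>. indicator B \<xi> * h \<xi> \<partial>mu)"
      using h_bounds by (simp add: emeasure_eq_measure)
    moreover have "(\<integral>\<xi>. indicator B \<xi> * indicator A \<xi> \<partial>mu) = measure mu (A \<inter> B)"
    proof -
      have "Sperm \<inter> (A \<inter> B) = A \<inter> B" using sets.sets_into_space[OF A] by auto
      then show ?thesis using A BS by (simp add: indicator_inter_arith[symmetric] Int_commute)
    qed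
    ultimately show "(\<integral>\<xi>\<in>B. indicator A \<xi> \<partial>mu) = (\<integral>\<xi>\<in>B. h \<xi> \<partial>mu)"
      by (simp add: set_lebesgue_integral_def)
  qed
  then show ?thesis using AE_space
    by eventually_elim (simp add: h_eq)
qed

end

lemma gibbs_mu: "gibbs \<alpha> V mu"
  unfolding gibbs_def using prob_space_mu gibbs_mu_aux by simp

end

section \<open>Linear growth of strictly convex potentials\<close>

text \<open>The effective domain of \<^term>\<open>F\<close> need not be a neighbourhood of the origin, nor need \<^term>\<open>F\<close> be lower
  semicontinuous. But on the span of \<^term>\<open>T\<close> the origin is interior to the domain, since \<^term>\<open>T\<close> spans
  this space positively. There \<^term>\<open>F\<close> is continuous, hence bounded away from 0 on a small sphere.\<close>

lemma strictly_convex_linear_growth: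
  fixes F :: "'a::euclidean_space \<Rightarrow> ennreal" and T :: "'a set"
  assumes sc: "\<And>x y t. x \<noteq> y \<Longrightarrow> 0 < t \<Longrightarrow> t < 1 \<Longrightarrow> F x < \<top> \<Longrightarrow> F y < \<top> \<Longrightarrow>
      F (t *\<^sub>R x + (1 - t) *\<^sub>R y) < ennreal t * F x + ennreal (1 - t) * F y"
    and F0: "F 0 = 0" and T: "\<And>v. v \<in> T \<Longrightarrow> F v < \<top>"
    and neg: "\<And>v. v \<in> T \<Longrightarrow> \<exists>(S :: 'b set) h. finite S \<and> (\<forall>s\<in>S. F (h s) < \<top>) \<and> - v = (\<Sum>s\<in>S. h s)"
    and lattice: "\<And>v. v \<in> T \<Longrightarrow> v = 0 \<or> 1 \<le> norm v"
  shows "\<exists>c>0. \<forall>v\<in>T. c * norm v \<le> enn2real (F v)"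
proof -
  define K where "K = {v. F v < \<top>}"
  define g where "g = (\<lambda>v. enn2real (F v))"
  have gF: "F v = ennreal (g v)" if "v \<in> K" for v using that by (simp add: g_def K_def)
  have g0: "0 \<le> g v" for v by (simp add: g_def)
  have cv: "F (u *\<^sub>R x + v *\<^sub>R y) \<le> ennreal (u * g x + v * g y)"
    if xy: "x \<in> K" "y \<in> K" and uv: "0 \<le> u" "0 \<le> v" "u + v = 1" for x y u v
  proof (cases "x = y \<or> u = 0 \<or> u = 1")
    case True
    then show ?thesis
    proof (elim disjE)
      assume "x = y"
      then have "u *\<^sub>R x + v *\<^sub>R y = x" using uv by (metis scaleR_add_left scaleR_one)
      moreover have "u * g x + v * g y = g x" using \<open>x = y\<close> uv by (metis distrib_right mult_1)
      ultimately show ?thesis using gF xy by simp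
    qed (use uv xy gF in auto)
  next
    case False
    have v: "v = 1 - u" using uv by simp
    have "F (u *\<^sub>R x + (1 - u) *\<^sub>R y) < ennreal u * F x + ennreal (1 - u) * F y"
      using False uv xy by (intro sc) (auto simp: K_def)
    also have "\<dots> = ennreal (u * g x + v * g y)"
      using uv g0 gF xy by (simp add: v ennreal_mult ennreal_plus)
    finally show ?thesis by (simp add: v)
  qed
  have convK: "convex K"
    unfolding convex_def
  proof (intro ballI allI impI)
    fix x y u v assume "x \<in> K" "y \<in> K" "0 \<le> (u::real)" "0 \<le> v" "u + v = 1"
    then have "F (u *\<^sub>R x + v *\<^sub>R y) \<le> ennreal (u * g x + v * g y)" by (rule cv)
    also have "\<dots> < \<top>" by simp
    finally show "u *\<^sub>R x + v *\<^sub>R y \<in> K" by (simp add: K_def)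
  qed
  have conv: "convex_on K g"
    unfolding convex_on_def
  proof (intro conjI convK ballI allI impI)
    fix x y u v assume a: "x \<in> K" "y \<in> K" "0 \<le> (u::real)" "0 \<le> v" "u + v = 1"
    have "u *\<^sub>R x + v *\<^sub>R y \<in> K" using convexD[OF convK] a by blast
    then show "g (u *\<^sub>R x + v *\<^sub>R y) \<le> u * g x + v * g y"
      using cv[OF a] gF[of "u *\<^sub>R x + v *\<^sub>R y"] ennreal_le_iff[of "u * g x + v * g y"] a(3,4) g0[of x] g0[of y] by simp
  qed
  have zK: "0 \<in> K" "g 0 = 0" using F0 by (auto simp: K_def g_def)
  have down: "s *\<^sub>R v \<in> K" if "v \<in> K" "0 \<le> s" "s \<le> 1" for s v
    using convexD[OF convK that(1) zK(1), of s "1 - s"] that by simp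
  have gdown: "g (s *\<^sub>R v) \<le> s * g v" if "v \<in> K" "0 \<le> s" "s \<le> 1" for s v
    using conv that zK unfolding convex_on_def
    by (metis (no_types, opaque_lifting) add.right_neutral diff_ge_0_iff_ge le_add_diff_inverse mult_zero_right scaleR_zero_right)
  have gpos: "0 < g v" if v: "v \<in> K" "v \<noteq> 0" for v
  proof -
    have "F ((1/2) *\<^sub>R v + (1 - 1/2) *\<^sub>R 0) < ennreal (1/2) * F v + ennreal (1 - 1/2) * F 0"
      using v zK by (intro sc) (auto simp: K_def)
    then have "F v \<noteq> 0" using F0 by auto
    then show ?thesis using gF[OF v(1)] g0[of v] by (metis ennreal_0 less_le)
  qed
  \<comment> \<open>\<open>P\<close> is the convex cone of directions in which the domain extends
    from the origin; \<open>Q\<close> below is its largest linear subspace, and it contains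
    \<open>T\<close> because each \<open>- v\<close> is a sum of points of the domain.\<close>
  define P where "P = {v. \<exists>s>0. s *\<^sub>R v \<in> K}"
  have KP: "K \<subseteq> P" unfolding P_def by (auto intro: exI[of _ 1])
  have Padd: "u + v \<in> P" if u: "u \<in> P" and v: "v \<in> P" for u v
  proof -
    obtain s where s: "s > 0" "s *\<^sub>R u \<in> K" using u by (auto simp: P_def)
    obtain t where t: "t > 0" "t *\<^sub>R v \<in> K" using v by (auto simp: P_def)
    let ?m = "min s t"
    have "(?m / s) *\<^sub>R (s *\<^sub>R u) \<in> K" by (rule down) (use s t in auto)
    moreover have "(?m / t) *\<^sub>R (t *\<^sub>R v) \<in> K" by (rule down) (use s t in auto)
    ultimately have "?m *\<^sub>R u \<in> K" "?m *\<^sub>R v \<in> K" using s t by auto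
    from convexD[OF convK this, of "1/2" "1/2"] have "(?m / 2) *\<^sub>R (u + v) \<in> K"
      by (simp add: scaleR_add_right)
    then show ?thesis unfolding P_def using s t by (auto intro!: exI[of _ "?m / 2"])
  qed
  have Pscale: "c *\<^sub>R v \<in> P" if v: "v \<in> P" and c: "0 \<le> c" for c v
  proof (cases "c = 0")
    case True
    then show ?thesis using KP zK by auto
  next
    case False
    obtain s where "s > 0" "s *\<^sub>R v \<in> K" using v by (auto simp: P_def)
    then show ?thesis unfolding P_def using c False by (auto intro!: exI[of _ "s / c"])
  qed
  define Q where "Q = {v. v \<in> P \<and> - v \<in> P}"
  have "subspace Q"
    unfolding subspace_def
  proof (intro conjI ballI allI)
    show "0 \<in> Q" using KP zK by (auto simp: Q_def)
    show "x + y \<in> Q" if "x \<in> Q" "y \<in> Q" for x y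
      using that Padd[of x y] Padd[of "- x" "- y"] by (auto simp: Q_def)
    show "c *\<^sub>R x \<in> Q" if "x \<in> Q" for c x
    proof (cases "0 \<le> c")
      case True
      then show ?thesis using that Pscale[of x c] Pscale[of "- x" c] by (auto simp: Q_def)
    next
      case False
      then show ?thesis using that Pscale[of x "- c"] Pscale[of "- x" "- c"] by (auto simp: Q_def)
    qed
  qed
  moreover have "T \<subseteq> Q"
  proof
    fix v assume v: "v \<in> T"
    obtain S :: "'b set" and h where S: "finite S" "\<forall>s\<in>S. F (h s) < \<top>" "- v = (\<Sum>s\<in>S. h s)"
      using neg[OF v] by blast
    have "(\<Sum>s\<in>S'. h s) \<in> P" if "finite S'" "S' \<subseteq> S" for S'
      using that
    proof (induction S' rule: finite_induct)
      case empty
      then show ?case using KP zK by auto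
    next
      case (insert s S')
      have "h s \<in> P" using KP S(2) insert by (auto simp: K_def)
      then show ?case using insert Padd by simp
    qed
    then have "- v \<in> P" using S by simp
    then show "v \<in> Q" using T[OF v] KP by (auto simp: Q_def K_def)
  qed
  ultimately have LP: "span T \<subseteq> P" using span_minimal[of T Q] by (auto simp: Q_def)
  \<comment> \<open>A linear retraction \<open>p\<close> onto the span makes \<open>g\<close>
    composed with \<open>p\<close> live on a convex set \<open>W\<close> with the origin in its
    interior in the whole space, where a convex function is continuous.\<close>
  obtain B where B: "B \<subseteq> span T" "independent B" "span T \<subseteq> span B"
    using basis_exists[of "span T"] by metis
  obtain p :: "'a \<Rightarrow> 'a" where p: "linear p" "\<forall>x\<in>B. p x = x" "range p = span ((\<lambda>x. x) ` B)"
    using linear_independent_extend_subspace[OF B(2), of "\<lambda>x. x"] by blast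
  have spanB: "span B = span T" using B by (metis span_minimal span_superset subspace_span subset_antisym)
  have pL: "p v \<in> span T" for v using p(3) spanB by auto
  have pid: "p v = v" if "v \<in> span T" for v
    using linear_eq_on_span[OF p(1) linear_id, of B v] p(2) that spanB by simp
  define W where "W = {v. p v \<in> K}"
  have convW: "convex W"
    unfolding W_def convex_def using convexD[OF convK] by (simp add: linear_add[OF p(1)] linear_scale[OF p(1)])
  have zW: "0 \<in> W" using zK linear_0[OF p(1)] by (simp add: W_def)
  have "\<exists>s>0. \<forall>e\<in>E. s *\<^sub>R e \<in> W" if "finite E" for E :: "'a set"
    using that
  proof (induction E rule: finite_induct)
    case empty
    show ?case by (rule exI[of _ 1]) simp
  next
    case (insert e E)
    then obtain s where s: "s > 0" "\<forall>e\<in>E. s *\<^sub>R e \<in> W" by auto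
    obtain t where t: "t > 0" "t *\<^sub>R p e \<in> K" using LP pL[of e] by (auto simp: P_def)
    have te: "t *\<^sub>R e \<in> W" using t by (simp add: W_def linear_scale[OF p(1)])
    have downW: "c *\<^sub>R v \<in> W" if "v \<in> W" "0 \<le> c" "c \<le> 1" for c v
      using down[of "p v" c] that by (simp add: W_def linear_scale[OF p(1)])
    let ?m = "min s t"
    have "?m *\<^sub>R e' \<in> W" if e': "e' \<in> insert e E" for e'
    proof (cases "e' = e")
      case True
      have "(?m / t) *\<^sub>R (t *\<^sub>R e) \<in> W" by (rule downW[OF te]) (use s t in auto)
      then show ?thesis using t True by simp
    next
      case False
      then have "s *\<^sub>R e' \<in> W" using s e' by auto
      then have "(?m / s) *\<^sub>R (s *\<^sub>R e') \<in> W" by (rule downW) (use s t in auto)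
      then show ?thesis using s by simp
    qed
    then show ?case using s t by (intro exI[of _ ?m]) auto
  qed
  from this[of "Basis \<union> uminus ` Basis"] obtain s where s: "s > 0" "\<forall>e\<in>Basis \<union> uminus ` (Basis :: 'a set). s *\<^sub>R e \<in> W"
    by auto
  \<comment> \<open>A vector \<open>v\<close> is the average of the DIM points obtained by scaling
    its coordinates by the dimension. Below this radius they lie on the segments between the points
    \<open>s e\<close> and \<open>- s e\<close> of \<open>W\<close>.\<close>
  define \<delta> where "\<delta> = s / DIM('a)"
  have \<delta>: "\<delta> > 0" using s by (simp add: \<delta>_def)
  have ballW: "ball 0 \<delta> \<subseteq> W"
  proof
    fix v :: 'a assume "v \<in> ball 0 \<delta>"
    then have nv: "norm v < \<delta>" by simp
    have y: "(DIM('a) * (v \<bullet> e)) *\<^sub>R e \<in> W" if e: "e \<in> Basis" for e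
    proof -
      have "\<bar>v \<bullet> e\<bar> \<le> norm v" using e by (rule Basis_le_norm)
      then have "DIM('a) * \<bar>v \<bullet> e\<bar> \<le> DIM('a) * \<delta>" using nv by (intro mult_left_mono) auto
      then have ab: "\<bar>DIM('a) * (v \<bullet> e)\<bar> \<le> s" by (simp add: \<delta>_def abs_mult)
      define a where "a = DIM('a) * (v \<bullet> e) / s"
      have "\<bar>a\<bar> \<le> 1" using ab s by (simp add: a_def abs_divide)
      then have a: "- 1 \<le> a" "a \<le> 1" by auto
      have e1: "s *\<^sub>R e \<in> W" "s *\<^sub>R (- e) \<in> W" using s(2) e by blast+
      have "((1 + a) / 2) *\<^sub>R (s *\<^sub>R e) + ((1 - a) / 2) *\<^sub>R (s *\<^sub>R (- e)) \<in> W"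
        by (rule convexD[OF convW e1]) (use a in \<open>simp_all add: add_divide_distrib diff_divide_distrib\<close>)
      moreover have "((1 + a) / 2) *\<^sub>R (s *\<^sub>R e) + ((1 - a) / 2) *\<^sub>R (s *\<^sub>R (- e)) =
          ((1 + a) / 2 * s - (1 - a) / 2 * s) *\<^sub>R e"
        by (simp only: scaleR_minus_right scaleR_scaleR scaleR_diff_left) simp
      moreover have "(1 + a) / 2 * s - (1 - a) / 2 * s = a * s" by (simp add: field_simps)
      ultimately have "(a * s) *\<^sub>R e \<in> W" by simp
      then show ?thesis using s by (simp add: a_def)
    qed
    have "(\<Sum>e\<in>Basis. (1 / DIM('a)) *\<^sub>R ((DIM('a) * (v \<bullet> e)) *\<^sub>R e)) \<in> W"
      by (rule convex_sum[OF finite_Basis convW]) (use y in auto)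
    also have "(\<Sum>e\<in>Basis. (1 / DIM('a)) *\<^sub>R ((DIM('a) * (v \<bullet> e)) *\<^sub>R e)) = v"
      by (simp add: euclidean_representation)
    finally show "v \<in> W" .
  qed
  have "convex_on W (\<lambda>v. g (p v))"
    unfolding convex_on_def
    using conv convW by (auto simp: W_def convex_on_def linear_add[OF p(1)] linear_scale[OF p(1)])
  then have "convex_on (ball 0 \<delta>) (\<lambda>v. g (p v))" by (rule convex_on_subset[OF _ ballW convex_ball])
  then have cont: "continuous_on (ball 0 \<delta>) (\<lambda>v. g (p v))" by (rule convex_on_continuous[OF open_ball])
  \<comment> \<open>Below 1 as well, so that any nonzero vector of \<open>T\<close>, having norm at
    least 1, is shrunk when scaled to the sphere; convexity then compares values along the
    ray.\<close>
  define r where "r = min (\<delta> / 2) (1 / 2)"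
  have r: "0 < r" "r < \<delta>" "r < 1" using \<delta> by (auto simp: r_def)
  let ?S = "sphere 0 r \<inter> span T"
  have Sb: "?S \<subseteq> ball 0 \<delta>" using r by auto
  have comp: "compact ?S" by (intro compact_Int_closed compact_sphere closed_subspace subspace_span)
  have pos: "0 < g (p v)" if v: "v \<in> ?S" for v
  proof -
    have "v \<in> W" using Sb ballW v by blast
    then have "p v \<in> K" by (simp add: W_def)
    moreover have "v \<noteq> 0" using v r by auto
    ultimately show ?thesis using gpos pid v by auto
  qed
  have "\<exists>m>0. \<forall>v\<in>?S. m \<le> g (p v)"
  proof (cases "?S = {}")
    case False
    obtain v where v: "v \<in> ?S" "\<forall>u\<in>?S. g (p v) \<le> g (p u)"
      using continuous_attains_inf[OF comp False continuous_on_subset[OF cont Sb]] by blast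
    then show ?thesis using pos[OF v(1)] by (intro exI[of _ "g (p v)"]) simp
  next
    case True
    then show ?thesis by (intro exI[of _ 1]) auto
  qed
  then obtain m where m: "m > 0" "\<And>v. v \<in> ?S \<Longrightarrow> m \<le> g (p v)" by auto
  have "m / r * norm v \<le> g v" if v: "v \<in> T" for v
  proof (cases "v = 0")
    case True
    then show ?thesis by (simp add: g0)
  next
    case False
    then have n: "1 \<le> norm v" using lattice[OF v] by simp
    let ?t = "r / norm v"
    have t: "0 \<le> ?t" "?t \<le> 1" using r n by (simp, subst pos_divide_le_eq, auto)
    have vs: "?t *\<^sub>R v \<in> span T" using v by (intro span_scale span_base)
    moreover have "norm (?t *\<^sub>R v) = r" using r False by simp
    ultimately have "m \<le> g (p (?t *\<^sub>R v))" by (intro m) auto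
    also have "\<dots> = g (?t *\<^sub>R v)" using pid[OF vs] by simp
    also have "\<dots> \<le> ?t * g v" by (rule gdown) (use T[OF v] t in \<open>auto simp: K_def\<close>)
    finally show ?thesis using r False by (simp add: field_simps)
  qed
  moreover have "0 < m / r" using m r by simp
  ultimately show ?thesis unfolding g_def by blast
qed

lemma sum_jump_finite_cycle:
  assumes "is_finite_cycle \<gamma>"
  shows "(\<Sum>y\<in>csupp \<gamma>. jump (\<gamma> y) y i) = 0"
proof -
  have "(\<Sum>y\<in>csupp \<gamma>. \<gamma> y i) = (\<Sum>y\<in>csupp \<gamma>. y i)"
    using sum.permute[OF finite_cycle_permutes[OF assms], of "\<lambda>y. y i"] by (simp add: comp_def)
  then show ?thesis by (simp add: jump_def sum_subtractf)
qed

text \<open>The jumps around a cycle sum to 0, so the opposite of one jump is the sum of the others,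
  all of finite potential when the cycle has finite energy. This is the positive spanning that the
  growth bound asks for; the energy dominates the potential of each jump.\<close>

lemma cycle_energy_ge_jump:
  fixes V :: "('d::finite) site \<Rightarrow> ennreal"
  assumes "strictly_convex_pot V" "V (\<lambda>_. 0) = 0"
  shows "\<exists>c>0. \<forall>\<gamma> x i. is_finite_cycle \<gamma> \<longrightarrow> x \<in> csupp \<gamma> \<longrightarrow> (\<Sum>y\<in>csupp \<gamma>. V (jump (\<gamma> y) y)) < \<top> \<longrightarrow>
     c * \<bar>real_of_int (\<gamma> x i - x i)\<bar> \<le> enn2real (\<Sum>y\<in>csupp \<gamma>. V (jump (\<gamma> y) y))"
proof -
  obtain f :: "('d \<Rightarrow> real) \<Rightarrow> ennreal" where
    sc: "\<And>x y t. x \<noteq> y \<Longrightarrow> 0 < t \<Longrightarrow> t < 1 \<Longrightarrow> f x < \<top> \<Longrightarrow> f y < \<top> \<Longrightarrow>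
        f (\<lambda>i. t * x i + (1 - t) * y i) < ennreal t * f x + ennreal (1 - t) * f y"
    and Vf: "\<And>z. V z = f (\<lambda>i. real_of_int (z i))"
    using assms(1) unfolding strictly_convex_pot_def by blast
  define F where "F = (\<lambda>v :: real ^ 'd. f (\<lambda>i. v $ i))"
  define emb where "emb = (\<lambda>z :: 'd site. (\<chi> i. real_of_int (z i)) :: real ^ 'd)"
  have FV: "F (emb z) = V z" for z
  proof -
    have "(\<lambda>i. emb z $ i) = (\<lambda>i. real_of_int (z i))" by (simp add: emb_def fun_eq_iff)
    then show ?thesis unfolding F_def Vf by (rule arg_cong)
  qed
  define T where "T = {emb (jump (\<gamma> x) x) | \<gamma> x. is_finite_cycle \<gamma> \<and> x \<in> csupp \<gamma> \<and>
      (\<Sum>y\<in>csupp \<gamma>. V (jump (\<gamma> y) y)) < \<top>}"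
  have fin: "V (jump (\<gamma> y) y) < \<top>"
    if "is_finite_cycle \<gamma>" "(\<Sum>y\<in>csupp \<gamma>. V (jump (\<gamma> y) y)) < \<top>" "y \<in> csupp \<gamma>" for \<gamma> y
    using le_less_trans[OF member_le_sum[OF that(3), of "\<lambda>y. V (jump (\<gamma> y) y)"] that(2)] finite_csupp[OF that(1)]
    by simp
  have "\<exists>c>0. \<forall>v\<in>T. c * norm v \<le> enn2real (F v)"
  proof (rule strictly_convex_linear_growth[where F=F and T=T and 'b="'d site"])
    fix x y :: "real ^ 'd" and t :: real
    assume a: "x \<noteq> y" "0 < t" "t < 1" "F x < \<top>" "F y < \<top>"
    have "(\<lambda>i. x $ i) \<noteq> (\<lambda>i. y $ i)" using a(1) by (auto simp: vec_eq_iff fun_eq_iff)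
    from sc[OF this a(2,3)] a(4,5)
    have "f (\<lambda>i. t * x $ i + (1 - t) * y $ i) < ennreal t * F x + ennreal (1 - t) * F y" by (simp add: F_def)
    moreover have "(\<lambda>i. (t *\<^sub>R x + (1 - t) *\<^sub>R y) $ i) = (\<lambda>i. t * x $ i + (1 - t) * y $ i)" by simp
    ultimately show "F (t *\<^sub>R x + (1 - t) *\<^sub>R y) < ennreal t * F x + ennreal (1 - t) * F y" unfolding F_def by metis
  next
    show "F 0 = 0" using FV[of "\<lambda>_. 0"] assms(2) by (simp add: emb_def zero_vec_def)
  next
    fix v assume "v \<in> T"
    then obtain \<gamma> x where v: "v = emb (jump (\<gamma> x) x)" and g: "is_finite_cycle \<gamma>" "x \<in> csupp \<gamma>"
      "(\<Sum>y\<in>csupp \<gamma>. V (jump (\<gamma> y) y)) < \<top>" by (auto simp: T_def)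
    show "F v < \<top>" using fin[OF g(1,3,2)] by (simp add: v FV)
    have "(\<Sum>y\<in>csupp \<gamma>. emb (jump (\<gamma> y) y)) = 0"
    proof (subst vec_eq_iff, rule allI)
      fix i
      have "(\<Sum>y\<in>csupp \<gamma>. emb (jump (\<gamma> y) y)) $ i = real_of_int (\<Sum>y\<in>csupp \<gamma>. jump (\<gamma> y) y i)"
        by (simp add: emb_def)
      then show "(\<Sum>y\<in>csupp \<gamma>. emb (jump (\<gamma> y) y)) $ i = 0 $ i" by (simp add: sum_jump_finite_cycle[OF g(1)])
    qed
    then have "- v = (\<Sum>y\<in>csupp \<gamma> - {x}. emb (jump (\<gamma> y) y))"
      using sum.remove[OF finite_csupp[OF g(1)] g(2), of "\<lambda>y. emb (jump (\<gamma> y) y)"] by (simp add: v minus_unique)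
    then show "\<exists>(S :: 'd site set) h. finite S \<and> (\<forall>s\<in>S. F (h s) < \<top>) \<and> - v = (\<Sum>s\<in>S. h s)"
      using finite_csupp[OF g(1)] fin[OF g(1,3)]
      by (intro exI[of _ "csupp \<gamma> - {x}"] exI[of _ "\<lambda>y. emb (jump (\<gamma> y) y)"]) (auto simp: FV)
    show "v = 0 \<or> 1 \<le> norm v"
    proof (cases "v = 0")
      case False
      then obtain i where i: "v $ i \<noteq> 0" by (auto simp: vec_eq_iff)
      then have "1 \<le> \<bar>v $ i\<bar>" by (simp add: v emb_def flip: of_int_abs)
      then show ?thesis using component_le_norm_cart[of v i] by simp
    qed simp
  qed
  then obtain c where c: "c > 0" "\<And>v. v \<in> T \<Longrightarrow> c * norm v \<le> enn2real (F v)" by auto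
  show ?thesis
  proof (intro exI[of _ c] conjI allI impI c(1))
    fix \<gamma> x i
    assume g: "is_finite_cycle \<gamma>" "x \<in> csupp \<gamma>" "(\<Sum>y\<in>csupp \<gamma>. V (jump (\<gamma> y) y)) < \<top>"
    let ?v = "emb (jump (\<gamma> x) x)"
    have "\<bar>real_of_int (\<gamma> x i - x i)\<bar> = \<bar>?v $ i\<bar>" by (simp add: emb_def jump_def)
    also have "\<dots> \<le> norm ?v" by (rule component_le_norm_cart)
    finally have "c * \<bar>real_of_int (\<gamma> x i - x i)\<bar> \<le> c * norm ?v" using c(1) by simp
    also have "\<dots> \<le> enn2real (F ?v)" using g by (intro c(2)) (auto simp: T_def)
    also have "\<dots> \<le> enn2real (\<Sum>y\<in>csupp \<gamma>. V (jump (\<gamma> y) y))"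
      unfolding FV using g finite_csupp[OF g(1)]
      by (intro enn2real_mono member_le_sum[of x _ "\<lambda>y. V (jump (\<gamma> y) y)"]) auto
    finally show "c * \<bar>real_of_int (\<gamma> x i - x i)\<bar> \<le> enn2real (\<Sum>y\<in>csupp \<gamma>. V (jump (\<gamma> y) y))" .
  qed
qed

text \<open>With energy \<open>h\<close> and jump at most \<open>h / c\<close>, the estimate
  \<open>(\<alpha> - \<alpha>') * h \<le> exp ((\<alpha> - \<alpha>') * h)\<close> trades the jump
  length for a passage from \<alpha> to \<alpha>'.\<close>

lemma jump_weight_le:
  assumes c: "0 < c" "\<And>\<gamma> x i. is_finite_cycle \<gamma> \<Longrightarrow> x \<in> csupp \<gamma> \<Longrightarrow> (\<Sum>y\<in>csupp \<gamma>. V (jump (\<gamma> y) y)) < \<top> \<Longrightarrow>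
     c * \<bar>real_of_int (\<gamma> x i - x i)\<bar> \<le> enn2real (\<Sum>y\<in>csupp \<gamma>. V (jump (\<gamma> y) y))"
    and a: "\<alpha>' < \<alpha>" and g: "is_finite_cycle \<gamma>" "x \<in> csupp \<gamma>"
  shows "\<bar>real_of_int (\<gamma> x i - x i)\<bar> * cweight \<alpha> V \<gamma> \<le> 1 / (c * (\<alpha> - \<alpha>')) * cweight \<alpha>' V \<gamma>"
proof (cases "(\<Sum>y\<in>csupp \<gamma>. V (jump (\<gamma> y) y)) < \<top>")
  case True
  define h where "h = enn2real (\<Sum>y\<in>csupp \<gamma>. V (jump (\<gamma> y) y))"
  have w: "cweight a V \<gamma> = exp (- a * h)" for a using True by (simp add: cweight_def boltz_def h_def)
  have h0: "0 \<le> h" by (simp add: h_def)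
  have "\<bar>real_of_int (\<gamma> x i - x i)\<bar> \<le> h / c"
    using c(2)[OF g True, of i] c(1) by (simp add: h_def field_simps)
  then have "\<bar>real_of_int (\<gamma> x i - x i)\<bar> * exp (- \<alpha> * h) \<le> h / c * exp (- \<alpha> * h)" by (rule mult_right_mono) simp
  also have "\<dots> = 1 / (c * (\<alpha> - \<alpha>')) * (((\<alpha> - \<alpha>') * h) * exp (- \<alpha> * h))" using a c by (simp add: field_simps)
  also have "\<dots> \<le> 1 / (c * (\<alpha> - \<alpha>')) * (exp ((\<alpha> - \<alpha>') * h) * exp (- \<alpha> * h))"
  proof (intro mult_left_mono mult_right_mono)
    show "(\<alpha> - \<alpha>') * h \<le> exp ((\<alpha> - \<alpha>') * h)" using exp_ge_add_one_self[of "(\<alpha> - \<alpha>') * h"] by linarith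
  qed (use a c in auto)
  also have "exp ((\<alpha> - \<alpha>') * h) * exp (- \<alpha> * h) = exp (- \<alpha>' * h)" by (simp add: algebra_simps flip: exp_add)
  finally show ?thesis unfolding w .
next
  case False
  then have "(\<Sum>y\<in>csupp \<gamma>. V (jump (\<gamma> y) y)) = \<top>" using less_top by blast
  then show ?thesis by (simp add: cweight_def boltz_def)
qed

section \<open>The mean jump\<close>

context cycle_gas
begin

text \<open>Mass transport: each cycle spreads its jump at \<open>x\<close> evenly over its sites,
  and re-rooting turns this into the average of all jumps along the cycle, which is 0. Summability
  of the absolute values justifies the rearrangement.\<close>

lemma infsum_jump_zero:
  assumes js: "(\<lambda>\<gamma>. \<bar>real_of_int (\<gamma> x i - x i)\<bar> * w \<gamma>) summable_on through x"
  shows "(\<Sum>\<^sub>\<infinity>\<gamma>\<in>through x. real_of_int (\<gamma> x i - x i) * (w \<gamma> * void_lim (csupp \<gamma>))) = 0"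
proof -
  define q where "q = (\<lambda>\<gamma>. w \<gamma> * void_lim (csupp \<gamma>))"
  define f where "f = (\<lambda>\<gamma> (y :: 'd site). real_of_int (\<gamma> x i - x i) * q \<gamma> / card (csupp \<gamma>))"
  define z where "z = (\<lambda>y :: 'd site. \<lambda>j. x j - y j)"
  \<comment> \<open>Re-rooting: a cycle with a marked site \<open>y\<close> is translated so that
    \<open>y\<close> lands on \<open>x\<close>, and the old \<open>x\<close> becomes the mark. Doing
    it twice restores the pair.\<close>
  define \<phi> where "\<phi> = (\<lambda>(\<gamma> :: 'd perm, y). (shift (z y) \<gamma>, tr (z y) x))"
  let ?I = "Sigma (through x) csupp"
  note r = void_system_lim
  have q_bounds: "0 \<le> q \<gamma>" "q \<gamma> \<le> w \<gamma>" if "\<gamma> \<in> through x" for \<gamma>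
    using void_nonneg[OF r throughD(3)[OF that]] void_mono[OF r throughD(3)[OF that], of "{}"] void_empty[OF r] w_nonneg[of \<gamma>]
    by (auto simp: q_def mult_left_le)
  have card0: "card (csupp \<gamma>) \<noteq> 0" if "\<gamma> \<in> through x" for \<gamma>
    using card_csupp_ge_1[OF that] by simp
  have zx: "tr (z y) y = x" for y by (auto simp: tr_def z_def)
  have zz: "z (tr (z y) x) = neg (z y)" for y by (auto simp: tr_def z_def neg_def)
  have maps: "\<phi> p \<in> ?I" if p: "p \<in> ?I" for p
  proof -
    obtain \<gamma> y where p': "p = (\<gamma>, y)" "\<gamma> \<in> through x" "y \<in> csupp \<gamma>" using p by auto
    have "x \<in> tr (z y) ` csupp \<gamma>" using p'(3) zx[of y] by (metis imageI)
    then have "shift (z y) \<gamma> \<in> through x"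
      using p'(2) by (auto simp: through_def is_finite_cycle_shift csupp_shift)
    moreover have "tr (z y) x \<in> csupp (shift (z y) \<gamma>)"
      using throughD(2)[OF p'(2)] by (auto simp: csupp_shift)
    ultimately show ?thesis by (simp add: \<phi>_def p'(1))
  qed
  have invol: "\<phi> (\<phi> p) = p" for p
    by (cases p) (simp add: \<phi>_def zz, simp add: neg_def tr_def z_def)
  have bij: "bij_betw \<phi> ?I ?I"
    by (rule bij_betw_byWitness[where f'=\<phi>]) (use invol in simp, use invol in simp, (use maps in blast)+)
  have f\<phi>: "(case \<phi> p of (\<gamma>, y) \<Rightarrow> f \<gamma> y) =
      (case p of (\<gamma>, y) \<Rightarrow> real_of_int (jump (\<gamma> y) y i) * q \<gamma> / card (csupp \<gamma>))" if p: "p \<in> ?I" for p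
  proof -
    obtain \<gamma> y where p': "p = (\<gamma>, y)" "\<gamma> \<in> through x" using p by auto
    have "q (shift (z y) \<gamma>) = q \<gamma>"
      by (simp add: q_def cweight_shift csupp_shift void_lim_tr[OF throughD(3)[OF p'(2)]])
    moreover have "card (csupp (shift (z y) \<gamma>)) = card (csupp \<gamma>)"
      by (simp add: csupp_shift card_image inj_on_subset[OF inj_tr])
    moreover have "shift (z y) \<gamma> x i - x i = jump (\<gamma> y) y i"
    proof -
      have "shift (z y) \<gamma> x = tr (z y) (\<gamma> y)" using shift_tr[of "z y" \<gamma> y] zx[of y] by simp
      then show ?thesis by (simp add: tr_def z_def jump_def)
    qed
    ultimately show ?thesis by (simp add: \<phi>_def p'(1) f_def)
  qed
  have abs: "(\<lambda>p. norm (case p of (\<gamma>, y) \<Rightarrow> f \<gamma> y)) summable_on ?I"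
    unfolding Infinite_Sum.abs_summable_on_Sigma_iff
  proof (intro conjI ballI)
    fix \<gamma> assume g: "\<gamma> \<in> through x"
    show "(\<lambda>y. norm (case (\<gamma>, y) of (\<gamma>, y) \<Rightarrow> f \<gamma> y)) summable_on csupp \<gamma>"
      by (rule summable_on_finite[OF throughD(3)[OF g]])
  next
    have "(\<lambda>\<gamma>. \<bar>real_of_int (\<gamma> x i - x i)\<bar> * q \<gamma>) summable_on through x"
      by (rule summable_on_comparison_test[OF js]) (use q_bounds in \<open>auto intro: mult_left_mono\<close>)
    moreover have "(\<Sum>\<^sub>\<infinity>y\<in>csupp \<gamma>. norm (case (\<gamma>, y) of (\<gamma>, y) \<Rightarrow> f \<gamma> y)) = \<bar>real_of_int (\<gamma> x i - x i)\<bar> * q \<gamma>"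
      if g: "\<gamma> \<in> through x" for \<gamma>
      using throughD(3)[OF g] card0[OF g] q_bounds[OF g] by (simp add: f_def abs_mult)
    moreover have "0 \<le> \<bar>real_of_int (\<gamma> x i - x i)\<bar> * q \<gamma>" if "\<gamma> \<in> through x" for \<gamma>
      using q_bounds[OF that] by simp
    ultimately show "(\<lambda>\<gamma>. norm (\<Sum>\<^sub>\<infinity>y\<in>csupp \<gamma>. norm (case (\<gamma>, y) of (\<gamma>, y) \<Rightarrow> f \<gamma> y))) summable_on through x"
      by (simp cong: summable_on_cong)
  qed
  have summ: "(\<lambda>(\<gamma>, y). f \<gamma> y) summable_on ?I" by (rule abs_summable_summable[OF abs])
  have "(\<Sum>\<^sub>\<infinity>\<gamma>\<in>through x. real_of_int (\<gamma> x i - x i) * q \<gamma>) = (\<Sum>\<^sub>\<infinity>\<gamma>\<in>through x. infsum (f \<gamma>) (csupp \<gamma>))"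
    by (rule infsum_cong) (use throughD(3) card0 in \<open>simp add: f_def\<close>)
  also have "\<dots> = (\<Sum>\<^sub>\<infinity>(\<gamma>, y)\<in>?I. f \<gamma> y)" by (rule infsum_Sigma'_banach[OF summ])
  also have "\<dots> = (\<Sum>\<^sub>\<infinity>p\<in>?I. case \<phi> p of (\<gamma>, y) \<Rightarrow> f \<gamma> y)"
    by (rule infsum_reindex_bij_betw[OF bij, symmetric])
  also have "\<dots> = (\<Sum>\<^sub>\<infinity>(\<gamma>, y)\<in>?I. real_of_int (jump (\<gamma> y) y i) * q \<gamma> / card (csupp \<gamma>))"
    by (rule infsum_cong) (rule f\<phi>)
  also have "\<dots> = (\<Sum>\<^sub>\<infinity>\<gamma>\<in>through x. \<Sum>\<^sub>\<infinity>y\<in>csupp \<gamma>. real_of_int (jump (\<gamma> y) y i) * q \<gamma> / card (csupp \<gamma>))"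
  proof (rule infsum_Sigma'_banach[symmetric])
    have "(\<lambda>p. case \<phi> p of (\<gamma>, y) \<Rightarrow> f \<gamma> y) summable_on ?I"
      using summ by (simp add: summable_on_reindex_bij_betw[OF bij])
    then show "(\<lambda>(\<gamma>, y). real_of_int (jump (\<gamma> y) y i) * q \<gamma> / card (csupp \<gamma>)) summable_on ?I"
      by (rule summable_on_cong[THEN iffD1, rotated]) (rule f\<phi>)
  qed
  also have "\<dots> = (\<Sum>\<^sub>\<infinity>\<gamma>\<in>through x. 0)"
  proof (rule infsum_cong)
    fix \<gamma> assume g: "\<gamma> \<in> through x"
    have "(\<Sum>\<^sub>\<infinity>y\<in>csupp \<gamma>. real_of_int (jump (\<gamma> y) y i) * q \<gamma> / card (csupp \<gamma>)) =
        real_of_int (\<Sum>y\<in>csupp \<gamma>. jump (\<gamma> y) y i) * q \<gamma> / card (csupp \<gamma>)"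
      using throughD(3)[OF g] by (simp add: sum_distrib_right sum_divide_distrib)
    then show "(\<Sum>\<^sub>\<infinity>y\<in>csupp \<gamma>. real_of_int (jump (\<gamma> y) y i) * q \<gamma> / card (csupp \<gamma>)) = 0"
      by (simp add: sum_jump_finite_cycle[OF throughD(1)[OF g]])
  qed
  finally show ?thesis by (simp add: q_def)
qed

lemma mean_jump_zero_mu:
  assumes js: "\<And>x i. (\<lambda>\<gamma>. \<bar>real_of_int (\<gamma> x i - x i)\<bar> * w \<gamma>) summable_on through x"
  shows "mean_jump_zero mu"
  unfolding mean_jump_zero_def
proof (intro allI)
  fix x :: "'d site" and i :: 'd
  interpret prob_space mu by (rule prob_space_mu)
  let ?f = "\<lambda>\<sigma> :: 'd perm. real_of_int (\<sigma> x i - x i)"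
  define K where "K = {k \<in> codes TYPE('d). (code k :: 'd perm) \<in> through x}"
  define a where "a = (\<lambda>k. if k \<in> K then real_of_int ((code k :: 'd perm) x i - x i) else 0)"
  define E where "E = (\<lambda>k. cyl (csupp (code k)) (code k :: 'd perm))"
  \<comment> \<open>The displacement as a series over codes, one term per possible cycle at
    \<open>x\<close>, at most one of them nonzero. The set \<open>{\<sigma>. k \<in> K}\<close> is
    everything or empty and switches off the codes outside \<open>K\<close>.\<close>
  define f where "f = (\<lambda>k \<sigma>. a k * indicator (E k \<inter> {\<sigma>. k \<in> K}) \<sigma>)"
  have Kc: "bij_betw (code :: nat \<Rightarrow> 'd perm) K (through x)"
  proof -
    have "through x \<subseteq> (choices :: 'd perm set)" by (auto simp: choices_def through_def)
    then have "code ` K = through x"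
      using bij_betw_imp_surj_on[OF bij_betw_code[where 'd='d]] by (auto simp: K_def image_iff)
    moreover have "inj_on (code :: nat \<Rightarrow> 'd perm) K"
      using bij_betw_imp_inj_on[OF bij_betw_code[where 'd='d]] by (rule inj_on_subset) (auto simp: K_def)
    ultimately show ?thesis by (simp add: bij_betw_def)
  qed
  have E: "E k \<in> sets mu" if "k \<in> K" for k
    using that by (auto simp: E_def K_def throughD intro!: cyl_in_SM)
  have mE: "measure mu (E k) = w (code k) * void_lim (csupp (code k))" if "k \<in> K" for k
    using that measure_mu_icyl[OF throughD(3) finite_cycle_permutes[OF throughD(1)]] by (auto simp: E_def K_def)
  have E_cyc: "code k = cyc \<sigma> x" if "k \<in> K" "\<sigma> \<in> E k" for k \<sigma>
    using that cyc_unique(1)[of "code k" x \<sigma>] by (auto simp: E_def K_def through_def cyl_def)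
  have E_unique: "k = l" if "k \<in> K" "l \<in> K" "\<sigma> \<in> E k" "\<sigma> \<in> E l" for k l \<sigma>
    using E_cyc[OF that(1,3)] E_cyc[OF that(2,4)] bij_betw_imp_inj_on[OF Kc] that by (metis inj_onD)
  have point: "summable (\<lambda>k. norm (f k \<sigma>)) \<and> (\<sigma> \<in> fin_orbs \<longrightarrow> (\<Sum>k. f k \<sigma>) = ?f \<sigma>)" for \<sigma>
  proof (cases "\<exists>k\<in>K. \<sigma> \<in> E k")
    case True
    then obtain k where k: "k \<in> K" "\<sigma> \<in> E k" by auto
    have z: "f l \<sigma> = 0" if "l \<noteq> k" for l
      using E_unique[OF _ k(1) _ k(2), of l] that by (auto simp: f_def indicator_def)
    have "x \<in> csupp (code k :: 'd perm)" using k(1) by (auto simp: K_def throughD)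
    then have "\<sigma> x = code k x" using k(2) by (auto simp: E_def cyl_def)
    then have fk: "f k \<sigma> = ?f \<sigma>" using k by (simp add: f_def a_def indicator_def)
    have "(\<lambda>l. f l \<sigma>) sums (\<Sum>l\<in>{k}. f l \<sigma>)" by (rule sums_finite) (use z in auto)
    then have "(\<Sum>l. f l \<sigma>) = ?f \<sigma>" using fk by (simp add: sums_iff)
    moreover have "summable (\<lambda>l. norm (f l \<sigma>))" by (rule summable_finite[of "{k}"]) (use z in auto)
    ultimately show ?thesis by simp
  next
    case False
    then have z: "f l \<sigma> = 0" for l by (auto simp: f_def indicator_def)
    have "\<sigma> x = x" if s: "\<sigma> \<in> fin_orbs"
    proof (rule ccontr)
      assume n: "\<sigma> x \<noteq> x"
      have b: "bij \<sigma>" and fo: "finite (orb \<sigma> x)" using s by (auto simp: fin_orbs_def Sperm_def)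
      note cy = is_finite_cycle_cyc[OF b fo n]
      have "cyc \<sigma> x \<in> through x" using cy orb_self[of x \<sigma>] by (simp add: through_def)
      then obtain k where k: "k \<in> K" "code k = cyc \<sigma> x" using bij_betw_imp_surj_on[OF Kc] by (metis imageE)
      have "\<sigma> \<in> E k" unfolding E_def k(2) cy(2) using s by (auto simp: cyl_def cyc_def fin_orbs_def)
      then show False using False k(1) by auto
    qed
    then show ?thesis using z by simp
  qed
  have fint: "integrable mu (f k)" for k
  proof (cases "k \<in> K")
    case True
    then have "f k = (\<lambda>\<sigma>. a k * indicator (E k) \<sigma>)" by (auto simp: f_def)
    then show ?thesis using E[OF True] by (simp add: emeasure_eq_measure)
  qed (simp add: f_def[abs_def] a_def)
  have norm_int: "(\<integral>\<sigma>. norm (f k \<sigma>) \<partial>mu) = (if k \<in> K then \<bar>a k\<bar> * (w (code k) * void_lim (csupp (code k))) else 0)"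
    and int: "(\<integral>\<sigma>. f k \<sigma> \<partial>mu) = (if k \<in> K then a k * (w (code k) * void_lim (csupp (code k))) else 0)" for k
  proof -
    have "(\<integral>\<sigma>. norm (f k \<sigma>) \<partial>mu) = \<bar>a k\<bar> * measure mu (E k) \<and> (\<integral>\<sigma>. f k \<sigma> \<partial>mu) = a k * measure mu (E k)" if k: "k \<in> K"
    proof -
      have 1: "f k = (\<lambda>\<sigma>. a k * indicator (E k) \<sigma>)" using k by (auto simp: f_def)
      have 2: "(\<lambda>\<sigma>. norm (f k \<sigma>)) = (\<lambda>\<sigma>. \<bar>a k\<bar> * indicator (E k) \<sigma>)" unfolding 1 by (auto simp: abs_mult indicator_def)
      have 3: "E k \<inter> space mu = E k" using sets.sets_into_space[OF E[OF k]] by auto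
      show ?thesis unfolding 2 unfolding 1 using 3 by simp
    qed
    then show "(\<integral>\<sigma>. norm (f k \<sigma>) \<partial>mu) = (if k \<in> K then \<bar>a k\<bar> * (w (code k) * void_lim (csupp (code k))) else 0)"
      "(\<integral>\<sigma>. f k \<sigma> \<partial>mu) = (if k \<in> K then a k * (w (code k) * void_lim (csupp (code k))) else 0)"
      using mE by (auto simp: f_def a_def)
  qed
  let ?q = "\<lambda>\<gamma>. w \<gamma> * void_lim (csupp \<gamma>)"
  have q_bounds: "0 \<le> ?q \<gamma>" "?q \<gamma> \<le> w \<gamma>" if "\<gamma> \<in> through x" for \<gamma>
    using void_nonneg[OF void_system_lim throughD(3)[OF that]] void_mono[OF void_system_lim throughD(3)[OF that], of "{}"]
      void_empty[OF void_system_lim] w_nonneg[of \<gamma>] by (auto simp: mult_left_le)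
  have qs: "(\<lambda>\<gamma>. \<bar>real_of_int (\<gamma> x i - x i)\<bar> * ?q \<gamma>) summable_on through x"
    by (rule summable_on_comparison_test[OF js[of x i]]) (use q_bounds in \<open>auto intro: mult_left_mono\<close>)
  have "(\<lambda>k. \<bar>real_of_int ((code k :: 'd perm) x i - x i)\<bar> * ?q (code k)) summable_on K"
    using qs by (simp only: summable_on_reindex_bij_betw[OF Kc, of "\<lambda>\<gamma>. \<bar>real_of_int (\<gamma> x i - x i)\<bar> * ?q \<gamma>"])
  also have "?this \<longleftrightarrow> (\<lambda>k. \<integral>\<sigma>. norm (f k \<sigma>) \<partial>mu) summable_on UNIV"
    unfolding norm_int by (rule summable_on_cong_neutral) (auto simp: a_def)
  finally have sn: "summable (\<lambda>k. \<integral>\<sigma>. norm (f k \<sigma>) \<partial>mu)" by (rule summable_on_imp_summable)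
  have AEs: "AE \<sigma> in mu. summable (\<lambda>k. norm (f k \<sigma>))" using point by simp
  have AEf: "AE \<sigma> in mu. (\<Sum>k. f k \<sigma>) = ?f \<sigma>" using AE_mu_fin_orbs by eventually_elim (use point in simp)
  have fm: "?f \<in> borel_measurable mu"
  proof -
    have "?f \<in> borel_measurable SM"
      by (rule continuous_map_Stop_measurable, rule continuous_map_Stop_local[of "{x}"]) auto
    then show ?thesis by (simp cong: measurable_cong_sets)
  qed
  have isum: "integrable mu (\<lambda>\<sigma>. \<Sum>k. f k \<sigma>)" by (rule integrable_suminf[OF fint AEs sn])
  have "integrable mu ?f"
    by (rule integrable_cong_AE_imp[OF isum fm]) (use AEf in auto)
  moreover have "(\<integral>\<sigma>. ?f \<sigma> \<partial>mu) = 0"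
  proof -
    have "(\<lambda>k. \<integral>\<sigma>. f k \<sigma> \<partial>mu) sums (\<integral>\<sigma>. (\<Sum>k. f k \<sigma>) \<partial>mu)" by (rule sums_integral[OF fint AEs sn])
    moreover have "(\<lambda>k. \<integral>\<sigma>. f k \<sigma> \<partial>mu) sums 0"
    proof -
      have "(\<lambda>\<gamma>. real_of_int (\<gamma> x i - x i) * ?q \<gamma>) summable_on through x"
      proof (rule abs_summable_summable)
        show "(\<lambda>\<gamma>. norm (real_of_int (\<gamma> x i - x i) * ?q \<gamma>)) summable_on through x"
        proof (rule summable_on_cong[THEN iffD1, OF _ qs])
          fix \<gamma> assume "\<gamma> \<in> through x"
          then show "\<bar>real_of_int (\<gamma> x i - x i)\<bar> * ?q \<gamma> = norm (real_of_int (\<gamma> x i - x i) * ?q \<gamma>)"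
            using q_bounds(1) by (simp only: real_norm_def abs_mult[of "real_of_int (\<gamma> x i - x i)"] abs_of_nonneg)
        qed
      qed
      from has_sum_infsum[OF this] have "((\<lambda>\<gamma>. real_of_int (\<gamma> x i - x i) * ?q \<gamma>) has_sum 0) (through x)"
        unfolding infsum_jump_zero[OF js[of x i]] .
      then have "((\<lambda>k. real_of_int ((code k :: 'd perm) x i - x i) * ?q (code k)) has_sum 0) K"
        by (simp only: has_sum_reindex_bij_betw[OF Kc, of "\<lambda>\<gamma>. real_of_int (\<gamma> x i - x i) * ?q \<gamma>"])
      also have "?this \<longleftrightarrow> ((\<lambda>k. \<integral>\<sigma>. f k \<sigma> \<partial>mu) has_sum 0) UNIV"
        unfolding int by (rule has_sum_cong_neutral) (auto simp: a_def)
      finally show ?thesis by (rule has_sum_imp_sums)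
    qed
    ultimately have "(\<integral>\<sigma>. (\<Sum>k. f k \<sigma>) \<partial>mu) = 0" by (rule sums_unique2)
    moreover have "(\<integral>\<sigma>. ?f \<sigma> \<partial>mu) = (\<integral>\<sigma>. (\<Sum>k. f k \<sigma>) \<partial>mu)"
      by (rule integral_cong_AE[OF fm]) (use isum AEf in \<open>auto simp: eq_commute\<close>)
    ultimately show ?thesis by simp
  qed
  ultimately show "integrable mu ?f \<and> (\<integral>\<sigma>. ?f \<sigma> \<partial>mu) = 0" by simp
qed

end

section \<open>Driving the coupling by a single uniform variable\<close>

lemma cweight_antimono: "\<alpha>' \<le> \<alpha> \<Longrightarrow> cweight \<alpha> V \<gamma> \<le> cweight \<alpha>' V \<gamma>"
  by (auto simp: cweight_def boltz_def mult_right_mono)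

lemma beta_antimono:
  assumes "\<alpha>' \<le> \<alpha>" shows "beta V \<alpha> \<le> beta V \<alpha>'"
  unfolding beta_def
  by (subst (1 2) nonneg_infsum_complete)
     (auto intro!: SUP_mono' sum_mono mult_left_mono ennreal_leI cweight_antimono assms)

lemma alpha_star_lessE:
  assumes "ereal \<alpha> > alpha_star V"
  obtains \<alpha>' where "0 < \<alpha>'" "\<alpha>' < \<alpha>" "beta V \<alpha>' < 1"
proof -
  obtain y where "y \<in> {ereal a | a. 0 < a \<and> beta V a < 1}" "y < ereal \<alpha>"
    using assms unfolding alpha_star_def Inf_less_iff by blast
  then show ?thesis using that by auto
qed

text \<open>The sample space consists of real sequences. The seed sits in coordinate 0, and the
  sigma-algebra is pulled back along it, so that everything measurable is a function of the
  seed.\<close>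

definition one_seed :: "(nat \<Rightarrow> real) measure" where
  "one_seed = distr unit_measure (vimage_algebra {\<omega>. \<omega> 0 \<in> {0..<1}} (\<lambda>\<omega>. \<omega> 0) unit_measure) (\<lambda>u _. u)"

lemma measurable_const_seed:
  "(\<lambda>u _. u) \<in> measurable unit_measure (vimage_algebra {\<omega> :: nat \<Rightarrow> real. \<omega> 0 \<in> {0..<1}} (\<lambda>\<omega>. \<omega> 0) unit_measure)"
  by (rule measurable_vimage_algebra2) auto

lemma space_one_seed: "space one_seed = {\<omega>. \<omega> 0 \<in> {0..<1}}"
  by (simp add: one_seed_def)

lemma measurable_seed: "(\<lambda>\<omega>. \<omega> 0) \<in> measurable one_seed unit_measure"
proof -
  have "(\<lambda>\<omega>. \<omega> 0) \<in> measurable (vimage_algebra {\<omega> :: nat \<Rightarrow> real. \<omega> 0 \<in> {0..<1}} (\<lambda>\<omega>. \<omega> 0) unit_measure) unit_measure"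
    by (rule measurable_vimage_algebra1) auto
  then show ?thesis by (simp add: one_seed_def)
qed

lemma prob_space_one_seed: "prob_space one_seed"
proof -
  interpret prob_space unit_measure by (rule prob_space_unit_measure)
  show ?thesis unfolding one_seed_def by (rule prob_space_distr[OF measurable_const_seed])
qed

lemma distr_one_seed:
  assumes "f \<in> measurable unit_measure N"
  shows "distr one_seed N (\<lambda>\<omega>. f (\<omega> 0)) = distr unit_measure N f"
proof -
  have "(\<lambda>\<omega>. f (\<omega> 0)) \<in> measurable one_seed N" by (rule measurable_compose[OF measurable_seed assms])
  then have "(\<lambda>\<omega>. f (\<omega> 0)) \<in> measurable (vimage_algebra {\<omega> :: nat \<Rightarrow> real. \<omega> 0 \<in> {0..<1}} (\<lambda>\<omega>. \<omega> 0) unit_measure) N"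
    by (simp add: one_seed_def)
  then show ?thesis unfolding one_seed_def by (subst distr_distr[OF _ measurable_const_seed]) (auto simp: comp_def)
qed

lemma AE_one_seed:
  assumes "AE u in unit_measure. P u" shows "AE \<omega> in one_seed. P (\<omega> 0)"
proof -
  obtain N where N: "{u \<in> space unit_measure. \<not> P u} \<subseteq> N" "emeasure unit_measure N = 0" "N \<in> sets unit_measure"
    using AE_E[OF assms] by blast
  have m: "(\<lambda>\<omega>. \<omega> 0) -` N \<inter> space one_seed \<in> sets one_seed" by (rule measurable_sets[OF measurable_seed N(3)])
  show ?thesis
  proof (rule AE_I[OF _ _ m])
    show "{\<omega> \<in> space one_seed. \<not> P (\<omega> 0)} \<subseteq> (\<lambda>\<omega>. \<omega> 0) -` N \<inter> space one_seed"
      using N(1) by (auto simp: space_one_seed)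
    have "distr one_seed unit_measure (\<lambda>\<omega>. \<omega> 0) = distr unit_measure unit_measure (\<lambda>u. u)"
      by (rule distr_one_seed) simp
    then have "emeasure (distr one_seed unit_measure (\<lambda>\<omega>. \<omega> 0)) N = emeasure unit_measure N"
      by (simp add: distr_id2)
    then show "emeasure one_seed ((\<lambda>\<omega>. \<omega> 0) -` N \<inter> space one_seed) = 0"
      using N by (simp add: emeasure_distr[OF measurable_seed N(3)])
  qed
qed

theorem theorem2p1:
  fixes V :: "('d::finite) site \<Rightarrow> ennreal" and \<alpha> :: real
  assumes "strictly_convex_pot V"
    and "V (\<lambda>_. 0) = 0"
    and "alpha_star V < \<infinity>"
    and "ereal \<alpha> > alpha_star V"
  shows "\<exists>(M :: (nat \<Rightarrow> real) measure) (\<zeta> :: 'd site set \<Rightarrow> (nat \<Rightarrow> real) \<Rightarrow> 'd perm).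
    prob_space M \<and>
    (\<forall>\<Lambda>. finite \<Lambda> \<or> \<Lambda> = UNIV \<longrightarrow>
        \<zeta> \<Lambda> \<in> measurable M SM \<and> (\<forall>\<omega> \<in> space M. \<zeta> \<Lambda> \<omega> \<in> SL \<Lambda> id)) \<and>
    (\<forall>\<Lambda>. finite \<Lambda> \<longrightarrow> distr M SM (\<zeta> \<Lambda>) = Gspec \<alpha> V \<Lambda> id) \<and>
    (\<forall>x. AE \<omega> in M. ((\<lambda>\<Lambda>. \<zeta> \<Lambda> \<omega> x) \<longlongrightarrow> \<zeta> UNIV \<omega> x) (finite_subsets_at_top UNIV)) \<and>
    (let \<mu> = distr M SM (\<zeta> UNIV) in
       weak_conv_net (\<lambda>\<Lambda>. Gspec \<alpha> V \<Lambda> id) \<mu> \<and>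
       gibbs \<alpha> V \<mu> \<and> ergodic \<mu> \<and> mean_jump_zero \<mu> \<and>
       (AE \<sigma> in \<mu>. finite_cycle_perm \<sigma>) \<and>
       (\<forall>\<nu>. gibbs \<alpha> V \<nu> \<and> (AE \<sigma> in \<nu>. finite_cycle_perm \<sigma>) \<longrightarrow> \<nu> = \<mu>))"
proof -
  obtain \<alpha>' where a: "0 < \<alpha>'" "\<alpha>' < \<alpha>" "beta V \<alpha>' < 1" using alpha_star_lessE[OF assms(4)] .
  define b where "b = enn2real (beta V \<alpha>')"
  have fin: "beta V \<alpha>' < \<top>" using a(3) by (rule less_trans) simp
  have b: "beta V \<alpha>' = ennreal b" using fin by (simp add: b_def)
  have b1: "b < 1" using a(3) unfolding b by (simp add: b_def ennreal_less_one_iff)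
  have b0: "0 \<le> b" by (simp add: b_def)
  \<comment> \<open>Two gases with the same \<open>b\<close>: the one at \<alpha> carries the
    construction, the one at \<alpha>' supplies the summable majorant for the jumps.\<close>
  interpret G': cycle_gas V \<alpha>' b
    by unfold_locales (use assms(2) a(1) b0 b1 b in auto)
  interpret G: cycle_gas V \<alpha> b
    by unfold_locales (use assms(2) a(1,2) b0 b1 b beta_antimono[of \<alpha>' \<alpha> V] in auto)
  obtain c where c: "0 < c" "\<And>\<gamma> x i. is_finite_cycle \<gamma> \<Longrightarrow> x \<in> csupp \<gamma> \<Longrightarrow> (\<Sum>y\<in>csupp \<gamma>. V (jump (\<gamma> y) y)) < \<top> \<Longrightarrow>
     c * \<bar>real_of_int (\<gamma> x i - x i)\<bar> \<le> enn2real (\<Sum>y\<in>csupp \<gamma>. V (jump (\<gamma> y) y))"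
    using cycle_energy_ge_jump[OF assms(1,2)] by blast
  have js: "(\<lambda>\<gamma>. \<bar>real_of_int (\<gamma> x i - x i)\<bar> * cweight \<alpha> V \<gamma>) summable_on through x" for x and i :: 'd
  proof (rule summable_on_comparison_test)
    have "(\<lambda>\<gamma>. cweight \<alpha>' V \<gamma> * 1) summable_on through x"
      by (rule G'.dominated_summable(1)) (use G'.card_csupp_ge_1 in fastforce)
    then show "(\<lambda>\<gamma>. 1 / (c * (\<alpha> - \<alpha>')) * cweight \<alpha>' V \<gamma>) summable_on through x"
      by (intro summable_on_cmult_right) simp
    show "\<bar>real_of_int (\<gamma> x i - x i)\<bar> * cweight \<alpha> V \<gamma> \<le> 1 / (c * (\<alpha> - \<alpha>')) * cweight \<alpha>' V \<gamma>"
      if "\<gamma> \<in> through x" for \<gamma>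
      by (rule jump_weight_le[OF c a(2) throughD(1,2)[OF that]])
  qed (simp add: cweight_nonneg)
  define \<zeta> where "\<zeta> = (\<lambda>\<Lambda> (\<omega> :: nat \<Rightarrow> real). G.sample \<Lambda> (\<omega> 0))"
  have distr: "distr one_seed SM (\<zeta> \<Lambda>) = distr unit_measure SM (G.sample \<Lambda>)" if "finite \<Lambda> \<or> \<Lambda> = UNIV" for \<Lambda>
    unfolding \<zeta>_def by (rule distr_one_seed[OF G.measurable_sample[OF that]])
  have mu: "distr one_seed SM (\<zeta> UNIV) = G.mu" by (simp add: distr G.mu_def)
  show ?thesis
    unfolding Let_def
  proof (intro exI[of _ one_seed] exI[of _ \<zeta>], unfold mu, intro conjI allI impI ballI)
    show "prob_space one_seed" by (rule prob_space_one_seed)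
    show "\<zeta> \<Lambda> \<in> measurable one_seed SM" if "finite \<Lambda> \<or> \<Lambda> = UNIV" for \<Lambda>
      unfolding \<zeta>_def by (rule measurable_compose[OF measurable_seed G.measurable_sample[OF that]])
    show "\<zeta> \<Lambda> \<omega> \<in> SL \<Lambda> id" if "finite \<Lambda> \<or> \<Lambda> = UNIV" "\<omega> \<in> space one_seed" for \<Lambda> \<omega>
      unfolding \<zeta>_def by (rule G.sample_in_SL[OF that(1)]) (use that(2) in \<open>simp add: space_one_seed\<close>)
    show "distr one_seed SM (\<zeta> \<Lambda>) = Gspec \<alpha> V \<Lambda> id" if "finite \<Lambda>" for \<Lambda>
      using that by (simp add: distr G.distr_sample)
    show "AE \<omega> in one_seed. ((\<lambda>\<Lambda>. \<zeta> \<Lambda> \<omega> x) \<longlongrightarrow> \<zeta> UNIV \<omega> x) (finite_subsets_at_top UNIV)" for x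
      using AE_one_seed[OF G.sample_eventually_eq] unfolding \<zeta>_def
      by eventually_elim (blast intro: tendsto_eventually)
    show "weak_conv_net (\<lambda>\<Lambda>. Gspec \<alpha> V \<Lambda> id) G.mu" by (rule G.weak_conv_mu)
    show "gibbs \<alpha> V G.mu" by (rule G.gibbs_mu)
    show "ergodic G.mu" by (rule G.ergodic_mu)
    show "mean_jump_zero G.mu" by (rule G.mean_jump_zero_mu[OF js])
    show "AE \<sigma> in G.mu. finite_cycle_perm \<sigma>" by (rule G.AE_mu_finite_cycle)
    show "\<nu> = G.mu" if "gibbs \<alpha> V \<nu> \<and> (AE \<sigma> in \<nu>. finite_cycle_perm \<sigma>)" for \<nu>
      using that G.gibbs_unique by blast
  qed
qed

end
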